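(* Let $M$ be a regular matroid on a finite ground set $E$ and let $(\sigma,\sigma^* )$ be a triangulating circuit-cocircuit signature of $M$. Suppose that $\vec f$ is an arc (with support $\{f\}$) and $B_1,B_2\in\mathbf B(M)$ are bases such that \[[\vec f]\cdot \beta_{(M,\sigma,\sigma^* )}(B_1)=\beta_{(M,\sigma,\sigma^* )}(B_2).\] Then: (1) For any $e\in (E\setminus(B_1\cup B_2))\setminus\{f\}$ we have $[\vec f]\cdot \beta_{(M\setminus e,\sigma\setminus e,\sigma^*\setminus e)}(B_1)=\beta_{(M\setminus e,\sigma\setminus e,\sigma^*\setminus e)}(B_2)$. (2) For any $e\in (B_1\cap B_2)\setminus\{f\}$ we have $[\vec f]\cdot \beta_{(M/e,\sigma/e,\sigma^*/e)}(B_1\setminus e)=\beta_{(M/e,\sigma/e,\sigma^*/e)}(B_2\setminus e)$. (3) For any $e\in E$ lying in a different connected component of $M$ than $f$, we have $e\in B_1\iff e\in B_2$.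
   Context: $M=M(A)$ is represented by a real totally unimodular $r\times|E|$ matrix $A$ of full row rank with columns indexed by $E$; bases are the $r$-subsets of $E$ indexing nonsingular $r\times r$ submatrices; circuits are minimal subsets contained in no basis, cocircuits are minimal subsets meeting every basis. Elements of $\mathbb Z^E$ are 1-chains; $\vec P(x)$ is the coefficient of $x$, $P$ the support, $\vec P\setminus e$ the restriction to $E\setminus\{e\}$. A 1-chain is simple if its coefficients lie in $\{-1,0,1\}$; an arc is a simple 1-chain with one-element support. A signed circuit (resp. signed cocircuit) is a simple 1-chain in $\ker A$ (resp. in the row space of $A$) whose support is a circuit (resp. cocircuit). An orientation is a map $\vec O:E\to\{+,-\}$; a 1-chain $\vec P$ is compatible with $\vec O$ ($\vec P\sim\vec O$) if for all $x\in P$ the sign of $\vec P(x)$ equals $\vec O(x)$. For $P\subseteq E$, $\mathrm{rev}_P(\vec O)$ switches the signs of $\vec O$ on $P$. Orientations are circuit-cocircuit equivalent if related by a sequence of moves $\vec O\mapsto\mathrm{rev}_C(\vec O)$ with $\vec C$ a signed circuit or signed cocircuit compatible with $\vec O$; $[\vec O]$ denotes the class. The sandpile group is $S(M)=\mathbb Z^E/(\Lambda+\Lambda^* )$ where $\Lambda,\Lambda^*$ are the lattices generated by signed circuits and signed cocircuits; $[\vec P]$ is the class of $\vec P$. The canonical action of $S(M)$ on equivalence classes is determined by: for an arc $\vec f$ and a class $G$, choose $\vec O\in G$ with $-\vec f\sim\vec O$ (one always exists) and set $[\vec f]\cdot G=[\mathrm{rev}_{\{f\}}(\vec O)]$; this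 is a well-defined simply transitive action. A circuit signature $\sigma$ chooses for each circuit $C$ one of its two signed circuits $\sigma(C)$; a cocircuit signature $\sigma^*$ likewise for cocircuits. A fourientation is a map $\vec F:E\to\{\emptyset,+,-,\pm\}$ (subsets of $\{+,-\}$); $-\vec F$ swaps $+$ and $-$, $\vec F^c(x)=\{+,-\}\setminus\vec F(x)$, intersections are pointwise; $\vec P\sim\vec F$ if for every $x\in P$ the sign of $\vec P(x)$ lies in $\vec F(x)$. For a basis $B$, $e\notin B$ has fundamental circuit $C_e\subseteq B\cup\{e\}$ and $e\in B$ has fundamental cocircuit $C^*_e\subseteq(E\setminus B)\cup\{e\}$. $\vec F(B,\sigma)$ is $\pm$ on $B$ and equals the sign of $\sigma(C_x)(x)$ at $x\notin B$; $\vec F(B,\sigma^* )$ is $\pm$ on $E\setminus B$ and equals the sign of $\sigma^*(C^*_x)(x)$ at $x\in B$. $\sigma$ is triangulating if for distinct bases $B_1,B_2$ no signed circuit is compatible with $\vec F(B_1,\sigma)\cap-\vec F(B_2,\sigma)$; $\sigma^*$ is triangulating if likewise no signed cocircuit is compatible with $\vec F(B_1,\sigma^* )\cap-\vec F(B_2,\sigma^* )$; $(\sigma,\sigma^* )$ is triangulating if both are. An orientation is $(\sigma,\sigma^* )$-compatible if every signed circuit compatible with it is in $\sigma$ and every signed cocircuit compatible with it is in $\sigma^*$; for triangulating $(\sigma,\sigma^* )$ each equivalence class contains exactly one such orientation, denoted $[\vec O]^\circ$, and for $s\in S(M)$ and $(\sigma,\sigma^* )$-compatible $\vec O$ one sets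 $s\cdot\vec O:=(s\cdot[\vec O])^\circ$. The BBY map is $\beta_{(M,\sigma,\sigma^* )}(B)=\vec F(B,\sigma)\cap\vec F(B,\sigma^* )$, a bijection from bases onto $(\sigma,\sigma^* )$-compatible orientations. Minors: for $e$ not a coloop, $M\setminus e$ has ground set $E\setminus\{e\}$, bases $\{B:e\notin B\}$ and is represented by $A$ with column $e$ deleted; for $e$ not a loop, $M/e$ has bases $\{B\setminus e:e\in B\}$. Signed circuits of $M\setminus e$ are $\vec C\setminus e$ for signed circuits $\vec C$ of $M$ with $\vec C(e)=0$; signed circuits of $M/e$ are the support-minimal nonzero 1-chains among $\{\vec C\setminus e\}$; dually, signed cocircuits of $M/e$ are $\vec C^*\setminus e$ with $\vec C^*(e)=0$, and those of $M\setminus e$ are the support-minimal nonzero ones among $\{\vec C^*\setminus e\}$. $\sigma\setminus e=\{\vec C\setminus e:\vec C\in\sigma\}\cap\{\text{signed circuits of }M\setminus e\}$, $\sigma/e$ analogously with $M/e$, and similarly for $\sigma^*$; these are triangulating signatures of the minors. Connected components of $M$ are the classes of the relation "there is a circuit containing both elements" (together with equality). *)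

theory Defs
  imports
    "Jordan_Normal_Form.Determinant"
    "HOL-Algebra.Generated_Groups"
    "HOL-Algebra.Group_Action"
begin

text \<open>A matrix with \<open>r\<close> rows and columns indexed by \<open>E\<close> is a function
  \<open>A :: nat \<Rightarrow> 'e \<Rightarrow> real\<close>, of which only the entries \<open>A i e\<close> with \<open>i < r\<close> and
  \<open>e \<in> E\<close> are relevant.  Rows and columns of a submatrix are listed in an arbitrary order,
  which affects its determinant only by a sign.\<close>

definition submatrix_of :: "(nat \<Rightarrow> 'e \<Rightarrow> real) \<Rightarrow> nat list \<Rightarrow> 'e list \<Rightarrow> real mat" where
  "submatrix_of A is js = mat (length is) (length js) (\<lambda>(i, j). A (is ! i) (js ! j))"

definition totally_unimodular :: "nat \<Rightarrow> 'e set \<Rightarrow> (nat \<Rightarrow> 'e \<Rightarrow> real) \<Rightarrow> bool" where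
  "totally_unimodular r E A \<longleftrightarrow>
     (\<forall>is js. distinct is \<and> set is \<subseteq> {..<r} \<and> distinct js \<and> set js \<subseteq> E \<and> length is = length js
        \<longrightarrow> det (submatrix_of A is js) \<in> {-1, 0, 1})"

definition full_row_rank :: "nat \<Rightarrow> 'e set \<Rightarrow> (nat \<Rightarrow> 'e \<Rightarrow> real) \<Rightarrow> bool" where
  "full_row_rank r E A \<longleftrightarrow>
     (\<forall>c. (\<forall>e\<in>E. (\<Sum>i<r. c i * A i e) = 0) \<longrightarrow> (\<forall>i<r. c i = 0))"

text \<open>An element of \<open>\<int>\<^sup>E\<close> is a function on the whole type that vanishes outside \<open>E\<close>.  Hence
  restriction to \<open>E - {e}\<close> amounts to setting the coefficient of \<open>e\<close> to \<open>0\<close>.\<close>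

type_synonym 'e chain = "'e \<Rightarrow> int"

definition chain_supp :: "'e chain \<Rightarrow> 'e set" where
  "chain_supp P = {x. P x \<noteq> 0}"

definition chains :: "'e set \<Rightarrow> 'e chain set" where
  "chains E = {P. chain_supp P \<subseteq> E}"

definition simple_chain :: "'e set \<Rightarrow> 'e chain \<Rightarrow> bool" where
  "simple_chain E P \<longleftrightarrow> P \<in> chains E \<and> (\<forall>x. P x \<in> {-1, 0, 1})"

definition is_arc :: "'e set \<Rightarrow> 'e chain \<Rightarrow> bool" where
  "is_arc E P \<longleftrightarrow> simple_chain E P \<and> (\<exists>x. chain_supp P = {x})"

definition chain_restrict :: "'e \<Rightarrow> 'e chain \<Rightarrow> 'e chain" where
  "chain_restrict e P = P(e := 0)"

definition supp_minimal :: "'e chain set \<Rightarrow> 'e chain set" where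
  "supp_minimal S =
     {P \<in> S. chain_supp P \<noteq> {} \<and> \<not> (\<exists>Q\<in>S. chain_supp Q \<noteq> {} \<and> chain_supp Q \<subset> chain_supp P)}"

definition in_kernel :: "nat \<Rightarrow> 'e set \<Rightarrow> (nat \<Rightarrow> 'e \<Rightarrow> real) \<Rightarrow> 'e chain \<Rightarrow> bool" where
  "in_kernel r E A P \<longleftrightarrow> (\<forall>i<r. (\<Sum>e\<in>E. A i e * of_int (P e)) = 0)"

definition in_row_space :: "nat \<Rightarrow> 'e set \<Rightarrow> (nat \<Rightarrow> 'e \<Rightarrow> real) \<Rightarrow> 'e chain \<Rightarrow> bool" where
  "in_row_space r E A P \<longleftrightarrow> (\<exists>c. \<forall>e\<in>E. of_int (P e) = (\<Sum>i<r. c i * A i e))"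

text \<open>A represented regular matroid is recorded together with its signed circuits and signed
  cocircuits, so that minors can be formed without choosing a representing matrix.\<close>

record 'e signed_matroid =
  ground :: "'e set"
  bases :: "'e set set"
  signed_circuits :: "'e chain set"
  signed_cocircuits :: "'e chain set"

definition circuits_of :: "'e set \<Rightarrow> 'e set set \<Rightarrow> 'e set set" where
  "circuits_of E \<B> =
     {C. C \<subseteq> E \<and> \<not> (\<exists>B\<in>\<B>. C \<subseteq> B) \<and> (\<forall>D. D \<subset> C \<longrightarrow> (\<exists>B\<in>\<B>. D \<subseteq> B))}"

definition cocircuits_of :: "'e set \<Rightarrow> 'e set set \<Rightarrow> 'e set set" where
  "cocircuits_of E \<B> =
     {C. C \<subseteq> E \<and> (\<forall>B\<in>\<B>. C \<inter> B \<noteq> {}) \<and> (\<forall>D. D \<subset> C \<longrightarrow> (\<exists>B\<in>\<B>. D \<inter> B = {}))}"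

definition circuits :: "'e signed_matroid \<Rightarrow> 'e set set" where
  "circuits M = circuits_of (ground M) (bases M)"

definition cocircuits :: "'e signed_matroid \<Rightarrow> 'e set set" where
  "cocircuits M = cocircuits_of (ground M) (bases M)"

definition bases_of_matrix :: "nat \<Rightarrow> 'e set \<Rightarrow> (nat \<Rightarrow> 'e \<Rightarrow> real) \<Rightarrow> 'e set set" where
  "bases_of_matrix r E A =
     {set js | js. distinct js \<and> set js \<subseteq> E \<and> length js = r \<and> det (submatrix_of A [0..<r] js) \<noteq> 0}"

definition matroid_of_matrix :: "nat \<Rightarrow> 'e set \<Rightarrow> (nat \<Rightarrow> 'e \<Rightarrow> real) \<Rightarrow> 'e signed_matroid" where
  "matroid_of_matrix r E A =
     (let \<B> = bases_of_matrix r E A in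
      \<lparr> ground = E,
        bases = \<B>,
        signed_circuits =
          {P. simple_chain E P \<and> in_kernel r E A P \<and> chain_supp P \<in> circuits_of E \<B>},
        signed_cocircuits =
          {P. simple_chain E P \<and> in_row_space r E A P \<and> chain_supp P \<in> cocircuits_of E \<B>} \<rparr>)"

text \<open>Deletion is meant for elements that are not coloops, contraction for elements that are not
  loops.\<close>

definition deletion :: "'e signed_matroid \<Rightarrow> 'e \<Rightarrow> 'e signed_matroid" where
  "deletion M e =
     \<lparr> ground = ground M - {e},
       bases = {B \<in> bases M. e \<notin> B},
       signed_circuits = chain_restrict e ` {P \<in> signed_circuits M. P e = 0},
       signed_cocircuits = supp_minimal (chain_restrict e ` signed_cocircuits M) \<rparr>"

definition contraction :: "'e signed_matroid \<Rightarrow> 'e \<Rightarrow> 'e signed_matroid" where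
  "contraction M e =
     \<lparr> ground = ground M - {e},
       bases = {B - {e} | B. B \<in> bases M \<and> e \<in> B},
       signed_circuits = supp_minimal (chain_restrict e ` signed_circuits M),
       signed_cocircuits = chain_restrict e ` {P \<in> signed_cocircuits M. P e = 0} \<rparr>"

definition component :: "'e signed_matroid \<Rightarrow> 'e \<Rightarrow> 'e set" where
  "component M x = {y \<in> ground M. y = x \<or> (\<exists>C\<in>circuits M. x \<in> C \<and> y \<in> C)}"

text \<open>The signs \<open>+\<close> and \<open>-\<close> are the integers \<open>1\<close> and \<open>-1\<close>.  A fourientation assigns to every
  element of \<open>E\<close> a subset of \<open>{1, -1}\<close>, and \<open>{}\<close> to everything outside \<open>E\<close>.  An orientation is
  identified with the fourientation whose values on \<open>E\<close> are the corresponding singletons, so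
  that both notions share compatibility and sign reversal.\<close>

type_synonym 'e fourientation = "'e \<Rightarrow> int set"

definition orientations :: "'e set \<Rightarrow> 'e fourientation set" where
  "orientations E = {F. (\<forall>x\<in>E. F x = {1} \<or> F x = {-1}) \<and> (\<forall>x. x \<notin> E \<longrightarrow> F x = {})}"

definition chain_compatible :: "'e chain \<Rightarrow> 'e fourientation \<Rightarrow> bool" where
  "chain_compatible P F \<longleftrightarrow> (\<forall>x\<in>chain_supp P. sgn (P x) \<in> F x)"

definition four_neg :: "'e fourientation \<Rightarrow> 'e fourientation" where
  "four_neg F = (\<lambda>x. uminus ` F x)"

definition four_inter :: "'e fourientation \<Rightarrow> 'e fourientation \<Rightarrow> 'e fourientation" where
  "four_inter F F' = (\<lambda>x. F x \<inter> F' x)"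

definition reverse_on :: "'e set \<Rightarrow> 'e fourientation \<Rightarrow> 'e fourientation" where
  "reverse_on P F = (\<lambda>x. if x \<in> P then uminus ` F x else F x)"

definition cc_move :: "'e signed_matroid \<Rightarrow> 'e fourientation \<Rightarrow> 'e fourientation \<Rightarrow> bool" where
  "cc_move M F F' \<longleftrightarrow>
     (\<exists>P \<in> signed_circuits M \<union> signed_cocircuits M.
        chain_compatible P F \<and> F' = reverse_on (chain_supp P) F)"

definition cc_class :: "'e signed_matroid \<Rightarrow> 'e fourientation \<Rightarrow> 'e fourientation set" where
  "cc_class M F = {F' \<in> orientations (ground M). (cc_move M)\<^sup>*\<^sup>* F F'}"

definition cc_classes :: "'e signed_matroid \<Rightarrow> 'e fourientation set set" where
  "cc_classes M = cc_class M ` orientations (ground M)"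

definition chain_group :: "'e set \<Rightarrow> 'e chain monoid" where
  "chain_group E = \<lparr> carrier = chains E, mult = (\<lambda>P Q x. P x + Q x), one = (\<lambda>_. 0) \<rparr>"

definition cc_lattice :: "'e signed_matroid \<Rightarrow> 'e chain set" where
  "cc_lattice M =
     (let G = chain_group (ground M)
      in generate G (signed_circuits M) <#>\<^bsub>G\<^esub> generate G (signed_cocircuits M))"

definition sandpile_group :: "'e signed_matroid \<Rightarrow> 'e chain set monoid" where
  "sandpile_group M = chain_group (ground M) Mod cc_lattice M"

definition sandpile_class :: "'e signed_matroid \<Rightarrow> 'e chain \<Rightarrow> 'e chain set" where
  "sandpile_class M P = cc_lattice M #>\<^bsub>chain_group (ground M)\<^esub> P"

text \<open>As the classes of arcs generate the sandpile group and every class of orientations contains,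
  for each arc \<open>a\<close>, an orientation compatible with \<open>-a\<close>, at most one action has this property.
  Extensionality only fixes the value of the action outside the group.\<close>

definition is_canonical_action ::
    "'e signed_matroid \<Rightarrow> ('e chain set \<Rightarrow> 'e fourientation set \<Rightarrow> 'e fourientation set) \<Rightarrow> bool"
  where
  "is_canonical_action M \<phi> \<longleftrightarrow>
     group_action (sandpile_group M) (cc_classes M) \<phi> \<and>
     \<phi> \<in> extensional (carrier (sandpile_group M)) \<and>
     (\<forall>a G F. is_arc (ground M) a \<and> G \<in> cc_classes M \<and> F \<in> G \<and> chain_compatible (\<lambda>x. - a x) F
        \<longrightarrow> \<phi> (sandpile_class M a) G = cc_class M (reverse_on (chain_supp a) F))"

definition canonical_action ::
    "'e signed_matroid \<Rightarrow> 'e chain set \<Rightarrow> 'e fourientation set \<Rightarrow> 'e fourientation set" where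
  "canonical_action M = (THE \<phi>. is_canonical_action M \<phi>)"

text \<open>A signature is the set of the chosen signed (co)circuits; \<open>chosen \<sigma> C\<close> is the one it chooses
  for the (co)circuit \<open>C\<close>.\<close>

definition circuit_signature :: "'e signed_matroid \<Rightarrow> 'e chain set \<Rightarrow> bool" where
  "circuit_signature M \<sigma> \<longleftrightarrow>
     \<sigma> \<subseteq> signed_circuits M \<and> (\<forall>C\<in>circuits M. \<exists>!P. P \<in> \<sigma> \<and> chain_supp P = C)"

definition cocircuit_signature :: "'e signed_matroid \<Rightarrow> 'e chain set \<Rightarrow> bool" where
  "cocircuit_signature M \<sigma>' \<longleftrightarrow>
     \<sigma>' \<subseteq> signed_cocircuits M \<and> (\<forall>C\<in>cocircuits M. \<exists>!P. P \<in> \<sigma>' \<and> chain_supp P = C)"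

definition chosen :: "'e chain set \<Rightarrow> 'e set \<Rightarrow> 'e chain" where
  "chosen \<sigma> C = (THE P. P \<in> \<sigma> \<and> chain_supp P = C)"

definition fund_circuit :: "'e signed_matroid \<Rightarrow> 'e set \<Rightarrow> 'e \<Rightarrow> 'e set" where
  "fund_circuit M B x = (THE C. C \<in> circuits M \<and> C \<subseteq> B \<union> {x})"

definition fund_cocircuit :: "'e signed_matroid \<Rightarrow> 'e set \<Rightarrow> 'e \<Rightarrow> 'e set" where
  "fund_cocircuit M B x = (THE C. C \<in> cocircuits M \<and> C \<subseteq> (ground M - B) \<union> {x})"

definition circuit_four ::
    "'e signed_matroid \<Rightarrow> 'e chain set \<Rightarrow> 'e set \<Rightarrow> 'e fourientation" where
  "circuit_four M \<sigma> B = (\<lambda>x.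
     if x \<notin> ground M then {}
     else if x \<in> B then {1, -1}
     else {sgn (chosen \<sigma> (fund_circuit M B x) x)})"

definition cocircuit_four ::
    "'e signed_matroid \<Rightarrow> 'e chain set \<Rightarrow> 'e set \<Rightarrow> 'e fourientation" where
  "cocircuit_four M \<sigma>' B = (\<lambda>x.
     if x \<notin> ground M then {}
     else if x \<notin> B then {1, -1}
     else {sgn (chosen \<sigma>' (fund_cocircuit M B x) x)})"

definition triangulating_circuit_signature :: "'e signed_matroid \<Rightarrow> 'e chain set \<Rightarrow> bool" where
  "triangulating_circuit_signature M \<sigma> \<longleftrightarrow>
     circuit_signature M \<sigma> \<and>
     (\<forall>B1\<in>bases M. \<forall>B2\<in>bases M. B1 \<noteq> B2 \<longrightarrow>
        \<not> (\<exists>P\<in>signed_circuits M.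
             chain_compatible P (four_inter (circuit_four M \<sigma> B1) (four_neg (circuit_four M \<sigma> B2)))))"

definition triangulating_cocircuit_signature :: "'e signed_matroid \<Rightarrow> 'e chain set \<Rightarrow> bool" where
  "triangulating_cocircuit_signature M \<sigma>' \<longleftrightarrow>
     cocircuit_signature M \<sigma>' \<and>
     (\<forall>B1\<in>bases M. \<forall>B2\<in>bases M. B1 \<noteq> B2 \<longrightarrow>
        \<not> (\<exists>P\<in>signed_cocircuits M.
             chain_compatible P (four_inter (cocircuit_four M \<sigma>' B1) (four_neg (cocircuit_four M \<sigma>' B2)))))"

definition triangulating :: "'e signed_matroid \<Rightarrow> 'e chain set \<Rightarrow> 'e chain set \<Rightarrow> bool" where
  "triangulating M \<sigma> \<sigma>' \<longleftrightarrow>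
     triangulating_circuit_signature M \<sigma> \<and> triangulating_cocircuit_signature M \<sigma>'"

definition compatible_orientation ::
    "'e signed_matroid \<Rightarrow> 'e chain set \<Rightarrow> 'e chain set \<Rightarrow> 'e fourientation \<Rightarrow> bool" where
  "compatible_orientation M \<sigma> \<sigma>' F \<longleftrightarrow>
     F \<in> orientations (ground M) \<and>
     (\<forall>P\<in>signed_circuits M. chain_compatible P F \<longrightarrow> P \<in> \<sigma>) \<and>
     (\<forall>P\<in>signed_cocircuits M. chain_compatible P F \<longrightarrow> P \<in> \<sigma>')"

definition compatible_rep ::
    "'e signed_matroid \<Rightarrow> 'e chain set \<Rightarrow> 'e chain set \<Rightarrow> 'e fourientation set \<Rightarrow> 'e fourientation" where
  "compatible_rep M \<sigma> \<sigma>' G = (THE F. F \<in> G \<and> compatible_orientation M \<sigma> \<sigma>' F)"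

definition sandpile_act ::
    "'e signed_matroid \<Rightarrow> 'e chain set \<Rightarrow> 'e chain set \<Rightarrow> 'e chain set \<Rightarrow>
     'e fourientation \<Rightarrow> 'e fourientation" where
  "sandpile_act M \<sigma> \<sigma>' s F = compatible_rep M \<sigma> \<sigma>' (canonical_action M s (cc_class M F))"

definition bby :: "'e signed_matroid \<Rightarrow> 'e chain set \<Rightarrow> 'e chain set \<Rightarrow> 'e set \<Rightarrow> 'e fourientation"
  where
  "bby M \<sigma> \<sigma>' B = four_inter (circuit_four M \<sigma> B) (cocircuit_four M \<sigma>' B)"

definition sig_delete :: "'e signed_matroid \<Rightarrow> 'e chain set \<Rightarrow> 'e \<Rightarrow> 'e chain set" where
  "sig_delete M \<sigma> e = chain_restrict e ` \<sigma> \<inter> signed_circuits (deletion M e)"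

definition sig_contract :: "'e signed_matroid \<Rightarrow> 'e chain set \<Rightarrow> 'e \<Rightarrow> 'e chain set" where
  "sig_contract M \<sigma> e = chain_restrict e ` \<sigma> \<inter> signed_circuits (contraction M e)"

definition cosig_delete :: "'e signed_matroid \<Rightarrow> 'e chain set \<Rightarrow> 'e \<Rightarrow> 'e chain set" where
  "cosig_delete M \<sigma>' e = chain_restrict e ` \<sigma>' \<inter> signed_cocircuits (deletion M e)"

definition cosig_contract :: "'e signed_matroid \<Rightarrow> 'e chain set \<Rightarrow> 'e \<Rightarrow> 'e chain set" where
  "cosig_contract M \<sigma>' e = chain_restrict e ` \<sigma>' \<inter> signed_cocircuits (contraction M e)"

end

theory Submission
  imports Defs
begin

text \<open>Let \<open>V\<close> and \<open>W\<close> be the integer points of the kernel and of the row space of \<open>A\<close>.  All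
  arguments are symmetric under exchanging \<open>V\<close> and \<open>W\<close> and complementing bases, and this duality
  turns statements about deletion into statements about contraction.

  Two orientations are equivalent iff their difference lies in \<open>V + W\<close>, so the hypothesis of the
  theorem says that \<open>(O\<^sub>2 - O\<^sub>1) / 2 - f = v + w\<close> where \<open>O\<^sub>i\<close> is the BBY orientation of \<open>B\<^sub>i\<close>.  As
  \<open>v\<close> and \<open>w\<close> are orthogonal and the coefficients of \<open>v + w\<close> off \<open>f\<close> are \<open>-1\<close>, \<open>0\<close> or \<open>1\<close>, the
  supports of \<open>v\<close> and \<open>w\<close> are disjoint, or they meet in \<open>f\<close> and exactly one further element \<open>g\<close>.
  Suppose that \<open>v e \<noteq> 0\<close> for some \<open>e \<noteq> f\<close> outside \<open>B\<^sub>1 \<union> B\<^sub>2\<close>.  The Farkas alternative at \<open>g\<close> (at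
  \<open>f\<close> if the supports are disjoint) yields a signed circuit \<open>u\<close> for which \<open>v + u\<close> contradicts that
  \<open>\<sigma>\<close> is triangulating, or a signed cocircuit \<open>u\<close> for which \<open>w - u\<close> contradicts that \<open>\<sigma>'\<close> is
  triangulating.  Hence \<open>v\<close> vanishes at \<open>e\<close> and the equation passes to the deletion of \<open>e\<close>.  For the
  last claim, an element of the symmetric difference of \<open>B\<^sub>1\<close> and \<open>B\<^sub>2\<close> lies on a circuit on which
  \<open>O\<^sub>1\<close> and \<open>O\<^sub>2\<close> cannot agree, and any element where they disagree is connected to \<open>f\<close> through the
  supports of \<open>v\<close> and \<open>w\<close>.

  That every class contains a compatible orientation is a counting argument: the BBY map is
  injective, and there are at most as many classes as bases because the orientations that are
  compatible with a lexicographic signature satisfy a deletion-contraction inequality.\<close>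

section \<open>Orthogonal pairs of regular lattices\<close>

text \<open>The products \<open>v x * w x\<close> sum to zero. Away from \<open>f\<close> a positive
  product would force \<open>v x + w x\<close> to have absolute value at least 2, so all these
  products are at most 0; at \<open>f\<close> a positive product can only be 1. This is why at most
  one further common element \<open>g\<close> exists.

  The element \<open>g\<close> is the obstacle to the vanishing of \<open>v\<close> at
  \<open>e\<close>: there \<open>v\<close> is nonzero although the orientations agree. If
  \<open>v\<close> followed the change from the first orientation to the second on its whole
  support, it would contradict the triangulating condition by itself. The circuit \<open>u\<close>
  of the Farkas alternative is chosen to cancel \<open>v\<close> at \<open>g\<close> while avoiding
  \<open>e\<close>.

  The action on orientations picks the compatible member of a class by a description operator. The
  hypothesis therefore says nothing about lattices until every class is known to have such a member,
  and this is what the counting provides. In a minor the member is exhibited: the restricted BBY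
  orientation is shown to be compatible there, and uniqueness within a class evaluates the
  operator.\<close>

definition conformal :: "'e chain \<Rightarrow> 'e chain \<Rightarrow> bool" where
  "conformal u v \<longleftrightarrow> (\<forall>x. u x \<noteq> 0 \<longrightarrow> sgn (u x) = sgn (v x))"

lemma conformal_trans: "conformal u v \<Longrightarrow> conformal v w \<Longrightarrow> conformal u w"
  by (metis conformal_def sgn_0_0)

text \<open>These are the signed circuits of the matroid with circuit lattice \<open>V\<close>,
  described by the lattice alone. Without bases in the definition, duality and the passage to minors
  only replace the lattice.\<close>

definition elementary :: "'e chain set \<Rightarrow> 'e chain set" where
  "elementary V = {P \<in> V. P \<noteq> (\<lambda>_. 0) \<and> (\<forall>x. P x \<in> {-1, 0, 1}) \<and>
     (\<forall>Q\<in>V. Q \<noteq> (\<lambda>_. 0) \<and> chain_supp Q \<subseteq> chain_supp P \<longrightarrow> chain_supp Q = chain_supp P)}"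

text \<open>The exchange property is part of \<open>fund\<close> and \<open>cofund\<close>, which makes the locale self-dual and
  closed under minors without any reference to a representing matrix.\<close>

locale regular_pair =
  fixes E :: "'e set" and BB :: "'e set set" and V W :: "'e chain set"
  assumes finite_E: "finite E"
    and bases_ne: "BB \<noteq> {}"
    and bases_sub: "B \<in> BB \<Longrightarrow> B \<subseteq> E"
    and V_sub: "V \<subseteq> chains E"
    and W_sub: "W \<subseteq> chains E"
    and V_zero: "(\<lambda>_. 0) \<in> V"
    and W_zero: "(\<lambda>_. 0) \<in> W"
    and V_diff: "u \<in> V \<Longrightarrow> v \<in> V \<Longrightarrow> (\<lambda>x. u x - v x) \<in> V"
    and W_diff: "u \<in> W \<Longrightarrow> v \<in> W \<Longrightarrow> (\<lambda>x. u x - v x) \<in> W"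
    and orth: "v \<in> V \<Longrightarrow> w \<in> W \<Longrightarrow> (\<Sum>x\<in>E. v x * w x) = 0"
    and fund: "B \<in> BB \<Longrightarrow> x \<in> E - B \<Longrightarrow>
      \<exists>c\<in>V. c x = 1 \<and> (\<forall>y. c y \<in> {-1, 0, 1}) \<and> (\<forall>y. c y \<noteq> 0 \<longrightarrow> y \<in> insert x B) \<and>
        (\<forall>y\<in>B. c y \<noteq> 0 \<longrightarrow> insert x (B - {y}) \<in> BB)"
    and cofund: "B \<in> BB \<Longrightarrow> y \<in> B \<Longrightarrow>
      \<exists>c\<in>W. c y = 1 \<and> (\<forall>x. c x \<in> {-1, 0, 1}) \<and> (\<forall>x. c x \<noteq> 0 \<longrightarrow> x \<in> insert y (E - B)) \<and>
        (\<forall>x\<in>E - B. c x \<noteq> 0 \<longrightarrow> insert x (B - {y}) \<in> BB)"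
begin

text \<open>Complementing bases exchanges the entering and the leaving element of an exchange step,
  which turns \<open>fund\<close> into \<open>cofund\<close> and conversely.\<close>

lemma dual: "regular_pair E ((\<lambda>B. E - B) ` BB) W V"
proof
  show "finite E" by (rule finite_E)
  show "(\<lambda>B. E - B) ` BB \<noteq> {}" using bases_ne by simp
  show "\<And>B. B \<in> (\<lambda>B. E - B) ` BB \<Longrightarrow> B \<subseteq> E" by auto
  show "\<And>v w. v \<in> W \<Longrightarrow> w \<in> V \<Longrightarrow> (\<Sum>x\<in>E. v x * w x) = 0"
    by (subst mult.commute) (rule orth)
next
  fix B x assume "B \<in> (\<lambda>B. E - B) ` BB" and x: "x \<in> E - B"
  then obtain B0 where B0: "B0 \<in> BB" "B = E - B0" by auto
  have sub: "B0 \<subseteq> E" using bases_sub B0 by blast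
  have x0: "x \<in> B0" using x B0 by auto
  have eq: "insert x (B - {y}) = E - insert y (B0 - {x})" if "y \<in> B" for y
    using that x0 B0 sub by auto
  obtain c where c: "c \<in> W" "c x = 1" "\<forall>x. c x \<in> {-1, 0, 1}"
    "\<forall>z. c z \<noteq> 0 \<longrightarrow> z \<in> insert x (E - B0)"
    "\<forall>z\<in>E - B0. c z \<noteq> 0 \<longrightarrow> insert z (B0 - {x}) \<in> BB"
    using cofund[OF B0(1) x0] by auto
  show "\<exists>c\<in>W. c x = 1 \<and> (\<forall>y. c y \<in> {-1, 0, 1}) \<and> (\<forall>y. c y \<noteq> 0 \<longrightarrow> y \<in> insert x B) \<and>
        (\<forall>y\<in>B. c y \<noteq> 0 \<longrightarrow> insert x (B - {y}) \<in> (\<lambda>B. E - B) ` BB)"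
    using c eq B0(2) by (intro bexI[of _ c]) auto
next
  fix B x assume "B \<in> (\<lambda>B. E - B) ` BB" and x: "x \<in> B"
  then obtain B0 where B0: "B0 \<in> BB" "B = E - B0" by auto
  have sub: "B0 \<subseteq> E" using bases_sub B0 by blast
  have x0: "x \<in> E - B0" using x B0 by auto
  have eq: "insert y (B - {x}) = E - insert x (B0 - {y})" if "y \<in> E - B" for y
    using that x0 B0 sub by auto
  have EB: "E - B = B0" using B0 sub by auto
  obtain c where c: "c \<in> V" "c x = 1" "\<forall>x. c x \<in> {-1, 0, 1}"
    "\<forall>z. c z \<noteq> 0 \<longrightarrow> z \<in> insert x B0"
    "\<forall>z\<in>B0. c z \<noteq> 0 \<longrightarrow> insert x (B0 - {z}) \<in> BB"
    using fund[OF B0(1) x0] by auto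
  show "\<exists>c\<in>V. c x = 1 \<and> (\<forall>y. c y \<in> {-1, 0, 1}) \<and> (\<forall>y. c y \<noteq> 0 \<longrightarrow> y \<in> insert x (E - B)) \<and>
        (\<forall>y\<in>E - B. c y \<noteq> 0 \<longrightarrow> insert y (B - {x}) \<in> (\<lambda>B. E - B) ` BB)"
    using c eq EB by (intro bexI[of _ c]) auto
qed (use V_sub W_sub V_zero W_zero V_diff W_diff in auto)

lemma V_uminus: "v \<in> V \<Longrightarrow> (\<lambda>x. - v x) \<in> V"
  using V_diff[OF V_zero, of v] by simp

lemma V_add:
  assumes "u \<in> V" "v \<in> V"
  shows "(\<lambda>x. u x + v x) \<in> V"
  using V_diff[OF assms(1) V_uminus[OF assms(2)]] by simp

lemma V_scale:
  assumes "v \<in> V"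
  shows "(\<lambda>x. k * v x) \<in> V"
proof (induction k rule: int_induct[of _ 0])
  case base
  show ?case using V_zero by simp
next
  case (step1 i)
  show ?case using V_add[OF step1(2) assms] by (simp add: algebra_simps)
next
  case (step2 i)
  show ?case using V_diff[OF step2(2) assms] by (simp add: algebra_simps)
qed

lemma V_supp: "v \<in> V \<Longrightarrow> v x \<noteq> 0 \<Longrightarrow> x \<in> E"
  using V_sub by (auto simp: chains_def chain_supp_def)

text \<open>Only one term of the orthogonality sum survives. In matroid terms, a circuit and a
  cocircuit never meet in exactly one element.\<close>

lemma orth_single:
  assumes "v \<in> V" "w \<in> W" "x \<in> E" "\<And>y. y \<in> E \<Longrightarrow> y \<noteq> x \<Longrightarrow> v y * w y = 0"
  shows "v x * w x = 0"
proof -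
  have "(\<Sum>y\<in>E. v y * w y) = v x * w x + (\<Sum>y\<in>E - {x}. v y * w y)"
    using finite_E assms(3) by (rule sum.remove)
  moreover have "(\<Sum>y\<in>E - {x}. v y * w y) = 0"
    using assms(4) by (intro sum.neutral) auto
  ultimately show ?thesis using orth[OF assms(1,2)] by simp
qed

text \<open>The fundamental cocircuit of \<open>y\<close> meets \<open>B\<close> in \<open>y\<close>
  only, so orthogonality forces \<open>v y = 0\<close>.\<close>

lemma basis_independent:
  assumes B: "B \<in> BB" and v: "v \<in> V" and sup: "\<And>x. v x \<noteq> 0 \<Longrightarrow> x \<in> B"
  shows "v = (\<lambda>_. 0)"
proof (rule ext, rule ccontr)
  fix y assume y: "v y \<noteq> 0"
  then have yB: "y \<in> B" using sup by blast
  obtain c where c: "c \<in> W" "c y = 1" "\<forall>x. c x \<noteq> 0 \<longrightarrow> x \<in> insert y (E - B)"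
    using cofund[OF B yB] by auto
  have "v y * c y = 0"
    using c sup by (intro orth_single[OF v c(1) V_supp[OF v y]]) auto
  then show False using c y by simp
qed

text \<open>Take a basis meeting \<open>D\<close> in as many elements as possible. If it misses some
  \<open>x\<close> in \<open>D\<close>, the fundamental circuit of \<open>x\<close> is not contained
  in \<open>D\<close>, and exchanging \<open>x\<close> for an element outside \<open>D\<close>
  enlarges the intersection.\<close>

lemma independent_in_basis:
  assumes D: "D \<subseteq> E" and ind: "\<And>v. v \<in> V \<Longrightarrow> chain_supp v \<subseteq> D \<Longrightarrow> v = (\<lambda>_. 0)"
  shows "\<exists>B\<in>BB. D \<subseteq> B"
proof -
  obtain B0 where B0: "B0 \<in> BB" using bases_ne by auto
  have bnd: "\<forall>B. B \<in> BB \<longrightarrow> card (B \<inter> D) < Suc (card E)"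
    using bases_sub finite_E by (meson card_mono le_infI1 le_imp_less_Suc)
  obtain B where B: "B \<in> BB" and max: "\<And>B'. B' \<in> BB \<Longrightarrow> card (B' \<inter> D) \<le> card (B \<inter> D)"
    using ex_has_greatest_nat[of "\<lambda>B. B \<in> BB" B0 "\<lambda>B. card (B \<inter> D)" "Suc (card E)"] B0 bnd by blast
  have "D \<subseteq> B"
  proof (rule ccontr)
    assume "\<not> D \<subseteq> B"
    then obtain x where x: "x \<in> D" "x \<notin> B" by auto
    then have xE: "x \<in> E - B" using D by auto
    obtain c where c: "c \<in> V" "c x = 1" "\<forall>y. c y \<noteq> 0 \<longrightarrow> y \<in> insert x B"
      "\<forall>y\<in>B. c y \<noteq> 0 \<longrightarrow> insert x (B - {y}) \<in> BB"
      using fund[OF B xE] by auto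
    have "c \<noteq> (\<lambda>_. 0)" using c(2) by auto
    then have "\<not> chain_supp c \<subseteq> D" using ind c(1) by blast
    then obtain z where z: "c z \<noteq> 0" "z \<notin> D" by (auto simp: chain_supp_def)
    then have zB: "z \<in> B" using c(3) x by auto
    have "insert x (B - {z}) \<in> BB" using c zB z by auto
    then have le: "card (insert x (B - {z}) \<inter> D) \<le> card (B \<inter> D)" by (rule max)
    have "insert x (B - {z}) \<inter> D = insert x (B \<inter> D)" using x z by auto
    moreover have "finite (B \<inter> D)" using D finite_E finite_subset by blast
    ultimately show False using le x by simp
  qed
  then show ?thesis using B by blast
qed

text \<open>By minimality the support without \<open>x\<close> is independent and extends to a
  basis. Relative to this basis \<open>v\<close> is an integer multiple of the fundamental circuit
  of \<open>x\<close>, whose coefficients are -1, 0 and 1.\<close>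

lemma minimal_simple:
  assumes v: "v \<in> V" and vx: "v x \<noteq> 0"
    and min: "\<And>q. q \<in> V \<Longrightarrow> q \<noteq> (\<lambda>_. 0) \<Longrightarrow> chain_supp q \<subseteq> chain_supp v \<Longrightarrow> chain_supp q = chain_supp v"
  shows "\<exists>u\<in>elementary V. u x = 1 \<and> v = (\<lambda>y. v x * u y)"
proof -
  have "\<exists>B\<in>BB. chain_supp v - {x} \<subseteq> B"
  proof (rule independent_in_basis)
    show "chain_supp v - {x} \<subseteq> E" using V_supp[OF v] by (auto simp: chain_supp_def)
    fix q assume q: "q \<in> V" "chain_supp q \<subseteq> chain_supp v - {x}"
    show "q = (\<lambda>_. 0)"
    proof (rule ccontr)
      assume "q \<noteq> (\<lambda>_. 0)"
      then have "chain_supp q = chain_supp v" using min q by blast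
      then show False using q vx by (auto simp: chain_supp_def)
    qed
  qed
  then obtain B where B: "B \<in> BB" "chain_supp v - {x} \<subseteq> B" by auto
  have xB: "x \<notin> B"
  proof
    assume "x \<in> B"
    then have "v = (\<lambda>_. 0)" using B by (intro basis_independent[OF B(1) v]) (auto simp: chain_supp_def)
    then show False using vx by simp
  qed
  then have xE: "x \<in> E - B" using V_supp[OF v vx] by simp
  obtain c where c: "c \<in> V" "c x = 1" "\<forall>y. c y \<in> {-1, 0, 1}" "\<forall>y. c y \<noteq> 0 \<longrightarrow> y \<in> insert x B"
    using fund[OF B(1) xE] by auto
  have "(\<lambda>y. v y - v x * c y) = (\<lambda>_. 0)"
  proof (rule basis_independent[OF B(1)])
    show "(\<lambda>y. v y - v x * c y) \<in> V" using V_diff[OF v V_scale[OF c(1)]] .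
    fix y assume ne: "v y - v x * c y \<noteq> 0"
    then have "y \<noteq> x" using c by auto
    moreover have "v y \<noteq> 0 \<or> c y \<noteq> 0" using ne by auto
    ultimately show "y \<in> B" using B c by (auto simp: chain_supp_def)
  qed
  then have eq: "v = (\<lambda>y. v x * c y)" by (metis eq_iff_diff_eq_0)
  then have supp: "chain_supp c = chain_supp v"
    using vx unfolding chain_supp_def by (metis mult_eq_0_iff)
  have "c \<noteq> (\<lambda>_. 0)" using c(2) by auto
  then have "c \<in> elementary V" using c supp min by (auto simp: elementary_def)
  then show ?thesis using eq c by blast
qed

text \<open>Induction on the support. If some \<open>q\<close> has smaller support, a suitable
  combination of \<open>v\<close> and \<open>q\<close> kills one element of the support of
  \<open>v\<close> without reversing any sign, as in the ratio test of the simplex method.\<close>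

lemma conformal_elementary:
  assumes "v \<in> V" "v \<noteq> (\<lambda>_. 0)"
  shows "\<exists>u\<in>elementary V. conformal u v"
  using assms
proof (induction "card (chain_supp v)" arbitrary: v rule: less_induct)
  case less
  have fin: "finite (chain_supp v)"
    using V_supp[OF less(2)] finite_E by (auto simp: chain_supp_def intro: finite_subset)
  show ?case
  proof (cases "\<exists>q\<in>V. q \<noteq> (\<lambda>_. 0) \<and> chain_supp q \<subset> chain_supp v")
    case False
    obtain x where x: "v x \<noteq> 0" using less(3) by auto
    obtain u where u: "u \<in> elementary V" "u x = 1" "v = (\<lambda>y. v x * u y)"
      using minimal_simple[OF less(2) x] False by blast
    define w where "w = (\<lambda>y. sgn (v x) * u y)"
    have "w \<in> V" unfolding w_def using u by (intro V_scale) (auto simp: elementary_def)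
    moreover have sw: "chain_supp w = chain_supp u" using x by (auto simp: w_def chain_supp_def sgn_if)
    moreover have "w x \<noteq> 0" using u(2) x by (simp add: w_def sgn_0_0)
    then have "w \<noteq> (\<lambda>_. 0)" by auto
    moreover have "\<forall>y. w y \<in> {-1, 0, 1}" using u by (auto simp: w_def elementary_def sgn_if)
    ultimately have "w \<in> elementary V" using u by (auto simp: elementary_def)
    moreover have "conformal w v" unfolding conformal_def
    proof (intro allI impI)
      fix y
      have "sgn (v y) = sgn (v x * u y)" using u(3) by metis
      moreover have "u y \<in> {-1, 0, 1}" using u by (auto simp: elementary_def)
      ultimately show "sgn (w y) = sgn (v y)" by (auto simp: w_def sgn_mult)
    qed
    ultimately show ?thesis by blast
  next
    case True
    then obtain q where q: "q \<in> V" "q \<noteq> (\<lambda>_. 0)" "chain_supp q \<subset> chain_supp v" by blast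
    then obtain y1 where y1: "q y1 \<noteq> 0" by auto
    then have "v y1 \<noteq> 0" using q by (auto simp: chain_supp_def)
    \<comment> \<open>The sign of \<open>q\<close> is chosen so that \<open>q'\<close> and
      \<open>v\<close> agree in sign at \<open>y1\<close>; this makes the set \<open>S\<close> of
      the ratio test nonempty.\<close>
    define q' where "q' = (\<lambda>x. sgn (q y1 * v y1) * q x)"
    have q'V: "q' \<in> V" unfolding q'_def using q by (intro V_scale)
    have q's: "chain_supp q' = chain_supp q"
      using y1 \<open>v y1 \<noteq> 0\<close> by (auto simp: q'_def chain_supp_def sgn_if)
    define S where "S = {y. q' y * v y > 0}"
    have "q' y1 * v y1 = \<bar>q y1 * v y1\<bar>" by (simp add: q'_def mult.assoc abs_sgn mult.commute)
    then have y1S: "y1 \<in> S" using y1 \<open>v y1 \<noteq> 0\<close> by (simp add: S_def)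
    have Ssub: "S \<subseteq> chain_supp v" by (auto simp: S_def chain_supp_def)
    then have finS: "finite S" using fin finite_subset by blast
    obtain y0 where y0: "y0 \<in> S" and min: "\<And>y. y \<in> S \<Longrightarrow>
        real_of_int \<bar>v y0\<bar> / \<bar>q' y0\<bar> \<le> real_of_int \<bar>v y\<bar> / \<bar>q' y\<bar>"
      using finS y1S ex_min_if_finite[of "(\<lambda>y. real_of_int \<bar>v y\<bar> / \<bar>q' y\<bar>) ` S"]
      by (force simp: not_less)
    \<comment> \<open>This is \<open>v\<close> minus the critical multiple of \<open>q'\<close>,
      cleared of denominators so that it stays integral. Minimality of the ratio at
      \<open>y0\<close> keeps all signs.\<close>
    define u where "u = (\<lambda>x. \<bar>q' y0\<bar> * v x - \<bar>v y0\<bar> * q' x)"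
    have pos: "\<bar>q' y0\<bar> > 0" "\<bar>v y0\<bar> > 0" using y0 by (auto simp: S_def)
    have uV: "u \<in> V" unfolding u_def
      using V_diff[OF V_scale[OF less(2)] V_scale[OF q'V]] .
    have u0: "u y0 = 0"
    proof -
      have "q' y0 * v y0 > 0" using y0 by (simp add: S_def)
      then show ?thesis unfolding u_def by (auto simp: abs_if zero_less_mult_iff)
    qed
    have usub: "chain_supp u \<subseteq> chain_supp v"
      using q(3) q's by (fastforce simp: u_def chain_supp_def)
    have "y0 \<in> chain_supp v" using y0 Ssub by auto
    then have "chain_supp u \<subset> chain_supp v" using u0 usub by (auto simp: chain_supp_def)
    then have lt: "card (chain_supp u) < card (chain_supp v)" using fin by (simp add: psubset_card_mono)
    \<comment> \<open>Where \<open>q\<close> vanishes, \<open>u\<close> is a nonzero multiple of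
      \<open>v\<close>; such a point keeps \<open>u\<close> nonzero.\<close>
    obtain z where z: "v z \<noteq> 0" "q z = 0" using q(3) by (auto simp: chain_supp_def)
    then have "u z \<noteq> 0" using pos by (auto simp: u_def q'_def)
    then have une: "u \<noteq> (\<lambda>_. 0)" by auto
    have conf: "sgn (u x) = sgn (v x)" if ux: "u x \<noteq> 0" for x
    proof -
      have vx: "v x \<noteq> 0" using ux usub by (auto simp: chain_supp_def)
      have "\<bar>v y0\<bar> * (sgn (v x) * q' x) \<le> \<bar>q' y0\<bar> * \<bar>v x\<bar>"
      proof (cases "q' x * v x > 0")
        case True
        then have "real_of_int \<bar>v y0\<bar> / \<bar>q' y0\<bar> \<le> real_of_int \<bar>v x\<bar> / \<bar>q' x\<bar>" by (intro min) (simp add: S_def)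
        moreover have "\<bar>q' x\<bar> > 0" using True by auto
        ultimately have "real_of_int \<bar>v y0\<bar> * real_of_int \<bar>q' x\<bar> \<le> real_of_int \<bar>q' y0\<bar> * real_of_int \<bar>v x\<bar>"
          using pos by (simp add: divide_simps mult.commute)
        then have "\<bar>v y0\<bar> * \<bar>q' x\<bar> \<le> \<bar>q' y0\<bar> * \<bar>v x\<bar>" by (metis of_int_le_iff of_int_mult)
        moreover have "sgn (v x) * q' x = \<bar>q' x\<bar>" using True by (auto simp: sgn_if zero_less_mult_iff)
        ultimately show ?thesis by simp
      next
        case False
        then have "sgn (v x) * q' x \<le> 0" by (auto simp: sgn_if zero_less_mult_iff)
        then have "\<bar>v y0\<bar> * (sgn (v x) * q' x) \<le> 0" by (simp add: mult_nonneg_nonpos)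
        then show ?thesis by (rule order_trans) simp
      qed
      then have "sgn (v x) * u x \<ge> 0" by (simp add: u_def right_diff_distrib abs_sgn mult_ac)
      then show ?thesis using ux vx by (auto simp: sgn_if split: if_splits)
    qed
    obtain w where "w \<in> elementary V" "conformal w u" using less(1)[OF lt uV une] by blast
    moreover have "conformal w v"
      using conformal_trans[OF \<open>conformal w u\<close>, of v] conf by (simp add: conformal_def)
    ultimately show ?thesis by blast
  qed
qed

lemma elementary_in: "u \<in> elementary V \<Longrightarrow> u \<in> V"
  by (simp add: elementary_def)

lemma elementary_values: "u \<in> elementary V \<Longrightarrow> u x = -1 \<or> u x = 0 \<or> u x = 1"
  by (auto simp: elementary_def)

text \<open>The coefficients of \<open>u\<close> are at most 1 in absolute value and agree in sign
  with \<open>v\<close>, so the subtraction moves coefficients towards 0 and never past it. The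
  decreasing sum is the measure of later inductions.\<close>

lemma conformal_subtract:
  assumes u: "u \<in> elementary V" "conformal u v"
  shows "conformal (\<lambda>y. v y - u y) v"
    and "(\<Sum>y\<in>E. nat \<bar>v y - u y\<bar>) < (\<Sum>y\<in>E. nat \<bar>v y\<bar>)"
proof -
  have conf: "u y \<noteq> 0 \<Longrightarrow> sgn (u y) = sgn (v y)" for y using u(2) by (simp add: conformal_def)
  have abs: "\<bar>v y - u y\<bar> = \<bar>v y\<bar> - \<bar>u y\<bar>" for y
    using elementary_values[OF u(1), of y] conf[of y] by (auto simp: sgn_if split: if_splits)
  show "conformal (\<lambda>y. v y - u y) v" unfolding conformal_def
  proof (intro allI impI)
    fix y assume "v y - u y \<noteq> 0"
    then show "sgn (v y - u y) = sgn (v y)"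
      using elementary_values[OF u(1), of y] conf[of y] by (auto simp: sgn_if split: if_splits)
  qed
  obtain z where z: "u z \<noteq> 0" using u by (auto simp: elementary_def fun_eq_iff)
  show "(\<Sum>y\<in>E. nat \<bar>v y - u y\<bar>) < (\<Sum>y\<in>E. nat \<bar>v y\<bar>)"
  proof (rule sum_strict_mono_ex1[OF finite_E])
    show "\<forall>y\<in>E. nat \<bar>v y - u y\<bar> \<le> nat \<bar>v y\<bar>" by (auto intro!: nat_mono simp: abs)
    have "\<bar>v z\<bar> > 0" using conf[OF z] z by (auto simp: sgn_0_0)
    then have "nat \<bar>v z - u z\<bar> < nat \<bar>v z\<bar>" using abs[of z] z by (simp add: nat_less_eq_zless)
    then show "\<exists>a\<in>E. nat \<bar>v a - u a\<bar> < nat \<bar>v a\<bar>" using V_supp[OF elementary_in[OF u(1)] z] by blast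
  qed
qed

text \<open>Conformal elementary chains are split off until one of them uses \<open>x\<close>. As
  long as they avoid \<open>x\<close>, the coefficient of \<open>v\<close> at \<open>x\<close> is
  unchanged, and the norm decreases.\<close>

lemma conformal_through:
  assumes "v \<in> V" "v x \<noteq> 0"
  shows "\<exists>u\<in>elementary V. conformal u v \<and> u x \<noteq> 0"
  using assms
proof (induction "\<Sum>y\<in>E. nat \<bar>v y\<bar>" arbitrary: v rule: less_induct)
  case less
  obtain u where u: "u \<in> elementary V" "conformal u v"
    using conformal_elementary[OF less(2)] less(3) by fastforce
  show ?case
  proof (cases "u x = 0")
    case True
    then have "v x - u x \<noteq> 0" using less(3) by simp
    then obtain w where "w \<in> elementary V" "conformal w (\<lambda>y. v y - u y)" "w x \<noteq> 0"
      using less(1)[OF conformal_subtract(2)[OF u] V_diff[OF less(2) elementary_in[OF u(1)]]] by blast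
    then show ?thesis using conformal_trans[OF _ conformal_subtract(1)[OF u]] by blast
  qed (use u in blast)
qed

lemma elementary_uminus:
  assumes "u \<in> elementary V"
  shows "(\<lambda>x. - u x) \<in> elementary V"
proof -
  have "u y \<in> {-1, 0, 1}" for y using assms by (auto simp: elementary_def)
  then have "- u y \<in> {-1, 0, 1}" for y by (metis insert_iff minus_minus minus_zero singletonD)
  moreover have "chain_supp (\<lambda>x. - u x) = chain_supp u" by (simp add: chain_supp_def)
  moreover have "(\<lambda>x. - u x) \<noteq> (\<lambda>_. 0)"
    using assms by (auto simp: elementary_def fun_eq_iff)
  ultimately show ?thesis
    using assms V_uminus by (simp add: elementary_def)
qed

text \<open>Subtracting the indicated multiple of \<open>u\<close> kills the coefficient at
  \<open>x\<close>, because \<open>u x\<close> squares to 1. A nonzero remainder would have strictly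
  smaller support than \<open>u\<close>.\<close>

lemma elementary_unique:
  assumes u: "u \<in> elementary V" and v: "v \<in> V" "v \<noteq> (\<lambda>_. 0)" "chain_supp v \<subseteq> chain_supp u"
    and x: "u x \<noteq> 0"
  shows "v = (\<lambda>y. v x * u x * u y)"
proof (rule ccontr)
  assume neq: "v \<noteq> (\<lambda>y. v x * u x * u y)"
  define d where "d = (\<lambda>y. v y - v x * u x * u y)"
  have uV: "u \<in> V" using u by (simp add: elementary_def)
  have "d \<in> V" unfolding d_def using V_diff[OF v(1) V_scale[OF uV]] .
  moreover have "d \<noteq> (\<lambda>_. 0)" using neq unfolding d_def by (auto simp: fun_eq_iff)
  moreover have "chain_supp d \<subseteq> chain_supp u" using v by (auto simp: d_def chain_supp_def)
  ultimately have "chain_supp d = chain_supp u" using u by (auto simp: elementary_def)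
  moreover have "u x * u x = 1"
  proof -
    have "u x \<in> {-1, 0, 1}" using u by (auto simp: elementary_def)
    then show ?thesis using x by auto
  qed
  then have "d x = 0" by (simp add: d_def mult.assoc)
  ultimately show False using x by (auto simp: chain_supp_def)
qed

lemma elementary_supp_eq:
  assumes u: "u \<in> elementary V" and v: "v \<in> elementary V" and s: "chain_supp v \<subseteq> chain_supp u"
  shows "v = u \<or> v = (\<lambda>y. - u y)"
proof -
  obtain x where x: "v x \<noteq> 0" using v by (auto simp: elementary_def fun_eq_iff)
  then have ux: "u x \<noteq> 0" using s by (auto simp: chain_supp_def)
  have vv: "v \<in> V" "v \<noteq> (\<lambda>_. 0)" using v by (auto simp: elementary_def)
  have "v = (\<lambda>y. v x * u x * u y)" using elementary_unique[OF u vv s ux] .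
  moreover have "v x \<in> {-1, 0, 1}" "u x \<in> {-1, 0, 1}" using u v by (auto simp: elementary_def)
  then have "v x * u x = 1 \<or> v x * u x = -1" using x ux by auto
  ultimately show ?thesis by (elim disjE) simp_all
qed

text \<open>Both inclusions rest on one dichotomy: a subset of \<open>E\<close> lies in a basis iff
  it supports no nonzero element of \<open>V\<close>.\<close>

lemma circuits_of_eq: "circuits_of E BB = chain_supp ` elementary V"
proof (intro equalityI subsetI)
  fix C assume C: "C \<in> circuits_of E BB"
  then have CE: "C \<subseteq> E" and nb: "\<not> (\<exists>B\<in>BB. C \<subseteq> B)" and sb: "\<And>D. D \<subset> C \<Longrightarrow> \<exists>B\<in>BB. D \<subseteq> B"
    by (auto simp: circuits_of_def)
  obtain v where v: "v \<in> V" "v \<noteq> (\<lambda>_. 0)" "chain_supp v \<subseteq> C"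
    using independent_in_basis[OF CE] nb by blast
  have sub: "chain_supp q = C" if qq: "q \<in> V" "q \<noteq> (\<lambda>_. 0)" "chain_supp q \<subseteq> C" for q
  proof (rule ccontr)
    assume "chain_supp q \<noteq> C"
    then have "chain_supp q \<subset> C" using qq(3) by blast
    then obtain B where "B \<in> BB" "chain_supp q \<subseteq> B" using sb by blast
    then show False using basis_independent[of B q] qq by (auto simp: chain_supp_def)
  qed
  obtain u where u: "u \<in> elementary V" "conformal u v" using conformal_elementary v by blast
  then have "chain_supp u \<subseteq> chain_supp v" by (auto simp: conformal_def chain_supp_def sgn_0_0)
  then have "chain_supp u = C" using sub[of u] u v by (auto simp: elementary_def)
  then show "C \<in> chain_supp ` elementary V" using u by blast
next
  fix C assume "C \<in> chain_supp ` elementary V"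
  then obtain u where u: "u \<in> elementary V" "C = chain_supp u" by auto
  have uV: "u \<in> V" "u \<noteq> (\<lambda>_. 0)" using u by (auto simp: elementary_def)
  have CE: "C \<subseteq> E" using u V_supp[OF uV(1)] by (auto simp: chain_supp_def)
  have "\<not> (\<exists>B\<in>BB. C \<subseteq> B)"
    using basis_independent[OF _ uV(1)] uV(2) u(2) by (auto simp: chain_supp_def)
  moreover have "\<exists>B\<in>BB. D \<subseteq> B" if D: "D \<subset> C" for D
  proof (rule independent_in_basis)
    show "D \<subseteq> E" using D CE by blast
    fix q assume q: "q \<in> V" "chain_supp q \<subseteq> D"
    then show "q = (\<lambda>_. 0)" using u D by (fastforce simp: elementary_def)
  qed
  ultimately show "C \<in> circuits_of E BB" using CE by (auto simp: circuits_of_def)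
qed

lemma signed_circuits_eq:
  "{P. simple_chain E P \<and> P \<in> V \<and> chain_supp P \<in> circuits_of E BB} = elementary V"
proof (intro equalityI subsetI)
  fix P assume "P \<in> {P. simple_chain E P \<and> P \<in> V \<and> chain_supp P \<in> circuits_of E BB}"
  then obtain u where P: "simple_chain E P" "P \<in> V" "u \<in> elementary V" "chain_supp P = chain_supp u"
    unfolding circuits_of_eq by auto
  then show "P \<in> elementary V"
    by (auto simp: elementary_def simple_chain_def chain_supp_def fun_eq_iff)
next
  fix P assume "P \<in> elementary V"
  then show "P \<in> {P. simple_chain E P \<and> P \<in> V \<and> chain_supp P \<in> circuits_of E BB}"
    using V_sub unfolding circuits_of_eq by (auto simp: elementary_def simple_chain_def)
qed

end

lemma cocircuits_of_dual:
  assumes "\<And>B. B \<in> BB \<Longrightarrow> B \<subseteq> E"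
  shows "cocircuits_of E BB = circuits_of E ((\<lambda>B. E - B) ` BB)"
proof -
  have eq: "D \<inter> B = {} \<longleftrightarrow> D \<subseteq> E - B" if "D \<subseteq> E" for D B using that by auto
  have "(C \<subseteq> E \<and> (\<forall>B\<in>BB. C \<inter> B \<noteq> {}) \<and> (\<forall>D. D \<subset> C \<longrightarrow> (\<exists>B\<in>BB. D \<inter> B = {}))) \<longleftrightarrow>
      (C \<subseteq> E \<and> \<not> (\<exists>B\<in>BB. C \<subseteq> E - B) \<and> (\<forall>D. D \<subset> C \<longrightarrow> (\<exists>B\<in>BB. D \<subseteq> E - B)))" for C
  proof (cases "C \<subseteq> E")
    case True
    then have "D \<subset> C \<Longrightarrow> D \<subseteq> E" for D by blast
    then show ?thesis using True eq by (metis (no_types, lifting))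
  qed simp
  then show ?thesis by (simp add: cocircuits_of_def circuits_of_def)
qed

section \<open>The Farkas alternative\<close>

context regular_pair begin

text \<open>Either \<open>g\<close> is spanned by \<open>S\<close> or some cocircuit through
  \<open>g\<close> avoids \<open>S\<close>. A basis that prefers \<open>S\<close> over
  \<open>g\<close> and \<open>g\<close> over everything else decides: the chain wanted is the
  fundamental circuit or cocircuit of \<open>g\<close>.\<close>

lemma linear_alternative:
  assumes g: "g \<in> E" "g \<notin> S"
  shows "(\<exists>v\<in>V. v g = 1 \<and> (\<forall>x. v x \<noteq> 0 \<longrightarrow> x \<in> S \<or> x = g)) \<or>
         (\<exists>w\<in>W. w g = 1 \<and> (\<forall>x. w x \<noteq> 0 \<longrightarrow> x \<notin> S \<or> x = g))"
proof -
  \<comment> \<open>The weight 2 lets an element of \<open>S\<close> outweigh \<open>g\<close>, so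
    exchanging \<open>g\<close> for it is still an improvement.\<close>
  define m where "m = (\<lambda>B. 2 * card (B \<inter> S) + (if g \<in> B then 1 else 0 :: nat))"
  obtain B0 where B0: "B0 \<in> BB" using bases_ne by auto
  have fin: "finite (B \<inter> S)" if "B \<in> BB" for B
    using bases_sub[OF that] finite_E by (meson finite_Int finite_subset)
  have "m B < 2 * card E + 2" if "B \<in> BB" for B
  proof -
    have "card (B \<inter> S) \<le> card E" using bases_sub[OF that] finite_E by (meson card_mono le_infI1)
    then show ?thesis by (simp add: m_def)
  qed
  then obtain B where B: "B \<in> BB" and max: "\<And>B'. B' \<in> BB \<Longrightarrow> m B' \<le> m B"
    using ex_has_greatest_nat[of "\<lambda>B. B \<in> BB" B0 m "2 * card E + 2"] B0 by blast
  show ?thesis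
  proof (cases "g \<in> B")
    case True
    obtain c where c: "c \<in> W" "c g = 1" "\<forall>x. c x \<noteq> 0 \<longrightarrow> x \<in> insert g (E - B)"
      "\<forall>x\<in>E - B. c x \<noteq> 0 \<longrightarrow> insert x (B - {g}) \<in> BB"
      using cofund[OF B True] by auto
    have "x \<notin> S \<or> x = g" if x: "c x \<noteq> 0" for x
    proof (rule ccontr)
      assume "\<not> (x \<notin> S \<or> x = g)"
      then have xS: "x \<in> S" "x \<noteq> g" by auto
      then have xB: "x \<in> E - B" using c x by auto
      then have "m (insert x (B - {g})) \<le> m B" using c x max by blast
      moreover have "insert x (B - {g}) \<inter> S = insert x (B \<inter> S)" using xS g by auto
      then have "card (insert x (B - {g}) \<inter> S) = Suc (card (B \<inter> S))"
        using fin[OF B] xB by simp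
      ultimately show False using True xS(2) by (simp add: m_def)
    qed
    then show ?thesis using c by blast
  next
    case False
    then have "g \<in> E - B" using g by simp
    then obtain c where c: "c \<in> V" "c g = 1" "\<forall>x. c x \<noteq> 0 \<longrightarrow> x \<in> insert g B"
      "\<forall>y\<in>B. c y \<noteq> 0 \<longrightarrow> insert g (B - {y}) \<in> BB"
      using fund[OF B] by metis
    have "x \<in> S \<or> x = g" if x: "c x \<noteq> 0" for x
    proof (rule ccontr)
      assume "\<not> (x \<in> S \<or> x = g)"
      then have xS: "x \<notin> S" "x \<noteq> g" by auto
      then have xB: "x \<in> B" using c x by auto
      then have "m (insert g (B - {x})) \<le> m B" using c x max by blast
      moreover have "insert g (B - {x}) \<inter> S = B \<inter> S" using xS g by auto
      ultimately show False using False by (simp add: m_def)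
    qed
    then show ?thesis using c by blast
  qed
qed

text \<open>\<open>F x\<close> is the set of signs allowed at \<open>x\<close> for \<open>v\<close>,
  and the negatives of the signs of \<open>w\<close> must avoid it. The induction runs over the
  number of elements with exactly one allowed sign; if there are none, only the supports are
  constrained and the linear alternative applies.\<close>

lemma farkas:
  fixes F :: "'e \<Rightarrow> int set"
  assumes g: "g \<in> E"
  shows "(\<exists>v\<in>V. v g > 0 \<and> (\<forall>x. x \<noteq> g \<longrightarrow> v x \<noteq> 0 \<longrightarrow> sgn (v x) \<in> F x)) \<or>
         (\<exists>w\<in>W. w g > 0 \<and> (\<forall>x. x \<noteq> g \<longrightarrow> w x \<noteq> 0 \<longrightarrow> - sgn (w x) \<notin> F x))"
proof (induction "card {x \<in> E - {g}. (1 \<in> F x) \<noteq> (-1 \<in> F x)}" arbitrary: F rule: less_induct)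
  case less
  have sg: "a \<noteq> 0 \<Longrightarrow> sgn a = 1 \<or> sgn a = -1" for a :: int by (auto simp: sgn_if)
  show ?case
  proof (cases "\<exists>x\<in>E - {g}. (1 \<in> F x) \<noteq> (-1 \<in> F x)")
    case False
    define S where "S = {x \<in> E - {g}. 1 \<in> F x}"
    have gS: "g \<notin> S" by (simp add: S_def)
    from linear_alternative[OF g gS] show ?thesis
    proof
      assume "\<exists>v\<in>V. v g = 1 \<and> (\<forall>x. v x \<noteq> 0 \<longrightarrow> x \<in> S \<or> x = g)"
      then obtain v where v: "v \<in> V" "v g = 1" "\<forall>x. v x \<noteq> 0 \<longrightarrow> x \<in> S \<or> x = g" by blast
      have "sgn (v x) \<in> F x" if "x \<noteq> g" "v x \<noteq> 0" for x
      proof -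
        have "x \<in> E - {g}" "1 \<in> F x" using v(3) that by (auto simp: S_def)
        then have "1 \<in> F x" "-1 \<in> F x" using False by blast+
        then show ?thesis using sg[OF that(2)] by (elim disjE) simp_all
      qed
      then show ?thesis using v by (intro disjI1 bexI[of _ v]) auto
    next
      assume "\<exists>w\<in>W. w g = 1 \<and> (\<forall>x. w x \<noteq> 0 \<longrightarrow> x \<notin> S \<or> x = g)"
      then obtain w where w: "w \<in> W" "w g = 1" "\<forall>x. w x \<noteq> 0 \<longrightarrow> x \<notin> S \<or> x = g" by blast
      have "- sgn (w x) \<notin> F x" if "x \<noteq> g" "w x \<noteq> 0" for x
      proof -
        have "x \<in> E" using regular_pair.V_supp[OF dual w(1) that(2)] .
        then have "x \<in> E - {g}" "1 \<notin> F x" using w(3) that by (auto simp: S_def)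
        then have "1 \<notin> F x" "-1 \<notin> F x" using False by blast+
        then show ?thesis using sg[OF that(2)] by (elim disjE) simp_all
      qed
      then show ?thesis using w by (intro disjI2 bexI[of _ w]) auto
    qed
  next
    case True
    then obtain x where x: "x \<in> E" "x \<noteq> g" "(1 \<in> F x) \<noteq> (-1 \<in> F x)" by auto
    then obtain t :: int where t: "t = 1 \<or> t = -1" "t \<in> F x" "- t \<notin> F x"
      by (metis minus_minus)
    have smaller: "card {y \<in> E - {g}. (1 \<in> (F(x := X)) y) \<noteq> (-1 \<in> (F(x := X)) y)}
        < card {x \<in> E - {g}. (1 \<in> F x) \<noteq> (-1 \<in> F x)}" if "(1 \<in> X) = (-1 \<in> X)" for X
    proof (rule psubset_card_mono)
      show "finite {x \<in> E - {g}. (1 \<in> F x) \<noteq> (-1 \<in> F x)}" using finite_E by simp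
      show "{y \<in> E - {g}. (1 \<in> (F(x := X)) y) \<noteq> (-1 \<in> (F(x := X)) y)}
        \<subset> {x \<in> E - {g}. (1 \<in> F x) \<noteq> (-1 \<in> F x)}"
        using x that by (auto split: if_splits)
    qed
    \<comment> \<open>Allowing both signs at \<open>x\<close> makes a solution in \<open>W\<close>
      vanish at \<open>x\<close>, and allowing none does the same to a solution in \<open>V\<close>.
      Hence only a \<open>V\<close>-solution of the first relaxation and a \<open>W\<close>-solution
      of the second can fail to solve the original problem.\<close>
    let ?F1 = "F(x := {1, -1})" and ?F2 = "F(x := {})"
    have ih1: "(\<exists>v\<in>V. v g > 0 \<and> (\<forall>y. y \<noteq> g \<longrightarrow> v y \<noteq> 0 \<longrightarrow> sgn (v y) \<in> ?F1 y)) \<or>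
         (\<exists>w\<in>W. w g > 0 \<and> (\<forall>y. y \<noteq> g \<longrightarrow> w y \<noteq> 0 \<longrightarrow> - sgn (w y) \<notin> ?F1 y))"
      by (rule less(1)[OF smaller]) simp
    have ih2: "(\<exists>v\<in>V. v g > 0 \<and> (\<forall>y. y \<noteq> g \<longrightarrow> v y \<noteq> 0 \<longrightarrow> sgn (v y) \<in> ?F2 y)) \<or>
         (\<exists>w\<in>W. w g > 0 \<and> (\<forall>y. y \<noteq> g \<longrightarrow> w y \<noteq> 0 \<longrightarrow> - sgn (w y) \<notin> ?F2 y))"
      by (rule less(1)[OF smaller]) simp
    show ?thesis
    proof (rule ccontr)
      assume no: "\<not> ?thesis"
      obtain v where v: "v \<in> V" "v g > 0" "\<And>y. y \<noteq> g \<Longrightarrow> v y \<noteq> 0 \<Longrightarrow> sgn (v y) \<in> ?F1 y"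
        using ih1
      proof (elim disjE bexE conjE)
        fix w assume w: "w \<in> W" "w g > 0" "\<forall>y. y \<noteq> g \<longrightarrow> w y \<noteq> 0 \<longrightarrow> - sgn (w y) \<notin> ?F1 y"
        have "w x = 0" using w(3) x(2) sg[of "w x"] by fastforce
        then have "- sgn (w y) \<notin> F y" if "y \<noteq> g" "w y \<noteq> 0" for y
          using w(3) that by (metis fun_upd_other)
        then show thesis using no w by blast
      qed blast
      obtain w where w: "w \<in> W" "w g > 0" "\<And>y. y \<noteq> g \<Longrightarrow> w y \<noteq> 0 \<Longrightarrow> - sgn (w y) \<notin> ?F2 y"
        using ih2
      proof (elim disjE bexE conjE)
        fix v assume v: "v \<in> V" "v g > 0" "\<forall>y. y \<noteq> g \<longrightarrow> v y \<noteq> 0 \<longrightarrow> sgn (v y) \<in> ?F2 y"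
        have "v x = 0" using v(3) x(2) by fastforce
        then have "sgn (v y) \<in> F y" if "y \<noteq> g" "v y \<noteq> 0" for y
          using v(3) that by (metis fun_upd_other)
        then show thesis using no v by blast
      qed blast
      have vx: "v x \<noteq> 0 \<and> sgn (v x) = - t"
      proof (rule ccontr)
        assume *: "\<not> (v x \<noteq> 0 \<and> sgn (v x) = - t)"
        have "sgn (v y) \<in> F y" if "y \<noteq> g" "v y \<noteq> 0" for y
          using v(3)[OF that] * t sg[OF that(2)] that by (cases "y = x") auto
        then show False using no v by blast
      qed
      have wx: "w x \<noteq> 0 \<and> sgn (w x) = - t"
      proof (rule ccontr)
        assume *: "\<not> (w x \<noteq> 0 \<and> sgn (w x) = - t)"
        have "- sgn (w y) \<notin> F y" if "y \<noteq> g" "w y \<noteq> 0" for y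
          using w(3)[OF that] * t sg[OF that(2)] that by (cases "y = x") auto
        then show False using no w by blast
      qed
      \<comment> \<open>At \<open>x\<close> both solutions have the forbidden sign
        \<open>- t\<close>, elsewhere the constraints force equal signs on common support. The
        pairing is therefore positive because of \<open>g\<close>, against orthogonality.\<close>
      have prod: "v y * w y \<ge> 0" for y
      proof (cases "v y = 0 \<or> w y = 0 \<or> y = g")
        case True
        then show ?thesis using v w by auto
      next
        case False
        have "sgn (v y) = sgn (w y)"
        proof (cases "y = x")
          case True
          then show ?thesis using vx wx by simp
        next
          case False2: False
          have "sgn (v y) \<in> F y" "- sgn (w y) \<notin> F y" using v(3)[of y] w(3)[of y] False False2 by auto
          then show ?thesis using sg[of "v y"] sg[of "w y"] False by auto
        qed
        then show ?thesis by (cases "v y" "0 :: int" rule: linorder_cases;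
            cases "w y" "0 :: int" rule: linorder_cases) (auto simp: zero_le_mult_iff)
      qed
      have "(\<Sum>y\<in>E. v y * w y) > 0"
        using prod v(2) w(2) g finite_E by (intro sum_pos2[of E g]) auto
      then show False using orth[OF v(1) w(1)] by simp
    qed
  qed
qed

lemma signed_elementary_through:
  assumes v: "v \<in> V" "v g > 0" and s: "s = 1 \<or> s = (-1 :: int)"
  shows "\<exists>u\<in>elementary V. u g = s \<and> (\<forall>x. u x \<noteq> 0 \<longrightarrow> v x \<noteq> 0 \<and> u x = s * sgn (v x))"
proof -
  have "s * v g \<noteq> 0" using v s by auto
  then obtain u where u: "u \<in> elementary V" "conformal u (\<lambda>x. s * v x)" "u g \<noteq> 0"
    using conformal_through[OF V_scale[OF v(1)], of s g] by blast
  have eq: "v x \<noteq> 0 \<and> u x = s * sgn (v x)" if "u x \<noteq> 0" for x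
  proof -
    have "sgn (u x) = sgn (s * v x)" using u(2) that by (simp add: conformal_def)
    moreover have "sgn (u x) = u x" using elementary_values[OF u(1), of x] by auto
    ultimately show ?thesis using s that by (auto simp: sgn_mult)
  qed
  have "u g = s" using eq[OF u(3)] v(2) by simp
  then show ?thesis using u(1) eq by blast
qed

text \<open>The prescribed sign \<open>s\<close> at \<open>g\<close> is absorbed by multiplying all
  constraint sets by \<open>s\<close>; a conformal elementary chain through \<open>g\<close> then
  inherits the constraints.\<close>

lemma farkas_elementary:
  fixes F :: "'e \<Rightarrow> int set"
  assumes g: "g \<in> E" and s: "s = 1 \<or> s = (-1 :: int)"
  shows "(\<exists>v\<in>elementary V. v g = s \<and> (\<forall>x. x \<noteq> g \<longrightarrow> v x \<noteq> 0 \<longrightarrow> v x \<in> F x)) \<or>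
         (\<exists>w\<in>elementary W. w g = s \<and> (\<forall>x. x \<noteq> g \<longrightarrow> w x \<noteq> 0 \<longrightarrow> - w x \<notin> F x))"
proof -
  interpret D: regular_pair E "(\<lambda>B. E - B) ` BB" W V by (rule dual)
  have mem: "a \<in> (\<lambda>t. s * t) ` F x \<longleftrightarrow> s * a \<in> F x" for a x
    using s by (auto simp: image_iff intro!: bexI[of _ "s * a"])
  from farkas[OF g, of "\<lambda>x. (\<lambda>t. s * t) ` F x"] show ?thesis
  proof (elim disjE bexE conjE)
    fix v assume v: "v \<in> V" "v g > 0" "\<forall>x. x \<noteq> g \<longrightarrow> v x \<noteq> 0 \<longrightarrow> sgn (v x) \<in> (\<lambda>t. s * t) ` F x"
    then show ?thesis using signed_elementary_through[OF v(1,2) s] unfolding mem by metis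
  next
    fix w assume w: "w \<in> W" "w g > 0" "\<forall>x. x \<noteq> g \<longrightarrow> w x \<noteq> 0 \<longrightarrow> - sgn (w x) \<notin> (\<lambda>t. s * t) ` F x"
    then show ?thesis using D.signed_elementary_through[OF w(1,2) s] unfolding mem by (metis mult_minus_right)
  qed
qed

end

text \<open>Let \<open>oi\<close> be the signs of the BBY orientation of \<open>Bi\<close>.  Then \<open>separated V B1 B2 o1 o2\<close> is the
  triangulating condition for this pair of bases, and
  \<open>separated W (E - B1) (E - B2) o1 o2\<close> is its counterpart for cocircuits.\<close>

definition separated ::
    "'e chain set \<Rightarrow> 'e set \<Rightarrow> 'e set \<Rightarrow> ('e \<Rightarrow> int) \<Rightarrow> ('e \<Rightarrow> int) \<Rightarrow> bool" where
  "separated V B1 B2 o1 o2 \<longleftrightarrow> \<not> (\<exists>u\<in>V. u \<noteq> (\<lambda>_. 0) \<and>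
     (\<forall>x. u x \<noteq> 0 \<longrightarrow> (x \<notin> B2 \<longrightarrow> sgn (u x) = o2 x) \<and> (x \<notin> B1 \<longrightarrow> sgn (u x) = - o1 x)))"

section \<open>Exchange and pivot arguments for a separated pair of bases\<close>

context regular_pair begin

lemma separatedD:
  assumes "separated V B1 B2 o1 o2" "u \<in> V"
    and "\<And>x. x \<in> E \<Longrightarrow> u x \<noteq> 0 \<Longrightarrow> x \<notin> B2 \<Longrightarrow> sgn (u x) = o2 x"
    and "\<And>x. x \<in> E \<Longrightarrow> u x \<noteq> 0 \<Longrightarrow> x \<notin> B1 \<Longrightarrow> sgn (u x) = - o1 x"
  shows "u y = 0"
proof (rule ccontr)
  assume "u y \<noteq> 0"
  then have "u \<noteq> (\<lambda>_. 0)" by auto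
  then show False using assms V_supp[OF assms(2)] unfolding separated_def by blast
qed

lemma separated_swap:
  assumes "separated V B1 B2 o1 o2"
  shows "separated V B2 B1 o2 o1"
  unfolding separated_def
proof
  assume "\<exists>u\<in>V. u \<noteq> (\<lambda>_. 0) \<and>
     (\<forall>x. u x \<noteq> 0 \<longrightarrow> (x \<notin> B1 \<longrightarrow> sgn (u x) = o1 x) \<and> (x \<notin> B2 \<longrightarrow> sgn (u x) = - o2 x))"
  then obtain u where u: "u \<in> V" "u \<noteq> (\<lambda>_. 0)"
    "\<And>x. u x \<noteq> 0 \<Longrightarrow> (x \<notin> B1 \<longrightarrow> sgn (u x) = o1 x) \<and> (x \<notin> B2 \<longrightarrow> sgn (u x) = - o2 x)" by blast
  obtain y where y: "u y \<noteq> 0" using u(2) by (auto simp: fun_eq_iff)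
  have "- u y = 0"
    by (rule separatedD[OF assms V_uminus[OF u(1)]]) (use u(3) in \<open>auto simp: sgn_minus\<close>)
  then show False using y by simp
qed

text \<open>The other Farkas alternative is a cocircuit \<open>w\<close> for which
  \<open>- w\<close> contradicts the separation in \<open>W\<close>. The circuit found serves to
  show that the orientations differ somewhere on it: if they agreed on its support, it would
  contradict the separation in \<open>V\<close>.\<close>

lemma exchange_chain:
  assumes B: "B1 \<in> BB" "B2 \<in> BB"
    and o1: "\<And>x. x \<in> E \<Longrightarrow> o1 x = 1 \<or> o1 x = -1" and o2: "\<And>x. x \<in> E \<Longrightarrow> o2 x = 1 \<or> o2 x = -1"
    and TW: "separated W (E - B1) (E - B2) o1 o2"
    and e: "e \<in> B1 - B2 \<or> e \<in> B2 - B1"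
  shows "\<exists>q\<in>elementary V. q e \<noteq> 0 \<and> (\<forall>x. q x \<noteq> 0 \<longrightarrow> x \<in> B1 \<union> B2 \<and>
     (x \<in> B1 - B2 \<longrightarrow> q x = o1 x) \<and> (x \<in> B2 - B1 \<longrightarrow> q x = - o2 x))"
proof -
  interpret D: regular_pair E "(\<lambda>B. E - B) ` BB" W V by (rule dual)
  have eE: "e \<in> E" using e B bases_sub by blast
  define s where "s = (if e \<in> B1 then o1 e else - o2 e)"
  have s: "s = 1 \<or> s = -1" using o1[OF eE] o2[OF eE] by (auto simp: s_def)
  define F where "F = (\<lambda>x. if x \<in> B1 \<inter> B2 then {1, -1} else if x \<in> B1 then {o1 x}
      else if x \<in> B2 then {- o2 x} else {})"
  from farkas_elementary[OF eE s, of F] show ?thesis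
  proof
    assume "\<exists>v\<in>elementary V. v e = s \<and> (\<forall>x. x \<noteq> e \<longrightarrow> v x \<noteq> 0 \<longrightarrow> v x \<in> F x)"
    then obtain v where v: "v \<in> elementary V" "v e = s"
      "\<And>x. x \<noteq> e \<Longrightarrow> v x \<noteq> 0 \<Longrightarrow> v x \<in> F x" by blast
    have "x \<in> B1 \<union> B2 \<and> (x \<in> B1 - B2 \<longrightarrow> v x = o1 x) \<and> (x \<in> B2 - B1 \<longrightarrow> v x = - o2 x)"
      if "v x \<noteq> 0" for x
    proof (cases "x = e")
      case True
      then show ?thesis using e v(2) by (auto simp: s_def)
    next
      case False
      then show ?thesis using v(3)[OF False that] by (auto simp: F_def split: if_splits)
    qed
    moreover have "v e \<noteq> 0" using v(2) s by auto
    ultimately show ?thesis using v(1) by blast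
  next
    assume "\<exists>w\<in>elementary W. w e = s \<and> (\<forall>x. x \<noteq> e \<longrightarrow> w x \<noteq> 0 \<longrightarrow> - w x \<notin> F x)"
    then obtain w where w: "w \<in> elementary W" "w e = s"
      "\<And>x. x \<noteq> e \<Longrightarrow> w x \<noteq> 0 \<Longrightarrow> - w x \<notin> F x" by blast
    have val: "w x = -1 \<or> w x = 0 \<or> w x = 1" for x using D.elementary_values[OF w(1)] .
    have sg: "sgn (- w x) = - w x" for x using val[of x] by auto
    have *: "(x \<in> B2 \<longrightarrow> - w x = o2 x) \<and> (x \<in> B1 \<longrightarrow> - w x = - o1 x)" if x: "x \<in> E" "w x \<noteq> 0" for x
    proof (cases "x = e")
      case True
      then show ?thesis using e w(2) by (auto simp: s_def)
    next
      case False
      then show ?thesis using w(3)[OF False x(2)] val[of x] o1[OF x(1)] o2[OF x(1)] x(2)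
        by (auto simp: F_def split: if_splits)
    qed
    have "- w e = 0"
    proof (rule D.separatedD[OF TW D.V_uminus[OF D.elementary_in[OF w(1)]]])
      fix x assume "x \<in> E" "- w x \<noteq> 0"
      then show "x \<notin> E - B2 \<Longrightarrow> sgn (- w x) = o2 x" "x \<notin> E - B1 \<Longrightarrow> sgn (- w x) = - o1 x"
        using *[of x] unfolding sg by auto
    qed
    then show ?thesis using w(2) s by simp
  qed
qed

text \<open>The exceptional element \<open>g\<close> is where \<open>v\<close> disagrees with the direction from \<open>o1\<close> to \<open>o2\<close>.  In the
  first alternative of \<open>alt\<close> only \<open>v\<close> is present and \<open>g\<close> is the support of the arc, in the second one
  both supports meet in \<open>f\<close> and \<open>g\<close>.\<close>

lemma pivot_vanish:
  assumes B: "B1 \<in> BB" "B2 \<in> BB"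
    and o1: "\<And>x. x \<in> E \<Longrightarrow> o1 x = 1 \<or> o1 x = -1" and o2: "\<And>x. x \<in> E \<Longrightarrow> o2 x = 1 \<or> o2 x = -1"
    and TV: "separated V B1 B2 o1 o2" and TW: "separated W (E - B1) (E - B2) o1 o2"
    and v: "v \<in> V" and w: "w \<in> W"
    and g: "g \<in> E" "o1 g = s" "o2 g = s" "v g = - s"
    and voff: "\<And>x. x \<noteq> g \<Longrightarrow> v x \<noteq> 0 \<Longrightarrow> v x = o2 x \<and> v x = - o1 x"
    and woff: "\<And>x. x \<noteq> g \<Longrightarrow> w x \<noteq> 0 \<Longrightarrow> w x = o2 x \<and> w x = - o1 x"
    and off: "\<And>x. x \<in> E \<Longrightarrow> x \<noteq> g \<Longrightarrow> v x = 0 \<Longrightarrow> w x = 0 \<Longrightarrow> o1 x = o2 x"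
    and alt: "(w = (\<lambda>_. 0) \<and> f = g) \<or> (w g = s \<and> v f \<noteq> 0 \<and> w f \<noteq> 0 \<and> f \<noteq> g)"
  shows "g \<notin> B2" and "e \<notin> B1 \<Longrightarrow> e \<notin> B2 \<Longrightarrow> e \<noteq> g \<Longrightarrow> e \<noteq> f \<Longrightarrow> v e = 0"
proof -
  interpret D: regular_pair E "(\<lambda>B. E - B) ` BB" W V by (rule dual)
  have s: "s = 1 \<or> s = -1" using o1[OF g(1)] g by auto
  have vE: "v x \<noteq> 0 \<Longrightarrow> x \<in> E" for x using V_supp[OF v] .
  have wE: "w x \<noteq> 0 \<Longrightarrow> x \<in> E" for x using D.V_supp[OF w] .
  have vsg: "sgn (v x) = v x" if "v x \<noteq> 0" for x
    using that voff[of x] o2[OF vE[OF that]] g s by (cases "x = g") auto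
  show gB2: "g \<notin> B2"
  proof
    assume "g \<in> B2"
    \<comment> \<open>If \<open>g\<close> were in \<open>B2\<close>, separation would constrain
      \<open>v\<close> at \<open>g\<close> by \<open>o1\<close> at most, and
      \<open>v g = - o1 g\<close> satisfies that constraint.\<close>
    have "v g = 0"
    proof (rule separatedD[OF TV v])
      fix x assume x: "x \<in> E" "v x \<noteq> 0" 
      show "x \<notin> B2 \<Longrightarrow> sgn (v x) = o2 x" using vsg[OF x(2)] voff[OF _ x(2)] \<open>g \<in> B2\<close> by (cases "x = g") auto
      show "x \<notin> B1 \<Longrightarrow> sgn (v x) = - o1 x" using vsg[OF x(2)] voff[OF _ x(2)] g by (cases "x = g") auto
    qed
    then show False using g s by auto
  qed
  assume e: "e \<notin> B1" "e \<notin> B2" "e \<noteq> g" "e \<noteq> f"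
  show "v e = 0"
  proof (rule ccontr)
    assume ve: "v e \<noteq> 0"
    \<comment> \<open>On the support of \<open>v\<close> the sign of \<open>v\<close> survives the
      addition of \<open>u\<close>, so \<open>u\<close> is free there, except that it must vanish
      outside both bases, in particular at \<open>e\<close>. Off this support \<open>F\<close> is
      exactly what the separation in \<open>V\<close> demands. At \<open>f\<close> both signs are
      allowed in order to exclude a cocircuit through \<open>f\<close>.\<close>
    define F where "F = (\<lambda>x. if v x \<noteq> 0 then (if x \<in> B1 \<or> x \<in> B2 \<or> x = f then {1, -1} else {})
      else if x \<in> B1 \<and> x \<in> B2 then {1, -1} else if x \<in> B2 then {- o1 x}
      else if x \<in> B1 then {o2 x} else {})"
    from farkas_elementary[OF g(1) s, of F] show False
    proof
      assume "\<exists>u\<in>elementary V. u g = s \<and> (\<forall>x. x \<noteq> g \<longrightarrow> u x \<noteq> 0 \<longrightarrow> u x \<in> F x)"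
      then obtain u where u: "u \<in> elementary V" "u g = s"
        "\<And>x. x \<noteq> g \<Longrightarrow> u x \<noteq> 0 \<Longrightarrow> u x \<in> F x" by blast
      have uval: "u x = -1 \<or> u x = 0 \<or> u x = 1" for x using elementary_values[OF u(1)] .
      have "u e = 0" using u(3)[of e] e ve by (auto simp: F_def)
      \<comment> \<open>At \<open>g\<close> the two chains cancel, and elsewhere
        \<open>v + u\<close> has the signs that separation forbids to a nonzero chain.\<close>
      have "v e + u e = 0"
      proof (rule separatedD[OF TV V_add[OF v elementary_in[OF u(1)]]])
        fix x assume x: "x \<in> E" "v x + u x \<noteq> 0"
        have xg: "x \<noteq> g" using x(2) g u(2) by auto
        have "(x \<notin> B2 \<longrightarrow> sgn (v x + u x) = o2 x) \<and> (x \<notin> B1 \<longrightarrow> sgn (v x + u x) = - o1 x)"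
        proof (cases "v x = 0")
          case True
          then have "u x \<in> F x" using u(3)[OF xg] x by simp
          then show ?thesis using True uval[of x] o1[OF x(1)] o2[OF x(1)]
            by (auto simp: F_def split: if_splits)
        next
          case False
          then have "v x = o2 x" "v x = - o1 x" using voff[OF xg] by auto
          moreover have "sgn (v x + u x) = v x"
            using x(2) uval[of x] o2[OF x(1)] \<open>v x = o2 x\<close> by auto
          ultimately show ?thesis by simp
        qed
        then show "x \<notin> B2 \<Longrightarrow> sgn (v x + u x) = o2 x" "x \<notin> B1 \<Longrightarrow> sgn (v x + u x) = - o1 x" by auto
      qed
      then show False using ve \<open>u e = 0\<close> by simp
    next
      assume "\<exists>u\<in>elementary W. u g = s \<and> (\<forall>x. x \<noteq> g \<longrightarrow> u x \<noteq> 0 \<longrightarrow> - u x \<notin> F x)"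
      then obtain u where u: "u \<in> elementary W" "u g = s"
        "\<And>x. x \<noteq> g \<Longrightarrow> u x \<noteq> 0 \<Longrightarrow> - u x \<notin> F x" by blast
      have uval: "u x = -1 \<or> u x = 0 \<or> u x = 1" for x using D.elementary_values[OF u(1)] .
      \<comment> \<open>Separation in \<open>W\<close> forces \<open>w = u\<close>. At
        \<open>g\<close> the difference is either 0 or, if \<open>w\<close> vanishes, equal to
        \<open>- o1 g\<close>, which is harmless because \<open>g\<close> is not in
        \<open>B2\<close>.\<close>
      have zero: "w y - u y = 0" for y
      proof (rule D.separatedD[OF TW D.V_diff[OF w D.elementary_in[OF u(1)]]])
        fix x assume x: "x \<in> E" "w x - u x \<noteq> 0"
        have "(x \<in> B2 \<longrightarrow> sgn (w x - u x) = o2 x) \<and> (x \<in> B1 \<longrightarrow> sgn (w x - u x) = - o1 x)"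
        proof (cases "x = g")
          case True
          then have "w g = 0" using alt x u(2) by auto
          then show ?thesis using True gB2 u(2) g s by auto
        next
          case False
          show ?thesis
          proof (cases "w x = 0")
            case True
            then have ux: "- u x \<notin> F x" "u x \<noteq> 0" using u(3)[OF False] x by auto
            then show ?thesis using True uval[of x] o1[OF x(1)] o2[OF x(1)] off[OF x(1) False]
              by (auto simp: F_def split: if_splits)
          next
            case w0: False
            then have "w x = o2 x" "w x = - o1 x" using woff[OF False] by auto
            moreover have "sgn (w x - u x) = w x"
              using x(2) uval[of x] o2[OF x(1)] \<open>w x = o2 x\<close> by auto
            ultimately show ?thesis by simp
          qed
        qed
        then show "x \<notin> E - B2 \<Longrightarrow> sgn (w x - u x) = o2 x" "x \<notin> E - B1 \<Longrightarrow> sgn (w x - u x) = - o1 x"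
          using x by auto
      qed
      show False
      proof (cases "w = (\<lambda>_. 0)")
        case True
        then show False using zero[of g] u(2) s by auto
      next
        case False
        then have f: "v f \<noteq> 0" "w f \<noteq> 0" "f \<noteq> g" using alt by auto
        \<comment> \<open>Here \<open>u\<close> agrees with \<open>w\<close>, which is nonzero at
          \<open>f\<close>; but \<open>F f\<close> contains both signs, so the cocircuit alternative
          forces \<open>u f = 0\<close>.\<close>
        then have "u f \<noteq> 0" using zero[of f] by auto
        then show False using u(3)[OF f(3)] uval[of f] f by (auto simp: F_def)
      qed
    qed
  qed
qed

text \<open>Negating both chains and exchanging the two bases reverses the sign of \<open>v\<close>
  at \<open>g\<close> relative to the orientations.\<close>

lemma pivot_vanish_swap:
  assumes B: "B1 \<in> BB" "B2 \<in> BB"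
    and o1: "\<And>x. x \<in> E \<Longrightarrow> o1 x = 1 \<or> o1 x = -1" and o2: "\<And>x. x \<in> E \<Longrightarrow> o2 x = 1 \<or> o2 x = -1"
    and TV: "separated V B1 B2 o1 o2" and TW: "separated W (E - B1) (E - B2) o1 o2"
    and v: "v \<in> V" and w: "w \<in> W"
    and g: "g \<in> E" "o1 g = s" "o2 g = s" "v g = s"
    and voff: "\<And>x. x \<noteq> g \<Longrightarrow> v x \<noteq> 0 \<Longrightarrow> v x = o2 x \<and> v x = - o1 x"
    and woff: "\<And>x. x \<noteq> g \<Longrightarrow> w x \<noteq> 0 \<Longrightarrow> w x = o2 x \<and> w x = - o1 x"
    and off: "\<And>x. x \<in> E \<Longrightarrow> x \<noteq> g \<Longrightarrow> v x = 0 \<Longrightarrow> w x = 0 \<Longrightarrow> o1 x = o2 x"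
    and alt: "(w = (\<lambda>_. 0) \<and> f = g) \<or> (w g = - s \<and> v f \<noteq> 0 \<and> w f \<noteq> 0 \<and> f \<noteq> g)"
  shows "g \<notin> B1" and "e \<notin> B1 \<Longrightarrow> e \<notin> B2 \<Longrightarrow> e \<noteq> g \<Longrightarrow> e \<noteq> f \<Longrightarrow> v e = 0"
proof -
  interpret D: regular_pair E "(\<lambda>B. E - B) ` BB" W V by (rule dual)
  have voff': "x \<noteq> g \<Longrightarrow> - v x \<noteq> 0 \<Longrightarrow> - v x = o1 x \<and> - v x = - o2 x" for x
    using voff[of x] by simp
  have woff': "x \<noteq> g \<Longrightarrow> - w x \<noteq> 0 \<Longrightarrow> - w x = o1 x \<and> - w x = - o2 x" for x
    using woff[of x] by simp
  have off': "x \<in> E \<Longrightarrow> x \<noteq> g \<Longrightarrow> - v x = 0 \<Longrightarrow> - w x = 0 \<Longrightarrow> o2 x = o1 x" for x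
    using off[of x] by simp
  have alt': "((\<lambda>x. - w x) = (\<lambda>_. 0) \<and> f = g) \<or> (- w g = s \<and> - v f \<noteq> 0 \<and> - w f \<noteq> 0 \<and> f \<noteq> g)"
    using alt by auto
  have vg: "- v g = - s" using g by simp
  note main = pivot_vanish[OF B(2,1) o2 o1 separated_swap[OF TV] D.separated_swap[OF TW]
    V_uminus[OF v] D.V_uminus[OF w] g(1,3,2) vg voff' woff' off' alt']
  show "g \<notin> B1" using main(1) by blast
  show "v e = 0" if "e \<notin> B1" "e \<notin> B2" "e \<noteq> g" "e \<noteq> f" using main(2)[of e] that by simp
qed

end

section \<open>The difference of two orientations\<close>

lemma sum_nonpos_zeroD:
  fixes h :: "'e \<Rightarrow> int"
  assumes "finite A" "\<And>x. x \<in> A \<Longrightarrow> h x \<le> 0" "sum h A = 0" "x \<in> A"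
  shows "h x = 0"
  using sum_nonneg_eq_0_iff[of A "\<lambda>x. - h x"] assms by (simp add: sum_negf)

section \<open>Connectivity through circuits, and the two shapes of the difference\<close>

context regular_pair begin

definition linked :: "'e \<Rightarrow> 'e \<Rightarrow> bool" where
  "linked x y \<longleftrightarrow> x = y \<or> (\<exists>u\<in>elementary V. u x \<noteq> 0 \<and> u y \<noteq> 0)"

lemma linked_sym: "linked x y \<Longrightarrow> linked y x"
  by (auto simp: linked_def)

text \<open>Farkas at \<open>x\<close>, with the support of \<open>w\<close> forbidden except for
  \<open>x\<close> and \<open>y\<close>: a circuit meeting \<open>w\<close> in \<open>x\<close> and
  at most \<open>y\<close> must contain \<open>y\<close> by orthogonality, while a cocircuit inside
  the support of \<open>w\<close> without \<open>y\<close> contradicts minimality.\<close>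

lemma linked_cocircuit:
  assumes w: "w \<in> elementary W" "w x \<noteq> 0" "w y \<noteq> 0"
  shows "linked x y"
proof (cases "x = y")
  case False
  interpret D: regular_pair E "(\<lambda>B. E - B) ` BB" W V by (rule dual)
  have xE: "x \<in> E" using D.V_supp[OF D.elementary_in[OF w(1)] w(2)] .
  define F :: "'e \<Rightarrow> int set" where "F = (\<lambda>z. if w z \<noteq> 0 \<and> z \<noteq> y then {} else {1, -1})"
  have "(\<exists>v\<in>elementary V. v x = 1 \<and> (\<forall>z. z \<noteq> x \<longrightarrow> v z \<noteq> 0 \<longrightarrow> v z \<in> F z)) \<or>
         (\<exists>w\<in>elementary W. w x = 1 \<and> (\<forall>z. z \<noteq> x \<longrightarrow> w z \<noteq> 0 \<longrightarrow> - w z \<notin> F z))"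
    using farkas_elementary[OF xE, of 1 F] by simp
  then show ?thesis
  proof (elim disjE bexE conjE)
    fix v assume v: "v \<in> elementary V" "v x = 1" "\<forall>z. z \<noteq> x \<longrightarrow> v z \<noteq> 0 \<longrightarrow> v z \<in> F z"
    have "v y \<noteq> 0"
    proof
      assume vy: "v y = 0"
      have "v x * w x = 0"
      proof (rule orth_single[OF elementary_in[OF v(1)] D.elementary_in[OF w(1)] xE])
        fix z assume "z \<in> E" "z \<noteq> x"
        then have "v z \<noteq> 0 \<Longrightarrow> v z \<in> F z" using v(3) by blast
        then show "v z * w z = 0" using vy by (cases "v z = 0"; cases "z = y") (auto simp: F_def split: if_splits)
      qed
      then show False using v(2) w(2) by simp
    qed
    then show ?thesis using v(1,2) by (auto simp: linked_def intro!: bexI[of _ v])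
  next
    fix q assume q: "q \<in> elementary W" "q x = 1" "\<forall>z. z \<noteq> x \<longrightarrow> q z \<noteq> 0 \<longrightarrow> - q z \<notin> F z"
    have *: "w z \<noteq> 0 \<and> z \<noteq> y" if "q z \<noteq> 0" for z
    proof (cases "z = x")
      case True
      then show ?thesis using w False by simp
    next
      case zx: False
      then have "- q z \<notin> F z" using q(3) that by blast
      then show ?thesis using D.elementary_values[OF q(1), of z] that by (auto simp: F_def split: if_splits)
    qed
    have "chain_supp q \<subseteq> chain_supp w" using * by (auto simp: chain_supp_def)
    moreover have "q \<noteq> (\<lambda>_. 0)" using q(2) by auto
    ultimately have "chain_supp q = chain_supp w"
      using w(1) D.elementary_in[OF q(1)] by (auto simp: elementary_def)
    then show ?thesis using * w(3) by (auto simp: chain_supp_def)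
  qed
qed (simp add: linked_def)

lemma elementary_eliminate:
  assumes u: "u \<in> elementary V" "v \<in> elementary V" "u t \<noteq> 0" "v t \<noteq> 0" "u x \<noteq> 0" "v x = 0"
  shows "\<exists>q\<in>elementary V. q x \<noteq> 0 \<and> q t = 0 \<and> chain_supp q \<subseteq> chain_supp u \<union> chain_supp v"
proof -
  define d where "d = (\<lambda>y. v t * u y - u t * v y)"
  have "d \<in> V" unfolding d_def
    using V_diff[OF V_scale[OF elementary_in[OF u(1)]] V_scale[OF elementary_in[OF u(2)]]] .
  moreover have "d x \<noteq> 0" using u by (simp add: d_def)
  ultimately obtain q where q: "q \<in> elementary V" "conformal q d" "q x \<noteq> 0"
    using conformal_through by blast
  have *: "q y \<noteq> 0 \<Longrightarrow> d y \<noteq> 0" for y using q(2) by (force simp: conformal_def sgn_0_0)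
  have "q t = 0" using *[of t] by (auto simp: d_def)
  moreover have "chain_supp q \<subseteq> chain_supp u \<union> chain_supp v"
    using * by (force simp: chain_supp_def d_def)
  ultimately show ?thesis using q by blast
qed

lemma elementary_not_subset:
  assumes u: "u \<in> elementary V" "v \<in> elementary V" "v t \<noteq> 0" "u t = 0"
  obtains y where "u y \<noteq> 0" "v y = 0"
proof -
  have "\<not> chain_supp u \<subseteq> chain_supp v"
  proof
    assume "chain_supp u \<subseteq> chain_supp v"
    then have "chain_supp u = chain_supp v" using u by (auto simp: elementary_def)
    then show False using u by (auto simp: chain_supp_def)
  qed
  then show thesis using that by (auto simp: chain_supp_def)
qed

text \<open>Two eliminations: first a circuit \<open>u3\<close> through \<open>x\<close> that avoids
  the common element \<open>t\<close>. If it misses \<open>z\<close>, a second elimination between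
  \<open>u2\<close> and \<open>u3\<close> gives a circuit \<open>u4\<close> through \<open>z\<close>
  that still meets \<open>u1\<close>, while the union with \<open>u1\<close> loses an element
  \<open>y1\<close> of \<open>u2\<close>.\<close>

lemma linked_meeting:
  assumes "u1 \<in> elementary V" "u2 \<in> elementary V" "u1 x \<noteq> 0" "u2 z \<noteq> 0" "u1 t \<noteq> 0" "u2 t \<noteq> 0"
  shows "linked x z"
  using assms
proof (induction "card (chain_supp u1 \<union> chain_supp u2)" arbitrary: u1 u2 t rule: less_induct)
  case less
  note u1 = less(2) and u2 = less(3)
  have fin: "finite (chain_supp u)" if "u \<in> elementary V" for u
    using V_supp[OF elementary_in[OF that]] finite_E by (auto simp: chain_supp_def intro: finite_subset)
  show ?case
  proof (cases "u2 x \<noteq> 0 \<or> u1 z \<noteq> 0")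
    case True
    then show ?thesis using less by (auto simp: linked_def)
  next
    case False
    obtain u3 where u3: "u3 \<in> elementary V" "u3 x \<noteq> 0" "u3 t = 0"
      "chain_supp u3 \<subseteq> chain_supp u1 \<union> chain_supp u2"
      using elementary_eliminate[OF u1 u2 less(6,7,4)] False by blast
    show ?thesis
    proof (cases "u3 z = 0")
      case z3: True
      obtain y1 where y1: "u3 y1 \<noteq> 0" "u1 y1 = 0" using elementary_not_subset[OF u3(1) u1 less(6) u3(3)] .
      then have y12: "u2 y1 \<noteq> 0" using u3(4) by (auto simp: chain_supp_def)
      obtain u4 where u4: "u4 \<in> elementary V" "u4 z \<noteq> 0" "u4 y1 = 0"
        "chain_supp u4 \<subseteq> chain_supp u2 \<union> chain_supp u3"
        using elementary_eliminate[OF u2 u3(1) y12 y1(1) less(5) z3] by blast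
      obtain y2 where y2: "u4 y2 \<noteq> 0" "u2 y2 = 0" using elementary_not_subset[OF u4(1) u2 y12 u4(3)] .
      then have "u3 y2 \<noteq> 0" using u4(4) by (auto simp: chain_supp_def)
      then have y21: "u1 y2 \<noteq> 0" using u3(4) y2(2) by (auto simp: chain_supp_def)
      have "chain_supp u1 \<union> chain_supp u4 \<subseteq> chain_supp u1 \<union> chain_supp u2" using u3(4) u4(4) by auto
      moreover have "y1 \<notin> chain_supp u1 \<union> chain_supp u4" using y1 u4 by (auto simp: chain_supp_def)
      moreover have "y1 \<in> chain_supp u1 \<union> chain_supp u2" using y12 by (auto simp: chain_supp_def)
      ultimately have "chain_supp u1 \<union> chain_supp u4 \<subset> chain_supp u1 \<union> chain_supp u2" by blast
      then have "card (chain_supp u1 \<union> chain_supp u4) < card (chain_supp u1 \<union> chain_supp u2)"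
        using fin[OF u1] fin[OF u2] by (intro psubset_card_mono) auto
      then show ?thesis using less(1)[OF _ u1 u4(1) less(4) u4(2) y21 y2(1)] by blast
    next
      case False
      then show ?thesis using u3 by (auto simp: linked_def)
    qed
  qed
qed

lemma linked_trans: "linked x y \<Longrightarrow> linked y z \<Longrightarrow> linked x z"
  using linked_meeting unfolding linked_def by blast

text \<open>A conformal elementary part of \<open>v\<close> that avoids \<open>g\<close> has the
  signs of \<open>o2\<close> and of \<open>- o1\<close> on its whole support, which separation
  excludes.\<close>

lemma through_pivot:
  assumes TV: "separated V B1 B2 o1 o2" and v: "v \<in> V" and x: "v x \<noteq> 0"
    and o2: "\<And>x. x \<in> E \<Longrightarrow> o2 x = 1 \<or> o2 x = -1"
    and off: "\<And>x. x \<noteq> g \<Longrightarrow> v x \<noteq> 0 \<Longrightarrow> v x = o2 x \<and> v x = - o1 x"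
  shows "\<exists>u\<in>elementary V. u x \<noteq> 0 \<and> u g \<noteq> 0"
proof -
  obtain u where u: "u \<in> elementary V" "conformal u v" "u x \<noteq> 0"
    using conformal_through[of v x, OF v x] by blast
  have "u g \<noteq> 0"
  proof
    assume ug: "u g = 0"
    have "u x = 0"
    proof (rule separatedD[OF TV elementary_in[OF u(1)]])
      fix y assume y: "y \<in> E" "u y \<noteq> 0"
      then have eq: "sgn (u y) = sgn (v y)" using u(2) by (simp add: conformal_def)
      then have "v y \<noteq> 0" using y(2) by (auto simp: sgn_0_0)
      moreover have "y \<noteq> g" using y ug by auto
      ultimately have "v y = o2 y" "v y = - o1 y" using off by auto
      then show "sgn (u y) = o2 y" "sgn (u y) = - o1 y" using eq o2[OF y(1)] by auto
    qed
    then show False using u by simp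
  qed
  then show ?thesis using u by blast
qed

text \<open>The case in which only one of the two chains is present; the pivot is then the support
  \<open>f\<close> of the arc itself.\<close>

lemma core_single:
  assumes B: "B1 \<in> BB" "B2 \<in> BB"
    and o1: "\<And>x. x \<in> E \<Longrightarrow> o1 x = 1 \<or> o1 x = -1" and o2: "\<And>x. x \<in> E \<Longrightarrow> o2 x = 1 \<or> o2 x = -1"
    and TV: "separated V B1 B2 o1 o2" and TW: "separated W (E - B1) (E - B2) o1 o2"
    and v: "v \<in> V" and f: "f \<in> E" and s: "s = 1 \<or> s = -1"
    and eq: "\<And>x. x \<in> E \<Longrightarrow> 2 * (v x + (if x = f then s else 0)) = o2 x - o1 x"
  shows "e \<notin> B1 \<Longrightarrow> e \<notin> B2 \<Longrightarrow> e \<noteq> f \<Longrightarrow> v e = 0"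
    and "v x \<noteq> 0 \<Longrightarrow> \<exists>u\<in>elementary V. u x \<noteq> 0 \<and> u f \<noteq> 0"
proof -
  have vE: "v x \<noteq> 0 \<Longrightarrow> x \<in> E" for x using V_supp[OF v] .
  have off: "v x = o2 x \<and> v x = - o1 x" if x: "x \<noteq> f" "v x \<noteq> 0" for x
    using eq[OF vE[OF x(2)]] o1[OF vE[OF x(2)]] o2[OF vE[OF x(2)]] x by auto
  show "v x \<noteq> 0 \<Longrightarrow> \<exists>u\<in>elementary V. u x \<noteq> 0 \<and> u f \<noteq> 0"
    using through_pivot[OF TV v _ o2 off] .
  have off0: "o1 x = o2 x" if x: "x \<in> E" "x \<noteq> f" "v x = 0" for x
    using eq[OF x(1)] x by auto
  assume e: "e \<notin> B1" "e \<notin> B2" "e \<noteq> f"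
  show "v e = 0"
  proof (cases "v f = - s")
    case False
    \<comment> \<open>If \<open>v\<close> does not cancel the arc at \<open>f\<close>, then it
      vanishes there or follows the change from \<open>o1\<close> to \<open>o2\<close> there as
      well, so separation kills \<open>v\<close> completely.\<close>
    have vf: "v f = 0 \<or> (v f = - 2 * s \<and> o2 f = - s \<and> o1 f = s)"
      using eq[OF f] o1[OF f] o2[OF f] False s by auto
    have *: "sgn (v x) = o2 x \<and> sgn (v x) = - o1 x" if "x \<in> E" "v x \<noteq> 0" for x
    proof (cases "x = f")
      case True
      then show ?thesis using vf that s by auto
    next
      case False
      then show ?thesis using off[OF False that(2)] o2[OF that(1)] by auto
    qed
    show ?thesis by (rule separatedD[OF TV v]) (use * in blast)+
  next
    case True
    then have o12: "o1 f = o2 f" using eq[OF f] by simp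
    show ?thesis
    proof (cases "o1 f = s")
      case True
      show ?thesis
        using pivot_vanish(2)[OF B o1 o2 TV TW v W_zero f, of s f e] True o12 \<open>v f = - s\<close> off off0 e
        by auto
    next
      case False
      then have "o1 f = - s" using o1[OF f] s by auto
      then show ?thesis
        using pivot_vanish_swap(2)[OF B o1 o2 TV TW v W_zero f, of "- s" f e] o12 \<open>v f = - s\<close> off off0 e
        by auto
    qed
  qed
qed

text \<open>The claim on \<open>w\<close> is the claim on \<open>v\<close> for the dual pair, since
  lying in both bases means lying outside both complements. With disjoint supports one chain
  vanishes and \<open>core_single\<close> applies; otherwise both pivot lemmas are used, one on each
  side.\<close>

lemma core:
  assumes B: "B1 \<in> BB" "B2 \<in> BB"
    and o1: "\<And>x. x \<in> E \<Longrightarrow> o1 x = 1 \<or> o1 x = -1" and o2: "\<And>x. x \<in> E \<Longrightarrow> o2 x = 1 \<or> o2 x = -1"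
    and TV: "separated V B1 B2 o1 o2" and TW: "separated W (E - B1) (E - B2) o1 o2"
    and v: "v \<in> V" and w: "w \<in> W" and f: "f \<in> E" and s: "s = 1 \<or> s = -1"
    and eq: "\<And>x. x \<in> E \<Longrightarrow> 2 * (v x + w x + (if x = f then s else 0)) = o2 x - o1 x"
  shows "(\<forall>e. e \<notin> B1 \<longrightarrow> e \<notin> B2 \<longrightarrow> e \<noteq> f \<longrightarrow> v e = 0) \<and>
    (\<forall>e. e \<in> B1 \<longrightarrow> e \<in> B2 \<longrightarrow> e \<noteq> f \<longrightarrow> w e = 0) \<and>
    (\<forall>x\<in>E. o1 x \<noteq> o2 x \<longrightarrow> linked x f)"
proof -
  interpret D: regular_pair E "(\<lambda>B. E - B) ` BB" W V by (rule dual)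
  have DB: "E - B1 \<in> (\<lambda>B. E - B) ` BB" "E - B2 \<in> (\<lambda>B. E - B) ` BB" using B by auto
  have EE: "E - (E - B1) = B1" "E - (E - B2) = B2" using B bases_sub by blast+
  have TV': "separated V (E - (E - B1)) (E - (E - B2)) o1 o2" using TV EE by simp
  have vE: "v x \<noteq> 0 \<Longrightarrow> x \<in> E" for x using V_supp[OF v] .
  have wE: "w x \<noteq> 0 \<Longrightarrow> x \<in> E" for x using D.V_supp[OF w] .
  have voff0: "v x = o2 x \<and> v x = - o1 x" if "x \<noteq> f" "v x \<noteq> 0" "w x = 0" for x
    using eq[OF vE[OF that(2)]] o1[OF vE[OF that(2)]] o2[OF vE[OF that(2)]] that by auto
  have woff0: "w x = o2 x \<and> w x = - o1 x" if "x \<noteq> f" "w x \<noteq> 0" "v x = 0" for x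
    using eq[OF wE[OF that(2)]] o1[OF wE[OF that(2)]] o2[OF wE[OF that(2)]] that by auto
  have link_W: "linked x y" if "\<exists>u\<in>elementary W. u x \<noteq> 0 \<and> u y \<noteq> 0" for x y
    using that linked_cocircuit by blast
  have link_V: "linked x y" if "\<exists>u\<in>elementary V. u x \<noteq> 0 \<and> u y \<noteq> 0" for x y
    using that by (auto simp: linked_def)
  \<comment> \<open>Equal signs would give the sum absolute value at least 2, but half the
    difference of two signs is at most 1.\<close>
  have le: "v x * w x \<le> 0" if "x \<in> E" "x \<noteq> f" for x
  proof (rule ccontr)
    assume "\<not> v x * w x \<le> 0"
    then have "(v x > 0 \<and> w x > 0) \<or> (v x < 0 \<and> w x < 0)" by (auto simp: not_le zero_less_mult_iff)
    then show False using eq[OF that(1)] o1[OF that(1)] o2[OF that(1)] that(2) by auto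
  qed
  have sum: "v f * w f + (\<Sum>x\<in>E - {f}. v x * w x) = 0"
    using orth[OF v w] sum.remove[OF finite_E f, of "\<lambda>x. v x * w x"] by simp
  show ?thesis
  proof (cases "v f * w f \<le> 0")
    case True
    then have nonpos: "v x * w x \<le> 0" if "x \<in> E" for x using le that by blast
    have "v x * w x = 0" if "x \<in> E" for x
      using sum_nonpos_zeroD[OF finite_E, of "\<lambda>x. v x * w x"] nonpos orth[OF v w] that by blast
    then have disj: "v x = 0 \<or> w x = 0" for x using vE by fastforce
    show ?thesis
    proof (cases "v f = 0")
      case True
      \<comment> \<open>Supports are disjoint and \<open>v\<close> misses \<open>f\<close>, so
        \<open>v\<close> follows the change from \<open>o1\<close> to \<open>o2\<close> on its whole
        support.\<close>
      have "v x = 0" for x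
      proof (rule separatedD[OF TV v])
        fix y assume y: "y \<in> E" "v y \<noteq> 0"
        then have "y \<noteq> f" "w y = 0" using True disj[of y] by auto
        then have "v y = o2 y" "v y = - o1 y" using voff0 y by auto
        then show "sgn (v y) = o2 y" "sgn (v y) = - o1 y" using o2[OF y(1)] by auto
      qed
      then have v0: "v = (\<lambda>_. 0)" by auto
      have eqw: "2 * (w x + (if x = f then s else 0)) = o2 x - o1 x" if "x \<in> E" for x
        using eq[OF that] v0 by simp
      note single = D.core_single[OF DB o1 o2 TW TV' w f s eqw]
      have "w e = 0" if "e \<in> B1" "e \<in> B2" "e \<noteq> f" for e using single(1)[of e] that by simp
      moreover have "linked x f" if x: "x \<in> E" "o1 x \<noteq> o2 x" for x
      proof (cases "x = f")
        case False
        then have "w x \<noteq> 0" using eqw[OF x(1)] x(2) by auto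
        then show ?thesis using single(2) link_W by blast
      qed (simp add: linked_def)
      ultimately show ?thesis using v0 by blast
    next
      case False
      then have wf: "w f = 0" using disj by auto
      have "w x = 0" for x
      proof (rule D.separatedD[OF TW w])
        fix y assume y: "y \<in> E" "w y \<noteq> 0"
        then have "y \<noteq> f" "v y = 0" using wf disj[of y] by auto
        then have "w y = o2 y" "w y = - o1 y" using woff0 y by auto
        then show "sgn (w y) = o2 y" "sgn (w y) = - o1 y" using o2[OF y(1)] by auto
      qed
      then have w0: "w = (\<lambda>_. 0)" by auto
      have eqv: "2 * (v x + (if x = f then s else 0)) = o2 x - o1 x" if "x \<in> E" for x
        using eq[OF that] w0 by simp
      note single = core_single[OF B o1 o2 TV TW v f s eqv]
      have "v e = 0" if "e \<notin> B1" "e \<notin> B2" "e \<noteq> f" for e using single(1)[of e] that by simp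
      moreover have "linked x f" if x: "x \<in> E" "o1 x \<noteq> o2 x" for x
      proof (cases "x = f")
        case False
        then have "v x \<noteq> 0" using eqv[OF x(1)] x(2) by auto
        then show ?thesis using single(2) link_V by blast
      qed (simp add: linked_def)
      ultimately show ?thesis using w0 by blast
    qed
  next
    case False
    then have "(v f > 0 \<and> w f > 0) \<or> (v f < 0 \<and> w f < 0)" by (auto simp: not_le zero_less_mult_iff)
    \<comment> \<open>Both coefficients at \<open>f\<close> have the same sign, and
      \<open>v f + w f + s\<close> is at most 1 in absolute value, which leaves only
      \<open>- s\<close> for both. The remaining products are nonpositive integers with sum -1, so
      exactly one of them is nonzero.\<close>
    then have vf: "v f = - s" "w f = - s" "o1 f = s" "o2 f = - s"
      using eq[OF f] o1[OF f] o2[OF f] s by auto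
    then have sum1: "(\<Sum>x\<in>E - {f}. v x * w x) = -1" using sum s by auto
    then obtain g where g: "g \<in> E - {f}" "v g * w g \<noteq> 0"
      using sum.neutral[of "E - {f}" "\<lambda>x. v x * w x"] by fastforce
    have gE: "g \<in> E" and gf: "g \<noteq> f" using g by auto
    have "v g * w g < 0" using g(2) le[OF gE gf] by (rule le_neq_trans[rotated])
    then have vg0: "v g * w g \<le> -1" by linarith
    have fin: "finite (E - {f} - {g})" using finite_E by simp
    have sum2: "v g * w g + (\<Sum>x\<in>E - {f} - {g}. v x * w x) = -1"
      using sum1 sum.remove[of "E - {f}" g "\<lambda>x. v x * w x"] finite_E g by simp
    moreover have "(\<Sum>x\<in>E - {f} - {g}. v x * w x) \<le> 0" using le by (intro sum_nonpos) auto
    ultimately have vg1: "v g * w g = -1" "(\<Sum>x\<in>E - {f} - {g}. v x * w x) = 0" using vg0 by auto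
    have "v x * w x = 0" if "x \<in> E - {f} - {g}" for x
      using sum_nonpos_zeroD[OF fin, of "\<lambda>x. v x * w x"] vg1(2) le that by auto
    then have disj: "v x = 0 \<or> w x = 0" if "x \<noteq> f" "x \<noteq> g" for x using vE that by fastforce
    have vwg: "w g = - v g" "v g = 1 \<or> v g = -1"
    proof -
      have "v g dvd 1" using vg1(1) by (metis dvd_triv_left dvd_minus_iff)
      then show "v g = 1 \<or> v g = -1" by auto
      then show "w g = - v g" using vg1(1) by auto
    qed
    have og: "o1 g = o2 g" using eq[OF gE] gf vwg by simp
    have vg: "v g = - o1 g \<or> v g = o1 g" using vwg(2) o1[OF gE] by auto
    have voff: "v x = o2 x \<and> v x = - o1 x" if "x \<noteq> g" "v x \<noteq> 0" for x
      using voff0[of x] that disj[of x] vf by (cases "x = f") auto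
    have woff: "w x = o2 x \<and> w x = - o1 x" if "x \<noteq> g" "w x \<noteq> 0" for x
      using woff0[of x] that disj[of x] vf by (cases "x = f") auto
    have off: "o1 x = o2 x" if "x \<in> E" "v x = 0" "w x = 0" for x
    proof -
      have "x \<noteq> f" using that vf s by auto
      then show ?thesis using eq[OF that(1)] that by simp
    qed
    have vfn: "v f \<noteq> 0" "w f \<noteq> 0" "f \<noteq> g" using vf s gf by auto
    have main: "(\<forall>e. e \<notin> B1 \<longrightarrow> e \<notin> B2 \<longrightarrow> e \<noteq> f \<longrightarrow> v e = 0) \<and>
      (\<forall>e. e \<in> B1 \<longrightarrow> e \<in> B2 \<longrightarrow> e \<noteq> f \<longrightarrow> w e = 0)"
      using vg
    proof
      assume a: "v g = - o1 g"
      have alt: "(w = (\<lambda>_. 0) \<and> f = g) \<or> (w g = o1 g \<and> v f \<noteq> 0 \<and> w f \<noteq> 0 \<and> f \<noteq> g)"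
        using a vwg vfn by simp
      have alt': "(v = (\<lambda>_. 0) \<and> f = g) \<or> (v g = - o1 g \<and> w f \<noteq> 0 \<and> v f \<noteq> 0 \<and> f \<noteq> g)"
        using a vwg vfn by simp
      have wg: "w g = o1 g" using a vwg by simp
      note pv = pivot_vanish[OF B o1 o2 TV TW v w gE refl og[symmetric] a voff woff off alt]
      note pw = D.pivot_vanish_swap[OF DB o1 o2 TW TV' w v gE refl og[symmetric] wg woff voff off alt']
      \<comment> \<open>The first pivot lemma shows that \<open>g\<close> misses one basis, the dual
        one that it lies in the other. Hence \<open>g\<close> differs from every \<open>e\<close> in
        both or in neither basis, as the vanishing claims require.\<close>
      have "g \<notin> B2" using pv(1) by blast
      moreover have "g \<in> B1" using pw(1) gE by blast
      ultimately show ?thesis using pv(2) pw(2) by blast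
    next
      assume a: "v g = o1 g"
      have alt: "(w = (\<lambda>_. 0) \<and> f = g) \<or> (w g = - o1 g \<and> v f \<noteq> 0 \<and> w f \<noteq> 0 \<and> f \<noteq> g)"
        using a vwg vfn by simp
      have alt': "(v = (\<lambda>_. 0) \<and> f = g) \<or> (v g = o1 g \<and> w f \<noteq> 0 \<and> v f \<noteq> 0 \<and> f \<noteq> g)"
        using a vwg vfn by simp
      have wg: "w g = - o1 g" using a vwg by simp
      note pv = pivot_vanish_swap[OF B o1 o2 TV TW v w gE refl og[symmetric] a voff woff off alt]
      note pw = D.pivot_vanish[OF DB o1 o2 TW TV' w v gE refl og[symmetric] wg woff voff off alt']
      have "g \<notin> B1" using pv(1) by blast
      moreover have "g \<in> B2" using pw(1) gE by blast
      ultimately show ?thesis using pv(2) pw(2) by blast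
    qed
    have "linked f g" using link_V[OF through_pivot[OF TV v vfn(1) o2 voff]] by blast
    then have gf_link: "linked g f" by (rule linked_sym)
    have "linked x f" if x: "x \<in> E" "o1 x \<noteq> o2 x" for x
    proof -
      have "v x \<noteq> 0 \<or> w x \<noteq> 0" using off x by blast
      then have "linked x g"
        using link_V[OF through_pivot[OF TV v _ o2 voff]] link_W[OF D.through_pivot[OF TW w _ o2 woff]]
        by blast
      then show ?thesis using linked_trans gf_link by blast
    qed
    then show ?thesis using main by blast
  qed
qed

end

section \<open>Equivalence classes of orientations\<close>

definition matroid_of_pair ::
    "'e set \<Rightarrow> 'e set set \<Rightarrow> 'e chain set \<Rightarrow> 'e chain set \<Rightarrow> 'e signed_matroid" where
  "matroid_of_pair E BB V W = \<lparr>ground = E, bases = BB,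
     signed_circuits = elementary V, signed_cocircuits = elementary W\<rparr>"

definition lattice_sum :: "'e chain set \<Rightarrow> 'e chain set \<Rightarrow> 'e chain set" where
  "lattice_sum V W = {\<lambda>x. v x + w x | v w. v \<in> V \<and> w \<in> W}"

text \<open>Reversing a compatible simple chain \<open>u\<close> in an orientation subtracts \<open>u\<close> from its positive part.\<close>

definition positive_part :: "'e fourientation \<Rightarrow> 'e chain" where
  "positive_part F = (\<lambda>x. if 1 \<in> F x then 1 else 0)"

lemma lattice_sum_commute: "lattice_sum V W = lattice_sum W V"
proof -
  have "(\<lambda>x. v x + w x) = (\<lambda>x. w x + v x)" for v w :: "'a chain" by (auto simp: add.commute)
  then show ?thesis unfolding lattice_sum_def by blast
qed

lemma chains_iff: "P \<in> chains E \<longleftrightarrow> (\<forall>x. x \<notin> E \<longrightarrow> P x = 0)"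
  by (auto simp: chains_def chain_supp_def)

lemma comm_group_chain_group: "comm_group (chain_group E)"
proof (rule comm_groupI)
  show "\<And>x. x \<in> carrier (chain_group E) \<Longrightarrow>
      \<exists>y\<in>carrier (chain_group E). y \<otimes>\<^bsub>chain_group E\<^esub> x = \<one>\<^bsub>chain_group E\<^esub>"
    by (rule_tac x = "\<lambda>z. - x z" in bexI) (auto simp: chain_group_def chains_iff)
qed (auto simp: chain_group_def chains_iff fun_eq_iff)

lemma chain_group_simps:
  "carrier (chain_group E) = chains E"
  "P \<otimes>\<^bsub>chain_group E\<^esub> Q = (\<lambda>x. P x + Q x)"
  "\<one>\<^bsub>chain_group E\<^esub> = (\<lambda>_. 0)"
  by (auto simp: chain_group_def)

lemma chain_group_inv:
  assumes "P \<in> chains E"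
  shows "inv\<^bsub>chain_group E\<^esub> P = (\<lambda>x. - P x)"
proof -
  interpret comm_group "chain_group E" by (rule comm_group_chain_group)
  show ?thesis
    using assms by (intro inv_equality) (auto simp: chain_group_simps chains_def chain_supp_def)
qed

lemma orientation_cases:
  assumes "F \<in> orientations E" "x \<in> E"
  shows "F x = {1} \<or> F x = {-1}"
  using assms by (auto simp: orientations_def)

lemma orientation_eqI:
  assumes "F \<in> orientations E" "F' \<in> orientations E"
    and "\<And>x. x \<in> E \<Longrightarrow> positive_part F x = positive_part F' x"
  shows "F = F'"
proof
  fix x
  show "F x = F' x"
  proof (cases "x \<in> E")
    case True
    then show ?thesis
      using orientation_cases[OF assms(1) True] orientation_cases[OF assms(2) True] assms(3)[OF True]
      by (auto simp: positive_part_def)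
  next
    case False
    then show ?thesis using assms by (auto simp: orientations_def)
  qed
qed

lemma reverse_orientation:
  assumes "F \<in> orientations E"
  shows "reverse_on S F \<in> orientations E"
  using assms by (force simp: orientations_def reverse_on_def)

lemma positive_part_reverse:
  assumes F: "F \<in> orientations E" and u: "chain_compatible u F" "\<And>x. u x = -1 \<or> u x = 0 \<or> u x = 1"
  shows "positive_part (reverse_on (chain_supp u) F) = (\<lambda>x. positive_part F x - u x)"
proof
  fix x
  show "positive_part (reverse_on (chain_supp u) F) x = positive_part F x - u x"
  proof (cases "u x = 0")
    case True
    then show ?thesis by (simp add: reverse_on_def positive_part_def chain_supp_def)
  next
    case False
    then have c: "sgn (u x) \<in> F x" using u(1) by (auto simp: chain_compatible_def chain_supp_def)
    then have "x \<in> E" using F by (auto simp: orientations_def)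
    have "F x = {1} \<and> u x = 1 \<or> F x = {-1} \<and> u x = -1"
      using orientation_cases[OF F \<open>x \<in> E\<close>] c u(2)[of x] False by (elim disjE) simp_all
    then show ?thesis by (elim disjE) (simp_all add: reverse_on_def positive_part_def chain_supp_def)
  qed
qed

lemma compatible_of_difference:
  assumes F: "F \<in> orientations E" "F' \<in> orientations E"
    and u: "\<And>x. u x \<noteq> 0 \<Longrightarrow> sgn (u x) = sgn (positive_part F x - positive_part F' x)"
  shows "chain_compatible u F" "chain_compatible (\<lambda>x. - u x) F'"
proof -
  have "sgn (u x) \<in> F x \<and> sgn (- u x) \<in> F' x" if ux: "u x \<noteq> 0" for x
  proof -
    have "sgn (u x) \<noteq> 0" using ux by (simp add: sgn_0_0)
    then have ne: "positive_part F x \<noteq> positive_part F' x" using u[OF ux] by auto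
    then have "x \<in> E" using F by (auto simp: positive_part_def orientations_def split: if_splits)
    then show ?thesis
      using orientation_cases[OF F(1)] orientation_cases[OF F(2)] u[OF ux] ne
      by (auto simp: positive_part_def sgn_minus)
  qed
  then show "chain_compatible u F" "chain_compatible (\<lambda>x. - u x) F'"
    by (auto simp: chain_compatible_def chain_supp_def)
qed

section \<open>Lattice description of the equivalence classes\<close>

context regular_pair begin

abbreviation rmat :: "'e signed_matroid" where
  "rmat \<equiv> matroid_of_pair E BB V W"

abbreviation lat :: "'e chain set" where
  "lat \<equiv> lattice_sum V W"

lemma rmat_simps [simp]:
  "ground rmat = E" "bases rmat = BB" "signed_circuits rmat = elementary V"
  "signed_cocircuits rmat = elementary W"
  by (auto simp: matroid_of_pair_def)

lemma W_add: "u \<in> W \<Longrightarrow> v \<in> W \<Longrightarrow> (\<lambda>x. u x + v x) \<in> W"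
  by (rule regular_pair.V_add[OF dual])

lemma lat_intro: "v \<in> V \<Longrightarrow> w \<in> W \<Longrightarrow> (\<lambda>x. v x + w x) \<in> lat"
  by (auto simp: lattice_sum_def)

lemma lat_V: "v \<in> V \<Longrightarrow> v \<in> lat"
  using lat_intro[OF _ W_zero, of v] by simp

lemma lat_W: "w \<in> W \<Longrightarrow> w \<in> lat"
  using lat_intro[OF V_zero, of w] by simp

lemma lat_zero: "(\<lambda>_. 0) \<in> lat"
  using lat_V[OF V_zero] .

lemma lat_diff:
  assumes "p \<in> lat" "q \<in> lat"
  shows "(\<lambda>x. p x - q x) \<in> lat"
proof -
  obtain v w where p: "v \<in> V" "w \<in> W" "p = (\<lambda>x. v x + w x)" using assms(1) by (auto simp: lattice_sum_def)
  obtain v' w' where q: "v' \<in> V" "w' \<in> W" "q = (\<lambda>x. v' x + w' x)" using assms(2) by (auto simp: lattice_sum_def)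
  have "(\<lambda>x. (v x - v' x) + (w x - w' x)) \<in> lat"
    using p q V_diff W_diff by (intro lat_intro) auto
  moreover have "(\<lambda>x. (v x - v' x) + (w x - w' x)) = (\<lambda>x. p x - q x)" using p q by auto
  ultimately show ?thesis by simp
qed

lemma lat_uminus: "p \<in> lat \<Longrightarrow> (\<lambda>x. - p x) \<in> lat"
  using lat_diff[OF lat_zero] by simp

lemma lat_add: "p \<in> lat \<Longrightarrow> q \<in> lat \<Longrightarrow> (\<lambda>x. p x + q x) \<in> lat"
  using lat_diff[OF _ lat_uminus] by fastforce

lemma lat_chains: "lat \<subseteq> chains E"
  using V_sub W_sub by (fastforce simp: lattice_sum_def chains_iff)

lemma subgroup_lat: "subgroup lat (chain_group E)"
proof -
  interpret comm_group "chain_group E" by (rule comm_group_chain_group)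
  show ?thesis
  proof (rule subgroupI)
    show "lat \<subseteq> carrier (chain_group E)" using lat_chains by (simp add: chain_group_simps)
    show "lat \<noteq> {}" using lat_zero by blast
    show "inv\<^bsub>chain_group E\<^esub> a \<in> lat" if "a \<in> lat" for a
      using lat_uminus[OF that] chain_group_inv[of a E] that lat_chains by auto
    show "a \<otimes>\<^bsub>chain_group E\<^esub> b \<in> lat" if "a \<in> lat" "b \<in> lat" for a b
      using lat_add that by (simp add: chain_group_simps)
  qed
qed

text \<open>Splitting off conformal elementary chains writes every element of \<open>V\<close> as a
  sum of them.\<close>

lemma generate_elementary: "generate (chain_group E) (elementary V) = V"
proof
  interpret comm_group "chain_group E" by (rule comm_group_chain_group)
  show "generate (chain_group E) (elementary V) \<subseteq> V"
  proof
    fix p assume "p \<in> generate (chain_group E) (elementary V)"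
    then show "p \<in> V"
    proof (induction rule: generate.induct)
      case one
      then show ?case using V_zero by (simp add: chain_group_simps)
    next
      case (incl h)
      then show ?case by (rule elementary_in)
    next
      case (inv h)
      then have "h \<in> V" by (rule elementary_in)
      then show ?case using V_sub V_uminus chain_group_inv[of h E] by auto
    next
      case (eng h1 h2)
      then show ?case using V_add by (simp add: chain_group_simps)
    qed
  qed
  show "V \<subseteq> generate (chain_group E) (elementary V)"
  proof
    fix v assume "v \<in> V"
    then show "v \<in> generate (chain_group E) (elementary V)"
    proof (induction "\<Sum>y\<in>E. nat \<bar>v y\<bar>" arbitrary: v rule: less_induct)
      case less
      show ?case
      proof (cases "v = (\<lambda>_. 0)")
        case True
        then show ?thesis using generate.one[of "chain_group E" "elementary V"] by (simp add: chain_group_simps)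
      next
        case False
        then obtain u where u: "u \<in> elementary V" "conformal u v"
          using conformal_elementary less(2) by blast
        have "(\<lambda>y. v y - u y) \<in> generate (chain_group E) (elementary V)"
          by (rule less(1)[OF conformal_subtract(2)[OF u] V_diff[OF less(2) elementary_in[OF u(1)]]])
        from generate.eng[OF this generate.incl[OF u(1)]] show ?thesis
          by (simp add: chain_group_simps)
      qed
    qed
  qed
qed

lemma cc_lattice_rmat: "cc_lattice rmat = lat"
proof -
  have "generate (chain_group E) (elementary W) = W"
    by (rule regular_pair.generate_elementary[OF dual])
  then show ?thesis
    using generate_elementary
    by (auto simp: cc_lattice_def Let_def set_mult_def chain_group_simps lattice_sum_def)
qed

lemma mem_sandpile_class: "q \<in> sandpile_class rmat p \<longleftrightarrow> (\<lambda>x. q x - p x) \<in> lat"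
  unfolding sandpile_class_def cc_lattice_rmat r_coset_def
  by (auto simp: chain_group_simps intro!: bexI[of _ "\<lambda>x. q x - p x"])

text \<open>A common element with equal signs would violate the bound, so all terms of the
  orthogonality sum are nonpositive and hence 0.\<close>

lemma lattice_simple_disjoint:
  assumes v: "v \<in> V" and w: "w \<in> W" and b: "\<And>x. x \<in> E \<Longrightarrow> \<bar>v x + w x\<bar> \<le> 1"
  shows "v x = 0 \<or> w x = 0"
proof (rule ccontr)
  assume c: "\<not> (v x = 0 \<or> w x = 0)"
  then have xE: "x \<in> E" using V_supp[OF v] by blast
  have "v y * w y \<le> 0" if "y \<in> E" for y
  proof (rule ccontr)
    assume "\<not> v y * w y \<le> 0"
    then have "(v y > 0 \<and> w y > 0) \<or> (v y < 0 \<and> w y < 0)" by (auto simp: not_le zero_less_mult_iff)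
    then show False using b[OF that] by auto
  qed
  then have "v x * w x = 0"
    using sum_nonpos_zeroD[OF finite_E, of "\<lambda>x. v x * w x"] orth[OF v w] xE by blast
  then show False using c by simp
qed

lemma conformal_sum:
  assumes v: "v \<in> V" "v y \<noteq> 0" and disj: "\<And>x. v x = 0 \<or> w x = 0"
  shows "\<exists>u\<in>elementary V. conformal u (\<lambda>x. v x + w x) \<and> u y \<noteq> 0"
proof -
  obtain u where u: "u \<in> elementary V" "conformal u v" "u y \<noteq> 0"
    using conformal_through[OF v] by blast
  have "conformal v (\<lambda>x. v x + w x)" using disj unfolding conformal_def by (metis add_0_right)
  then show ?thesis using u conformal_trans by blast
qed

text \<open>Because the two summands have disjoint supports, a conformal part of either is also
  conformal to \<open>d\<close>.\<close>

lemma lat_conformal: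
  assumes d: "d \<in> lat" "\<And>x. \<bar>d x\<bar> \<le> 1" and y: "d y \<noteq> 0"
  shows "\<exists>u\<in>elementary V \<union> elementary W. conformal u d \<and> u y \<noteq> 0"
proof -
  obtain v w where vw: "v \<in> V" "w \<in> W" "d = (\<lambda>x. v x + w x)" using d(1) by (auto simp: lattice_sum_def)
  have disj: "v x = 0 \<or> w x = 0" for x
    using lattice_simple_disjoint[OF vw(1,2)] d(2) vw(3) by blast
  have "v y \<noteq> 0 \<or> w y \<noteq> 0" using y vw(3) by auto
  then show ?thesis
  proof
    assume "v y \<noteq> 0"
    from conformal_sum[OF vw(1) this disj] show ?thesis unfolding vw(3) by blast
  next
    assume "w y \<noteq> 0"
    have "w x = 0 \<or> v x = 0" for x using disj by blast
    from regular_pair.conformal_sum[OF dual vw(2) \<open>w y \<noteq> 0\<close> this]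
    show ?thesis unfolding vw(3) by (auto simp: add.commute)
  qed
qed

lemma elementary_union_values: "u \<in> elementary V \<union> elementary W \<Longrightarrow> u x = -1 \<or> u x = 0 \<or> u x = 1"
  using elementary_values regular_pair.elementary_values[OF dual] by blast

lemma elementary_union_lat: "u \<in> elementary V \<union> elementary W \<Longrightarrow> u \<in> lat"
  using lat_V lat_W by (auto simp: elementary_def)

lemma elementary_union_uminus:
  "u \<in> elementary V \<union> elementary W \<Longrightarrow> (\<lambda>x. - u x) \<in> elementary V \<union> elementary W"
  using elementary_uminus regular_pair.elementary_uminus[OF dual] by blast

lemma cc_move_rmat:
  assumes "F \<in> orientations E"
  shows "cc_move rmat F F' \<longleftrightarrow> (\<exists>u\<in>elementary V \<union> elementary W. chain_compatible u F \<and>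
     F' \<in> orientations E \<and> positive_part F' = (\<lambda>x. positive_part F x - u x))"
    (is "?L \<longleftrightarrow> ?R")
proof
  assume ?L
  then show ?R
    using reverse_orientation[OF assms] positive_part_reverse[OF assms] elementary_union_values
    unfolding cc_move_def rmat_simps by metis
next
  assume ?R
  then obtain u where u: "u \<in> elementary V \<union> elementary W" "chain_compatible u F"
    "F' \<in> orientations E" "positive_part F' = (\<lambda>x. positive_part F x - u x)" by blast
  have "F' = reverse_on (chain_supp u) F"
    using u positive_part_reverse[OF assms u(2) elementary_union_values[OF u(1)]]
    by (intro orientation_eqI[OF u(3) reverse_orientation[OF assms]]) simp
  then show ?L using u unfolding cc_move_def rmat_simps by blast
qed

text \<open>A move changes the positive part by a lattice element. Conversely, an elementary part
  conformal to the difference of positive parts gives a legal move towards \<open>F'\<close>, and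
  the number of disagreements decreases.\<close>

lemma cc_class_rmat:
  assumes F: "F \<in> orientations E"
  shows "cc_class rmat F = {F' \<in> orientations E. (\<lambda>x. positive_part F' x - positive_part F x) \<in> lat}"
proof (intro equalityI subsetI)
  fix F' assume "F' \<in> cc_class rmat F"
  then have "(cc_move rmat)\<^sup>*\<^sup>* F F'" by (simp add: cc_class_def)
  then have "F' \<in> orientations E \<and> (\<lambda>x. positive_part F' x - positive_part F x) \<in> lat"
  proof (induction rule: rtranclp_induct)
    case base
    then show ?case using F lat_zero by simp
  next
    case (step F1 F2)
    then obtain u where u: "u \<in> elementary V \<union> elementary W" "F2 \<in> orientations E"
      "positive_part F2 = (\<lambda>x. positive_part F1 x - u x)" using cc_move_rmat by blast
    have "(\<lambda>x. positive_part F1 x - positive_part F x - u x) \<in> lat"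
      using lat_diff[OF _ elementary_union_lat[OF u(1)]] step(3) by fastforce
    moreover have "(\<lambda>x. positive_part F1 x - positive_part F x - u x) = (\<lambda>x. positive_part F2 x - positive_part F x)"
      using u(3) by auto
    ultimately show ?case using u(2) by simp
  qed
  then show "F' \<in> {F' \<in> orientations E. (\<lambda>x. positive_part F' x - positive_part F x) \<in> lat}" by simp
next
  fix F' assume "F' \<in> {F' \<in> orientations E. (\<lambda>x. positive_part F' x - positive_part F x) \<in> lat}"
  then have F': "F' \<in> orientations E" and d: "(\<lambda>x. positive_part F' x - positive_part F x) \<in> lat" by auto
  from F d have "(cc_move rmat)\<^sup>*\<^sup>* F F'"
  proof (induction "card {x \<in> E. positive_part F' x \<noteq> positive_part F x}" arbitrary: F rule: less_induct)
    case less
    show ?case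
    proof (cases "F = F'")
      case False
      then obtain y where y: "y \<in> E" "positive_part F' y \<noteq> positive_part F y"
        using orientation_eqI[OF less(2) F'] by metis
      let ?d = "\<lambda>x. positive_part F' x - positive_part F x"
      have "\<bar>?d x\<bar> \<le> 1" for x by (auto simp: positive_part_def)
      then obtain u where u: "u \<in> elementary V \<union> elementary W" "conformal u ?d" "u y \<noteq> 0"
        using lat_conformal[OF less(3), of y] y by auto
      note uval = elementary_union_values[OF u(1)]
      have compat: "chain_compatible (\<lambda>x. - u x) F"
        using compatible_of_difference(2)[OF F' less(2), of u] u(2) by (simp add: conformal_def)
      define F2 where "F2 = reverse_on (chain_supp (\<lambda>x. - u x)) F"
      have "- u x = -1 \<or> - u x = 0 \<or> - u x = 1" for x using uval[of x] by auto
      then have p2: "positive_part F2 = (\<lambda>x. positive_part F x + u x)"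
        using positive_part_reverse[OF less(2) compat] by (simp add: F2_def)
      have F2: "F2 \<in> orientations E" unfolding F2_def using reverse_orientation[OF less(2)] .
      have "(\<lambda>x. ?d x - u x) \<in> lat" using lat_diff[OF less(3) elementary_union_lat[OF u(1)]] .
      moreover have "(\<lambda>x. ?d x - u x) = (\<lambda>x. positive_part F' x - positive_part F2 x)" using p2 by auto
      ultimately have d2: "(\<lambda>x. positive_part F' x - positive_part F2 x) \<in> lat" by simp
      \<comment> \<open>On its support \<open>u\<close> equals the difference, not just its sign,
        since both take values in -1, 0, 1; so the move removes all disagreements there.\<close>
      have eq: "positive_part F2 x = positive_part F' x" if "u x \<noteq> 0" for x
      proof -
        have "sgn (u x) = sgn (?d x)" using u(2) that by (simp add: conformal_def)
        moreover have "?d x = -1 \<or> ?d x = 0 \<or> ?d x = 1" by (auto simp: positive_part_def)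
        ultimately have "u x = ?d x" using uval[of x] that by auto
        then show ?thesis using p2 by simp
      qed
      have "{x \<in> E. positive_part F' x \<noteq> positive_part F2 x} \<subset> {x \<in> E. positive_part F' x \<noteq> positive_part F x}"
      proof
        show "{x \<in> E. positive_part F' x \<noteq> positive_part F2 x} \<subseteq> {x \<in> E. positive_part F' x \<noteq> positive_part F x}"
        proof
          fix x assume x: "x \<in> {x \<in> E. positive_part F' x \<noteq> positive_part F2 x}"
          then have "u x = 0" using eq[of x] by auto
          then have "positive_part F2 x = positive_part F x" using p2 by simp
          then show "x \<in> {x \<in> E. positive_part F' x \<noteq> positive_part F x}" using x by simp
        qed
        show "{x \<in> E. positive_part F' x \<noteq> positive_part F2 x} \<noteq> {x \<in> E. positive_part F' x \<noteq> positive_part F x}"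
          using eq[OF u(3)] y by (metis (mono_tags, lifting) mem_Collect_eq)
      qed
      then have "card {x \<in> E. positive_part F' x \<noteq> positive_part F2 x} < card {x \<in> E. positive_part F' x \<noteq> positive_part F x}"
        using finite_E by (intro psubset_card_mono) auto
      then have "(cc_move rmat)\<^sup>*\<^sup>* F2 F'" using less(1)[OF _ F2 d2] by blast
      moreover have "cc_move rmat F F2"
        using cc_move_rmat[OF less(2)] elementary_union_uminus[OF u(1)] compat F2 p2
        by (auto intro!: bexI[of _ "\<lambda>x. - u x"])
      ultimately show ?thesis by (metis converse_rtranclp_into_rtranclp)
    qed simp
  qed
  then show "F' \<in> cc_class rmat F" using F' by (simp add: cc_class_def)
qed

text \<open>Farkas with \<open>F\<close> itself as the constraint: every element lies in a circuit
  or a cocircuit compatible with \<open>F\<close>. Reversing it flips the sign at \<open>f\<close>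
  within the class.\<close>

lemma exists_with_sign:
  assumes F: "F \<in> orientations E" and f: "f \<in> E" and s: "s = 1 \<or> s = -1"
  shows "\<exists>F'\<in>orientations E. (\<lambda>x. positive_part F' x - positive_part F x) \<in> lat \<and> F' f = {s}"
proof (cases "F f = {s}")
  case True
  then show ?thesis using F lat_zero by (intro bexI[of _ F]) auto
next
  case False
  have Ff: "F f = {- s}" using orientation_cases[OF F f] s False by (elim disjE) simp_all
  have s': "- s = 1 \<or> - s = -1" using s by auto
  have "\<exists>u\<in>elementary V \<union> elementary W. u f = - s \<and> (\<forall>x. u x \<noteq> 0 \<longrightarrow> u x \<in> F x)"
    using farkas_elementary[OF f s', of F]
  proof (elim disjE bexE conjE)
    fix u assume "u \<in> elementary V" "u f = - s" "\<forall>x. x \<noteq> f \<longrightarrow> u x \<noteq> 0 \<longrightarrow> u x \<in> F x"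
    then show ?thesis using Ff by (intro bexI[of _ u]) auto
  next
    fix u assume u: "u \<in> elementary W" "u f = - s" "\<forall>x. x \<noteq> f \<longrightarrow> u x \<noteq> 0 \<longrightarrow> - u x \<notin> F x"
    have "u x \<in> F x" if "u x \<noteq> 0" for x
    proof (cases "x = f")
      case False
      have "u \<in> W" using u(1) by (simp add: elementary_def)
      then have "x \<in> E" using that W_sub by (auto simp: chains_def chain_supp_def)
      moreover have "u x = -1 \<or> u x = 0 \<or> u x = 1" using elementary_union_values u(1) by blast
      ultimately show ?thesis using orientation_cases[OF F] u(3) that False by force
    qed (use u Ff in auto)
    then show ?thesis using u by (intro bexI[of _ u]) auto
  qed
  then obtain u where u: "u \<in> elementary V \<union> elementary W" "u f = - s" "\<forall>x. u x \<noteq> 0 \<longrightarrow> u x \<in> F x"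
    by blast
  note uval = elementary_union_values[OF u(1)]
  have "sgn (u x) = u x" for x using uval[of x] by auto
  then have compat: "chain_compatible u F" using u(3) by (simp add: chain_compatible_def chain_supp_def)
  let ?F = "reverse_on (chain_supp u) F"
  have "positive_part ?F = (\<lambda>x. positive_part F x - u x)" by (rule positive_part_reverse[OF F compat uval])
  then have "(\<lambda>x. positive_part ?F x - positive_part F x) = (\<lambda>x. - u x)" by auto
  then have "(\<lambda>x. positive_part ?F x - positive_part F x) \<in> lat"
    using lat_uminus[OF elementary_union_lat[OF u(1)]] by simp
  moreover have "?F f = {s}" using Ff u(2) s by (auto simp: reverse_on_def chain_supp_def)
  ultimately show ?thesis using reverse_orientation[OF F] by blast
qed

lemma positive_part_reverse_arc:
  assumes F: "F \<in> orientations E" and a: "a = (\<lambda>x. if x = f then s else 0)" "s = 1 \<or> s = -1"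
    and Ff: "F f = {- s}" 
  shows "positive_part (reverse_on (chain_supp a) F) = (\<lambda>x. positive_part F x + a x)"
proof -
  have supp: "chain_supp (\<lambda>x. - a x) = chain_supp a" by (simp add: chain_supp_def)
  have "chain_compatible (\<lambda>x. - a x) F"
    using Ff a by (auto simp: chain_compatible_def chain_supp_def)
  from positive_part_reverse[OF F this] show ?thesis using a(2) unfolding supp by (auto simp: a(1))
qed

lemma chain_remove_arc:
  assumes c: "c \<in> chains E" "c f \<noteq> 0" and c': "c' = (\<lambda>x. c x - (if x = f then sgn (c f) else 0))"
  shows "f \<in> E" "c' \<in> chains E" "(\<Sum>x\<in>E. nat \<bar>c' x\<bar>) < (\<Sum>x\<in>E. nat \<bar>c x\<bar>)"
proof -
  show f: "f \<in> E" using c by (auto simp: chains_def chain_supp_def)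
  show "c' \<in> chains E" using c f by (auto simp: c' chains_def chain_supp_def split: if_splits)
  show "(\<Sum>x\<in>E. nat \<bar>c' x\<bar>) < (\<Sum>x\<in>E. nat \<bar>c x\<bar>)"
  proof (rule sum_strict_mono_ex1[OF finite_E])
    show "\<forall>x\<in>E. nat \<bar>c' x\<bar> \<le> nat \<bar>c x\<bar>" by (auto simp: c' sgn_if)
    show "\<exists>a\<in>E. nat \<bar>c' a\<bar> < nat \<bar>c a\<bar>" using f c(2) by (intro bexI[of _ f]) (auto simp: c' sgn_if)
  qed
qed

text \<open>Arcs are added one at a time. Before each arc the class representative is changed so
  that its sign at \<open>f\<close> is opposite to the arc, and reversing \<open>f\<close> then adds
  the arc to the positive part.\<close>

lemma exists_translate:
  assumes "F \<in> orientations E" "c \<in> chains E"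
  shows "\<exists>F'\<in>orientations E. (\<lambda>x. positive_part F' x - positive_part F x - c x) \<in> lat"
  using assms(2)
proof (induction "\<Sum>x\<in>E. nat \<bar>c x\<bar>" arbitrary: c rule: less_induct)
  case less
  show ?case
  proof (cases "c = (\<lambda>_. 0)")
    case True
    then show ?thesis using assms(1) lat_zero by (intro bexI[of _ F]) auto
  next
    case False
    then obtain f where f: "c f \<noteq> 0" by auto
    define s where "s = sgn (c f)"
    have s: "s = 1 \<or> s = -1" using f by (auto simp: s_def sgn_if)
    define a where "a = (\<lambda>x. if x = f then s else 0)"
    define c' where "c' = (\<lambda>x. c x - a x)"
    have c'eq: "c' = (\<lambda>x. c x - (if x = f then sgn (c f) else 0))" unfolding c'_def a_def s_def ..
    note rem = chain_remove_arc[OF less(2) f c'eq]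
    obtain F1 where F1: "F1 \<in> orientations E" "(\<lambda>x. positive_part F1 x - positive_part F x - c' x) \<in> lat"
      using less(1)[OF rem(3,2)] by blast
    have s': "- s = 1 \<or> - s = -1" using s by auto
    obtain F2 where F2: "F2 \<in> orientations E" "(\<lambda>x. positive_part F2 x - positive_part F1 x) \<in> lat" "F2 f = {- s}"
      using exists_with_sign[OF F1(1) rem(1) s'] by blast
    let ?F3 = "reverse_on (chain_supp a) F2"
    have p3: "positive_part ?F3 = (\<lambda>x. positive_part F2 x + a x)"
      using positive_part_reverse_arc[OF F2(1) a_def s F2(3)] .
    have "(\<lambda>x. (positive_part F2 x - positive_part F1 x) + (positive_part F1 x - positive_part F x - c' x)) \<in> lat"
      using lat_add[OF F2(2) F1(2)] .
    moreover have "(\<lambda>x. (positive_part F2 x - positive_part F1 x) + (positive_part F1 x - positive_part F x - c' x))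
       = (\<lambda>x. positive_part ?F3 x - positive_part F x - c x)" using p3 by (auto simp: c'_def)
    ultimately show ?thesis using reverse_orientation[OF F2(1)] by force
  qed
qed

end

section \<open>The canonical action\<close>

context regular_pair begin

text \<open>The lattice form of the value that the class of \<open>c\<close> should take on the
  class of \<open>F\<close>. It is nonempty by \<open>exists_translate\<close>, hence an equivalence
  class.\<close>

definition translate_class :: "'e fourientation \<Rightarrow> 'e chain \<Rightarrow> 'e fourientation set" where
  "translate_class F c = {F' \<in> orientations E. (\<lambda>x. positive_part F' x - positive_part F x - c x) \<in> lat}"

lemma translate_class_zero:
  "F \<in> orientations E \<Longrightarrow> translate_class F (\<lambda>_. 0) = cc_class rmat F"
  by (simp add: translate_class_def cc_class_rmat)

lemma translate_class_cong:
  assumes "(\<lambda>x. positive_part F' x + c' x - (positive_part F x + c x)) \<in> lat"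
  shows "translate_class F' c' = translate_class F c"
proof -
  have "(\<lambda>x. positive_part G x - positive_part F' x - c' x) \<in> lat \<longleftrightarrow>
      (\<lambda>x. positive_part G x - positive_part F x - c x) \<in> lat" for G
  proof -
    have "(\<lambda>x. (positive_part G x - positive_part F' x - c' x) +
        (positive_part F' x + c' x - (positive_part F x + c x))) =
        (\<lambda>x. positive_part G x - positive_part F x - c x)" by auto
    moreover have "(\<lambda>x. (positive_part G x - positive_part F x - c x) -
        (positive_part F' x + c' x - (positive_part F x + c x))) =
        (\<lambda>x. positive_part G x - positive_part F' x - c' x)" by auto
    ultimately show ?thesis
      using lat_add[OF _ assms, of "\<lambda>x. positive_part G x - positive_part F' x - c' x"]
        lat_diff[OF _ assms, of "\<lambda>x. positive_part G x - positive_part F x - c x"] by auto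
  qed
  then show ?thesis by (simp add: translate_class_def)
qed

lemma translate_class_cc_class:
  assumes F: "F \<in> orientations E" and G: "G \<in> translate_class F c"
  shows "translate_class F c = cc_class rmat G"
proof -
  have "G \<in> orientations E" "(\<lambda>x. positive_part G x - positive_part F x - c x) \<in> lat"
    using G by (auto simp: translate_class_def)
  then have "(\<lambda>x. positive_part G x + 0 - (positive_part F x + c x)) \<in> lat"
    by (simp add: algebra_simps)
  then have "translate_class G (\<lambda>_. 0) = translate_class F c" by (rule translate_class_cong)
  then show ?thesis using translate_class_zero \<open>G \<in> orientations E\<close> by simp
qed

lemma translate_class_in_classes:
  assumes F: "F \<in> orientations E" and c: "c \<in> chains E"
  shows "translate_class F c \<in> cc_classes rmat"
proof -
  obtain G where G: "G \<in> translate_class F c"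
    using exists_translate[OF F c] by (auto simp: translate_class_def)
  then have "G \<in> orientations E" by (simp add: translate_class_def)
  then show ?thesis using translate_class_cc_class[OF F G] by (simp add: cc_classes_def)
qed

lemma cc_class_self: "F \<in> orientations E \<Longrightarrow> F \<in> cc_class rmat F"
  using lat_zero by (simp add: cc_class_rmat)

lemma cc_class_member:
  assumes F: "F \<in> orientations E" and G: "G \<in> cc_class rmat F"
  shows "G \<in> orientations E" "cc_class rmat G = cc_class rmat F"
proof -
  show "G \<in> orientations E" using G by (simp add: cc_class_rmat[OF F])
  show "cc_class rmat G = cc_class rmat F"
    using translate_class_cc_class[OF F, of G "\<lambda>_. 0"] translate_class_zero[OF F] G by simp
qed

lemma normal_lat: "lat \<lhd> chain_group E"
  using comm_group.subgroup_imp_normal[OF comm_group_chain_group subgroup_lat] .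

lemma sandpile_group_rmat: "sandpile_group rmat = chain_group E Mod lat"
  by (simp add: sandpile_group_def cc_lattice_rmat)

lemma carrier_sandpile: "carrier (sandpile_group rmat) = sandpile_class rmat ` chains E"
  by (simp add: sandpile_group_rmat carrier_FactGroup sandpile_class_def cc_lattice_rmat chain_group_simps)

lemma sandpile_class_mult:
  assumes "p \<in> chains E" "q \<in> chains E"
  shows "sandpile_class rmat p \<otimes>\<^bsub>sandpile_group rmat\<^esub> sandpile_class rmat q
    = sandpile_class rmat (\<lambda>x. p x + q x)"
proof -
  interpret normal lat "chain_group E" by (rule normal_lat)
  show ?thesis using rcos_sum[of p q] assms
    by (simp add: sandpile_group_rmat sandpile_class_def cc_lattice_rmat chain_group_simps)
qed

lemma group_sandpile: "group (sandpile_group rmat)"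
  unfolding sandpile_group_rmat using normal.factorgroup_is_group[OF normal_lat] .

text \<open>An explicit candidate for the canonical action: \<open>s\<close> is a coset, and two
  classes are related by \<open>s\<close> when representatives differ by a chain in
  \<open>s\<close>. Both restrictions make it extensional.\<close>

definition torsor_action :: "'e chain set \<Rightarrow> 'e fourientation set \<Rightarrow> 'e fourientation set" where
  "torsor_action = (\<lambda>s\<in>carrier (sandpile_group rmat). \<lambda>G\<in>cc_classes rmat.
     {F' \<in> orientations E. \<exists>F\<in>G. (\<lambda>x. positive_part F' x - positive_part F x) \<in> s})"

lemma torsor_action_value:
  assumes F: "F \<in> orientations E" and c: "c \<in> chains E"
  shows "torsor_action (sandpile_class rmat c) (cc_class rmat F) = translate_class F c"
proof -
  have "(\<exists>G\<in>cc_class rmat F. (\<lambda>x. positive_part F' x - positive_part G x) \<in> sandpile_class rmat c) \<longleftrightarrow>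
      (\<lambda>x. positive_part F' x - positive_part F x - c x) \<in> lat" (is "?L \<longleftrightarrow> ?R") for F'
  proof
    assume ?L
    then obtain G where G: "G \<in> orientations E" "(\<lambda>x. positive_part G x - positive_part F x) \<in> lat"
      "(\<lambda>x. positive_part F' x - positive_part G x - c x) \<in> lat"
      by (auto simp: cc_class_rmat[OF F] mem_sandpile_class)
    have "(\<lambda>x. (positive_part F' x - positive_part G x - c x) + (positive_part G x - positive_part F x))
       = (\<lambda>x. positive_part F' x - positive_part F x - c x)" by auto
    then show ?R using lat_add[OF G(3,2)] by simp
  next
    assume ?R
    then show ?L using cc_class_self[OF F] by (auto simp: mem_sandpile_class)
  qed
  moreover have "sandpile_class rmat c \<in> carrier (sandpile_group rmat)" using c by (simp add: carrier_sandpile)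
  moreover have "cc_class rmat F \<in> cc_classes rmat" using F by (simp add: cc_classes_def)
  ultimately show ?thesis by (simp add: torsor_action_def translate_class_def)
qed

lemma torsor_action_compose:
  assumes F: "F \<in> orientations E" and c: "c \<in> chains E" "c' \<in> chains E"
  shows "torsor_action (sandpile_class rmat c') (translate_class F c) = translate_class F (\<lambda>x. c x + c' x)"
proof -
  obtain G where G: "G \<in> translate_class F c"
    using exists_translate[OF F c(1)] by (auto simp: translate_class_def)
  then have GO: "G \<in> orientations E" and d: "(\<lambda>x. positive_part G x - positive_part F x - c x) \<in> lat"
    by (auto simp: translate_class_def)
  have "(\<lambda>x. positive_part G x + c' x - (positive_part F x + (c x + c' x))) \<in> lat"
    using d by (simp add: algebra_simps)
  then show ?thesis
    using translate_class_cc_class[OF F G] torsor_action_value[OF GO c(2)] translate_class_cong by simp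
qed

lemma cc_classes_rmat: "G \<in> cc_classes rmat \<longleftrightarrow> (\<exists>F\<in>orientations E. G = cc_class rmat F)"
  by (auto simp: cc_classes_def)

lemma is_arc_form:
  assumes "is_arc E a"
  obtains f s where "f \<in> E" "s = 1 \<or> s = -1" "a = (\<lambda>x. if x = f then s else 0)"
proof -
  obtain f where f: "chain_supp a = {f}" using assms by (auto simp: is_arc_def)
  have "a f \<in> {-1, 0, 1}" using assms by (auto simp: is_arc_def simple_chain_def)
  moreover have "a f \<noteq> 0" using f by (auto simp: chain_supp_def)
  ultimately have "a f = 1 \<or> a f = -1" by auto
  moreover have "a = (\<lambda>x. if x = f then a f else 0)" using f by (auto simp: chain_supp_def fun_eq_iff)
  moreover have "f \<in> E" using assms f by (auto simp: is_arc_def simple_chain_def chains_def)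
  ultimately show thesis using that by blast
qed

lemma reverse_arc_translate:
  assumes F: "F \<in> orientations E" and a: "is_arc E a" and c: "chain_compatible (\<lambda>x. - a x) F"
  shows "reverse_on (chain_supp a) F \<in> translate_class F a"
proof -
  obtain f s where fs: "f \<in> E" "s = 1 \<or> s = -1" "a = (\<lambda>x. if x = f then s else 0)"
    using is_arc_form[OF a] .
  have "f \<in> chain_supp (\<lambda>x. - a x)" using fs(2,3) by (auto simp: chain_supp_def)
  then have "sgn (- a f) \<in> F f" using c unfolding chain_compatible_def by blast
  moreover have "sgn (- a f) = - s" using fs(2,3) by auto
  ultimately have "F f = {- s}" using orientation_cases[OF F fs(1)] by auto
  then have "positive_part (reverse_on (chain_supp a) F) = (\<lambda>x. positive_part F x + a x)"
    using positive_part_reverse_arc[OF F fs(3,2)] by simp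
  then show ?thesis
    using reverse_orientation[OF F] lat_zero by (simp add: translate_class_def)
qed

lemma is_canonical_torsor_action: "is_canonical_action rmat torsor_action"
  unfolding is_canonical_action_def
proof (intro conjI allI impI)
  have closed: "torsor_action s \<in> cc_classes rmat \<rightarrow> cc_classes rmat" if "s \<in> carrier (sandpile_group rmat)" for s
    using that torsor_action_value translate_class_in_classes by (auto simp: carrier_sandpile cc_classes_rmat)
  have inverse: "torsor_action (sandpile_class rmat c') (torsor_action (sandpile_class rmat c) G) = G"
    if "c \<in> chains E" "c' \<in> chains E" "G \<in> cc_classes rmat" "\<And>x. c x + c' x = 0" for c c' G
    using that torsor_action_value torsor_action_compose translate_class_zero by (auto simp: cc_classes_rmat)
  have bij: "torsor_action s \<in> Bij (cc_classes rmat)" if s: "s \<in> carrier (sandpile_group rmat)" for s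
  proof -
    obtain c where c: "c \<in> chains E" "s = sandpile_class rmat c" using s by (auto simp: carrier_sandpile)
    let ?s = "sandpile_class rmat (\<lambda>x. - c x)"
    have c': "(\<lambda>x. - c x) \<in> chains E" using c by (simp add: chains_iff)
    then have s': "?s \<in> carrier (sandpile_group rmat)" by (simp add: carrier_sandpile)
    have "bij_betw (torsor_action s) (cc_classes rmat) (cc_classes rmat)"
    proof (rule bij_betwI[where g = "torsor_action ?s"])
      show "torsor_action s \<in> cc_classes rmat \<rightarrow> cc_classes rmat" using closed[OF s] .
      show "torsor_action ?s \<in> cc_classes rmat \<rightarrow> cc_classes rmat" using closed[OF s'] .
      show "torsor_action ?s (torsor_action s G) = G" if "G \<in> cc_classes rmat" for G
        using inverse[OF c(1) c' that] c(2) by simp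
      show "torsor_action s (torsor_action ?s G) = G" if "G \<in> cc_classes rmat" for G
        using inverse[OF c' c(1) that] c(2) by simp
    qed
    moreover have "torsor_action s \<in> extensional (cc_classes rmat)" using s by (simp add: torsor_action_def)
    ultimately show ?thesis by (simp add: Bij_def)
  qed
  have "torsor_action (s \<otimes>\<^bsub>sandpile_group rmat\<^esub> t) = compose (cc_classes rmat) (torsor_action s) (torsor_action t)"
    if st: "s \<in> carrier (sandpile_group rmat)" "t \<in> carrier (sandpile_group rmat)" for s t
  proof
    fix G
    obtain c c' where c: "c \<in> chains E" "s = sandpile_class rmat c" "c' \<in> chains E" "t = sandpile_class rmat c'"
      using st by (auto simp: carrier_sandpile)
    have sum: "(\<lambda>x. c x + c' x) \<in> chains E" using c by (simp add: chains_iff)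
    have st': "s \<otimes>\<^bsub>sandpile_group rmat\<^esub> t = sandpile_class rmat (\<lambda>x. c x + c' x)"
      using c sandpile_class_mult by simp
    show "torsor_action (s \<otimes>\<^bsub>sandpile_group rmat\<^esub> t) G =
        compose (cc_classes rmat) (torsor_action s) (torsor_action t) G"
    proof (cases "G \<in> cc_classes rmat")
      case True
      then obtain F where F: "F \<in> orientations E" "G = cc_class rmat F" by (auto simp: cc_classes_rmat)
      have "compose (cc_classes rmat) (torsor_action s) (torsor_action t) G = translate_class F (\<lambda>x. c' x + c x)"
        using True F c torsor_action_value torsor_action_compose by (simp add: compose_def)
      then show ?thesis unfolding st' using F torsor_action_value[OF F(1) sum] by (simp add: add.commute)
    next
      case False
      have "sandpile_class rmat (\<lambda>x. c x + c' x) \<in> carrier (sandpile_group rmat)"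
        using sum by (simp add: carrier_sandpile)
      then show ?thesis unfolding st' using False by (simp add: torsor_action_def compose_def)
    qed
  qed
  then have "torsor_action \<in> hom (sandpile_group rmat) (BijGroup (cc_classes rmat))"
    using bij by (auto simp: hom_def BijGroup_def)
  then show "group_action (sandpile_group rmat) (cc_classes rmat) torsor_action"
    using group_sandpile group_BijGroup
    by (simp add: group_action_def group_hom_def group_hom_axioms_def)
  show "torsor_action \<in> extensional (carrier (sandpile_group rmat))" by (simp add: torsor_action_def)
  fix a G F
  assume "is_arc (ground rmat) a \<and> G \<in> cc_classes rmat \<and> F \<in> G \<and> chain_compatible (\<lambda>x. - a x) F"
  then have a: "is_arc E a" "G \<in> cc_classes rmat" "F \<in> G" "chain_compatible (\<lambda>x. - a x) F" by auto
  then obtain F0 where F0: "F0 \<in> orientations E" "G = cc_class rmat F0" by (auto simp: cc_classes_rmat)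
  then have F: "F \<in> orientations E" "G = cc_class rmat F" using cc_class_member[OF F0(1)] a(3) by auto
  have aE: "a \<in> chains E" using a(1) by (simp add: is_arc_def simple_chain_def)
  show "torsor_action (sandpile_class rmat a) G = cc_class rmat (reverse_on (chain_supp a) F)"
    using torsor_action_value[OF F(1) aE] translate_class_cc_class[OF F(1) reverse_arc_translate[OF F(1) a(1,4)]]
      F(2) by simp
qed

text \<open>The rule for arcs and the homomorphism property determine all values, because every
  chain is a sum of arcs.\<close>

lemma canonical_action_unique_value:
  assumes can: "is_canonical_action rmat \<phi>" and F: "F \<in> orientations E" and c: "c \<in> chains E"
  shows "\<phi> (sandpile_class rmat c) (cc_class rmat F) = translate_class F c"
proof -
  interpret group_action "sandpile_group rmat" "cc_classes rmat" \<phi>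
    using can by (simp add: is_canonical_action_def)
  interpret hom: group_hom "sandpile_group rmat" "BijGroup (cc_classes rmat)" \<phi> by (rule group_hom)
  show ?thesis using c
  proof (induction "\<Sum>x\<in>E. nat \<bar>c x\<bar>" arbitrary: c rule: less_induct)
    case less
    show ?case
    proof (cases "c = (\<lambda>_. 0)")
      case True
      have "sandpile_class rmat (\<lambda>_. 0) = lat" by (auto simp: mem_sandpile_class)
      then have "sandpile_class rmat c = \<one>\<^bsub>sandpile_group rmat\<^esub>" using True by (simp add: sandpile_group_rmat)
      moreover have "cc_class rmat F \<in> cc_classes rmat" using F by (simp add: cc_classes_def)
      moreover have "\<phi> \<one>\<^bsub>sandpile_group rmat\<^esub> = (\<lambda>x\<in>cc_classes rmat. x)" using id_eq_one by simp
      ultimately show ?thesis using True translate_class_zero[OF F] by simp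
    next
      case False
      then obtain f where f: "c f \<noteq> 0" by auto
      define s where "s = sgn (c f)"
      have s: "s = 1 \<or> s = -1" using f by (auto simp: s_def sgn_if)
      define a where "a = (\<lambda>x. if x = f then s else 0)"
      define c' where "c' = (\<lambda>x. c x - a x)"
      have c'eq: "c' = (\<lambda>x. c x - (if x = f then sgn (c f) else 0))" unfolding c'_def a_def s_def ..
      note rem = chain_remove_arc[OF less(2) f c'eq]
      have arc: "is_arc E a"
      proof -
        have "chain_supp a = {f}" using s by (auto simp: a_def chain_supp_def)
        moreover have "\<forall>x. a x \<in> {-1, 0, 1}" using s by (auto simp: a_def)
        ultimately show ?thesis using rem(1) by (simp add: is_arc_def simple_chain_def chains_def)
      qed
      then have aE: "a \<in> chains E" by (simp add: is_arc_def simple_chain_def)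
      have cls: "cc_class rmat F \<in> cc_classes rmat" using F by (simp add: cc_classes_def)
      have "sandpile_class rmat c = sandpile_class rmat a \<otimes>\<^bsub>sandpile_group rmat\<^esub> sandpile_class rmat c'"
        using sandpile_class_mult[OF aE rem(2)] by (simp add: c'_def)
      moreover have car: "sandpile_class rmat a \<in> carrier (sandpile_group rmat)"
        "sandpile_class rmat c' \<in> carrier (sandpile_group rmat)"
        using aE rem(2) by (auto simp: carrier_sandpile)
      ultimately have "\<phi> (sandpile_class rmat c) = \<phi> (sandpile_class rmat a) \<otimes>\<^bsub>BijGroup (cc_classes rmat)\<^esub> \<phi> (sandpile_class rmat c')"
        by simp
      then have "\<phi> (sandpile_class rmat c) (cc_class rmat F)
          = \<phi> (sandpile_class rmat a) (\<phi> (sandpile_class rmat c') (cc_class rmat F))"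
        using bij_prop0[OF car(1)] bij_prop0[OF car(2)] cls by (simp add: BijGroup_def compose_def)
      also have "\<phi> (sandpile_class rmat c') (cc_class rmat F) = translate_class F c'"
        using less(1)[OF rem(3,2)] .
      also obtain F1 where F1: "F1 \<in> translate_class F c'"
        using exists_translate[OF F rem(2)] by (auto simp: translate_class_def)
      then have F1O: "F1 \<in> orientations E" by (simp add: translate_class_def)
      \<comment> \<open>The rule for arcs requires a representative compatible with the negative of
        \<open>a\<close>.\<close>
      have "- s = 1 \<or> - s = -1" using s by auto
      then obtain F2 where F2: "F2 \<in> orientations E" "(\<lambda>x. positive_part F2 x - positive_part F1 x) \<in> lat" "F2 f = {- s}"
        using exists_with_sign[OF F1O rem(1)] by blast
      have "F2 \<in> cc_class rmat F1" using F2 by (simp add: cc_class_rmat[OF F1O])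
      then have eq: "translate_class F c' = cc_class rmat F2" "F2 \<in> translate_class F c'"
        using translate_class_cc_class[OF F F1] cc_class_member(2)[OF F1O] by auto
      have compat: "chain_compatible (\<lambda>x. - a x) F2"
        using F2(3) s by (auto simp: chain_compatible_def chain_supp_def a_def)
      have "cc_class rmat F2 \<in> cc_classes rmat" using F2 by (simp add: cc_classes_def)
      then have "\<phi> (sandpile_class rmat a) (cc_class rmat F2) = cc_class rmat (reverse_on (chain_supp a) F2)"
        using can arc compat cc_class_self[OF F2(1)] unfolding is_canonical_action_def by auto
      then have "\<phi> (sandpile_class rmat a) (translate_class F c') = translate_class F2 a"
        using eq(1) translate_class_cc_class[OF F2(1) reverse_arc_translate[OF F2(1) arc compat]] by simp
      also have "\<dots> = translate_class F c"
      proof (rule translate_class_cong)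
        have "(\<lambda>x. positive_part F2 x - positive_part F x - c' x) \<in> lat"
          using eq(2) by (simp add: translate_class_def)
        then show "(\<lambda>x. positive_part F2 x + a x - (positive_part F x + c x)) \<in> lat"
          by (simp add: c'_def algebra_simps)
      qed
      finally show ?thesis .
    qed
  qed
qed

text \<open>Existence is \<open>torsor_action\<close>, and extensionality in both arguments turns
  uniqueness of values into equality of actions. The description operator is thereby evaluated once
  and for all.\<close>

lemma canonical_action_value:
  assumes F: "F \<in> orientations E" and c: "c \<in> chains E"
  shows "canonical_action rmat (sandpile_class rmat c) (cc_class rmat F) = translate_class F c"
proof -
  have "is_canonical_action rmat (canonical_action rmat)"
    unfolding canonical_action_def
  proof (rule theI[of "is_canonical_action rmat", OF is_canonical_torsor_action])
    fix \<phi> assume can: "is_canonical_action rmat \<phi>"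
    interpret group_action "sandpile_group rmat" "cc_classes rmat" \<phi>
      using can by (simp add: is_canonical_action_def)
    show "\<phi> = torsor_action"
    proof (rule extensionalityI[of _ "carrier (sandpile_group rmat)"])
      show "\<phi> \<in> extensional (carrier (sandpile_group rmat))" using can by (simp add: is_canonical_action_def)
      show "torsor_action \<in> extensional (carrier (sandpile_group rmat))" by (simp add: torsor_action_def)
      fix s assume s: "s \<in> carrier (sandpile_group rmat)"
      show "\<phi> s = torsor_action s"
      proof (rule extensionalityI[of _ "cc_classes rmat"])
        show "\<phi> s \<in> extensional (cc_classes rmat)" using bij_prop0[OF s] by (simp add: Bij_def)
        show "torsor_action s \<in> extensional (cc_classes rmat)" using s by (simp add: torsor_action_def)
        fix G assume "G \<in> cc_classes rmat"
        then show "\<phi> s G = torsor_action s G"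
          using s canonical_action_unique_value[OF can] torsor_action_value
          by (auto simp: carrier_sandpile cc_classes_rmat)
      qed
    qed
  qed
  then show ?thesis using canonical_action_unique_value[OF _ F c] by blast
qed

text \<open>An elementary chain conformal to the difference is compatible with one orientation and
  its negative with the other, so a signature would contain both.\<close>

lemma compatible_unique:
  assumes no_opposite: "\<And>u. u \<in> \<sigma> \<Longrightarrow> (\<lambda>x. - u x) \<notin> \<sigma>" "\<And>u. u \<in> \<sigma>' \<Longrightarrow> (\<lambda>x. - u x) \<notin> \<sigma>'"
    and F: "compatible_orientation rmat \<sigma> \<sigma>' F" and F': "compatible_orientation rmat \<sigma> \<sigma>' F'"
    and d: "(\<lambda>x. positive_part F' x - positive_part F x) \<in> lat"
  shows "F = F'"
proof (rule ccontr)
  assume "F \<noteq> F'"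
  have FO: "F \<in> orientations E" "F' \<in> orientations E"
    using F F' by (auto simp: compatible_orientation_def)
  then obtain y where y: "y \<in> E" "positive_part F' y \<noteq> positive_part F y"
    using orientation_eqI[OF FO] \<open>F \<noteq> F'\<close> by metis
  let ?d = "\<lambda>x. positive_part F' x - positive_part F x"
  have "\<bar>?d x\<bar> \<le> 1" for x by (auto simp: positive_part_def)
  then obtain u where u: "u \<in> elementary V \<union> elementary W" "conformal u ?d"
    using lat_conformal[OF d, of y] y by auto
  have compat: "chain_compatible u F'" "chain_compatible (\<lambda>x. - u x) F"
    using compatible_of_difference[OF FO(2,1), of u] u(2) by (auto simp: conformal_def)
  from u(1) show False
  proof
    assume uV: "u \<in> elementary V"
    then have "u \<in> \<sigma>" "(\<lambda>x. - u x) \<in> \<sigma>"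
      using F F' compat elementary_uminus[OF uV] by (auto simp: compatible_orientation_def)
    then show False using no_opposite by blast
  next
    assume uW: "u \<in> elementary W"
    then have "u \<in> \<sigma>'" "(\<lambda>x. - u x) \<in> \<sigma>'"
      using F F' compat regular_pair.elementary_uminus[OF dual uW] by (auto simp: compatible_orientation_def)
    then show False using no_opposite by blast
  qed
qed

text \<open>The compatible representative is supplied as a premise, so that the lemma applies in
  minors, where only the restricted BBY orientation is known to be one.\<close>

lemma sandpile_act_iff:
  assumes no_opposite: "\<And>u. u \<in> \<sigma> \<Longrightarrow> (\<lambda>x. - u x) \<notin> \<sigma>" "\<And>u. u \<in> \<sigma>' \<Longrightarrow> (\<lambda>x. - u x) \<notin> \<sigma>'"
    and F: "F \<in> orientations E" and c: "c \<in> chains E"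
    and F': "compatible_orientation rmat \<sigma> \<sigma>' F'" "F' \<in> translate_class F c"
  shows "sandpile_act rmat \<sigma> \<sigma>' (sandpile_class rmat c) F = F'"
  unfolding sandpile_act_def canonical_action_value[OF F c] compatible_rep_def
proof (rule the_equality)
  show "F' \<in> translate_class F c \<and> compatible_orientation rmat \<sigma> \<sigma>' F'" using F' by simp
  fix G assume G: "G \<in> translate_class F c \<and> compatible_orientation rmat \<sigma> \<sigma>' G"
  have "(\<lambda>x. positive_part G x - positive_part F x - c x) \<in> lat"
    "(\<lambda>x. positive_part F' x - positive_part F x - c x) \<in> lat"
    using G F'(2) by (auto simp: translate_class_def)
  from lat_diff[OF this]
  have "(\<lambda>x. (positive_part G x - positive_part F x - c x) - (positive_part F' x - positive_part F x - c x)) \<in> lat" .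
  then have "(\<lambda>x. positive_part G x - positive_part F' x) \<in> lat" by simp
  then show "G = F'" using compatible_unique[OF no_opposite F'(1)] G by metis
qed

end

section \<open>Signatures and the BBY map\<close>

definition dual_matroid :: "'e signed_matroid \<Rightarrow> 'e signed_matroid" where
  "dual_matroid M = \<lparr>ground = ground M, bases = (\<lambda>B. ground M - B) ` bases M,
     signed_circuits = signed_cocircuits M, signed_cocircuits = signed_circuits M\<rparr>"

lemma dual_matroid_simps [simp]:
  "ground (dual_matroid M) = ground M" "bases (dual_matroid M) = (\<lambda>B. ground M - B) ` bases M"
  "signed_circuits (dual_matroid M) = signed_cocircuits M"
  "signed_cocircuits (dual_matroid M) = signed_circuits M"
  by (auto simp: dual_matroid_def)

text \<open>A signature as a choice between \<open>u\<close> and \<open>- u\<close>, phrased by the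
  lattice alone so that it can be transported to minors.\<close>

definition signature_on :: "'e chain set \<Rightarrow> 'e chain set \<Rightarrow> bool" where
  "signature_on V \<sigma> \<longleftrightarrow> \<sigma> \<subseteq> elementary V \<and> (\<forall>u\<in>elementary V. (u \<in> \<sigma>) \<noteq> ((\<lambda>x. - u x) \<in> \<sigma>))"

lemma chain_supp_uminus: "chain_supp (\<lambda>x. - u x) = chain_supp u"
  by (simp add: chain_supp_def)

lemma signature_onD:
  assumes "signature_on V \<sigma>" "u \<in> \<sigma>"
  shows "u \<in> elementary V" "(\<lambda>x. - u x) \<notin> \<sigma>"
  using assms by (auto simp: signature_on_def)

text \<open>Passing from positive parts to signs doubles differences; this is the factor 2 in
  \<open>core\<close>.\<close>

definition orientation_sign :: "'e fourientation \<Rightarrow> 'e \<Rightarrow> int" where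
  "orientation_sign F x = 2 * positive_part F x - 1"

lemma orientation_sign_values: "orientation_sign F x = 1 \<or> orientation_sign F x = -1"
  by (auto simp: orientation_sign_def positive_part_def)

lemma orientation_eq_sign:
  assumes "F \<in> orientations E" "x \<in> E"
  shows "F x = {orientation_sign F x}"
  using orientation_cases[OF assms] by (elim disjE) (simp_all add: orientation_sign_def positive_part_def)

section \<open>Fundamental circuits, signatures and the BBY map of a regular pair\<close>

context regular_pair begin

lemma dual_rmat: "dual_matroid rmat = matroid_of_pair E ((\<lambda>B. E - B) ` BB) W V"
  by (simp add: dual_matroid_def matroid_of_pair_def)

lemma dual_bases_involution: "(\<lambda>B. E - B) ` (\<lambda>B. E - B) ` BB = BB"
proof -
  have "E - (E - B) = B" if "B \<in> BB" for B using bases_sub[OF that] by blast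
  then show ?thesis by (simp add: image_image)
qed

lemma circuits_rmat: "circuits rmat = chain_supp ` elementary V"
  by (simp add: circuits_def circuits_of_eq)

lemma cocircuits_of_bases: "cocircuits_of E BB = circuits_of E ((\<lambda>B. E - B) ` BB)"
  by (rule cocircuits_of_dual[OF bases_sub])

text \<open>All elements of \<open>V\<close> supported in \<open>insert x B\<close> are multiples of
  the fundamental circuit, since subtracting a multiple leaves a chain supported in the
  basis.\<close>

lemma elementary_of_fundamental:
  assumes B: "B \<in> BB" and x: "x \<notin> B" and v: "v \<in> V" "v x = 1 \<or> v x = -1"
    and supp: "chain_supp v \<subseteq> insert x B"
  shows "v \<in> elementary V"
proof -
  have xE: "x \<in> E - B" using V_supp[OF v(1), of x] v(2) x by auto
  obtain c where c: "c \<in> V" "c x = 1" "\<forall>y. c y \<in> {-1, 0, 1}" "\<forall>y. c y \<noteq> 0 \<longrightarrow> y \<in> insert x B"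
    using fund[OF B xE] by auto
  have multiple: "q = (\<lambda>y. q x * c y)" if q: "q \<in> V" "chain_supp q \<subseteq> insert x B" for q
  proof -
    have "(\<lambda>y. q y - q x * c y) = (\<lambda>_. 0)"
    proof (rule basis_independent[OF B V_diff[OF q(1) V_scale[OF c(1)]]])
      fix y assume ne: "q y - q x * c y \<noteq> 0"
      then have "y \<noteq> x" using c by auto
      moreover have "q y \<noteq> 0 \<or> c y \<noteq> 0" using ne by auto
      ultimately show "y \<in> B" using q c by (auto simp: chain_supp_def)
    qed
    then have "q y - q x * c y = 0" for y by (rule fun_cong)
    then show ?thesis by (intro ext) (rule eq_iff_diff_eq_0[THEN iffD2])
  qed
  have vc: "v = (\<lambda>y. v x * c y)" using multiple[OF v(1) supp] .
  have supp_v: "chain_supp v = chain_supp c"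
    using v(2) by (subst vc) (auto simp: chain_supp_def)
  have "v y \<in> {-1, 0, 1}" for y
  proof -
    have "v y = v x * c y" using vc by (rule fun_cong)
    moreover have "c y \<in> {-1, 0, 1}" using c by blast
    ultimately show ?thesis using v(2) by auto
  qed
  moreover have "chain_supp q = chain_supp v" if q: "q \<in> V" "q \<noteq> (\<lambda>_. 0)" "chain_supp q \<subseteq> chain_supp v" for q
  proof -
    have qc: "q = (\<lambda>y. q x * c y)" using multiple[OF q(1)] q(3) supp by blast
    then have "q x \<noteq> 0" using q(2) by auto
    then have "chain_supp q = chain_supp c" by (subst qc) (auto simp: chain_supp_def)
    then show ?thesis using supp_v by simp
  qed
  moreover have "v \<noteq> (\<lambda>_. 0)" using v(2) by auto
  ultimately show ?thesis using v(1) by (auto simp: elementary_def)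
qed

lemma fundamental_elementary:
  assumes B: "B \<in> BB" and x: "x \<in> E - B"
  obtains c where "c \<in> elementary V" "c x = 1" "chain_supp c \<subseteq> insert x B"
proof -
  obtain c where c: "c \<in> V" "c x = 1" "\<forall>y. c y \<noteq> 0 \<longrightarrow> y \<in> insert x B" using fund[OF B x] by auto
  have "chain_supp c \<subseteq> insert x B" using c by (auto simp: chain_supp_def)
  moreover have "c \<in> elementary V" using elementary_of_fundamental[OF B _ c(1)] c(2) x calculation by auto
  ultimately show thesis using that c by blast
qed

lemma fundamental_unique:
  assumes B: "B \<in> BB" "x \<notin> B" and u: "u \<in> elementary V" "chain_supp u \<subseteq> insert x B"
    and v: "v \<in> elementary V" "chain_supp v \<subseteq> insert x B"
  shows "v = u \<or> v = (\<lambda>y. - u y)"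
proof -
  have nz: "q x \<noteq> 0" if q: "q \<in> elementary V" "chain_supp q \<subseteq> insert x B" for q
  proof
    assume "q x = 0"
    then have "q = (\<lambda>_. 0)"
      using q(2) by (intro basis_independent[OF B(1) elementary_in[OF q(1)]]) (auto simp: chain_supp_def)
    then show False using q(1) by (simp add: elementary_def)
  qed
  define k where "k = v x * u x"
  have k: "k = 1 \<or> k = -1" "k * u x = v x"
    using nz[OF u] nz[OF v] elementary_values[OF u(1), of x] elementary_values[OF v(1), of x]
    by (auto simp: k_def)
  have "(\<lambda>y. v y - k * u y) = (\<lambda>_. 0)"
  proof (rule basis_independent[OF B(1) V_diff[OF elementary_in[OF v(1)] V_scale[OF elementary_in[OF u(1)]]]])
    fix y assume ne: "v y - k * u y \<noteq> 0"
    then have "y \<noteq> x" using k by auto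
    moreover have "v y \<noteq> 0 \<or> u y \<noteq> 0" using ne by auto
    ultimately show "y \<in> B" using u v by (auto simp: chain_supp_def)
  qed
  then have "v y = k * u y" for y by (simp add: fun_eq_iff)
  then show ?thesis using k(1) by auto
qed

lemma fund_circuit_rmat:
  assumes B: "B \<in> BB" "x \<notin> B" and u: "u \<in> elementary V" "chain_supp u \<subseteq> insert x B"
  shows "fund_circuit rmat B x = chain_supp u"
  unfolding fund_circuit_def circuits_rmat
proof (rule the_equality)
  show "chain_supp u \<in> chain_supp ` elementary V \<and> chain_supp u \<subseteq> B \<union> {x}" using u by auto
  fix C assume "C \<in> chain_supp ` elementary V \<and> C \<subseteq> B \<union> {x}"
  then obtain v where v: "v \<in> elementary V" "C = chain_supp v" "chain_supp v \<subseteq> insert x B" by auto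
  show "C = chain_supp u"
    using fundamental_unique[OF B u v(1,3)] v(2) by (elim disjE) (simp_all add: chain_supp_uminus)
qed

lemma chosen_signature:
  assumes "signature_on V \<sigma>" "u \<in> \<sigma>"
  shows "chosen \<sigma> (chain_supp u) = u"
  unfolding chosen_def
proof (rule the_equality)
  show "u \<in> \<sigma> \<and> chain_supp u = chain_supp u" using assms by simp
  fix v assume v: "v \<in> \<sigma> \<and> chain_supp v = chain_supp u"
  then have "v = u \<or> v = (\<lambda>y. - u y)"
    using assms by (intro elementary_supp_eq) (auto simp: signature_on_def)
  then show "v = u" using v signature_onD(2)[OF assms] by auto
qed

lemma circuit_four_value:
  assumes sig: "signature_on V \<sigma>" and B: "B \<in> BB" and x: "x \<in> E - B"
    and u: "u \<in> \<sigma>" "chain_supp u \<subseteq> insert x B"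
  shows "circuit_four rmat \<sigma> B x = {u x}"
proof -
  have uel: "u \<in> elementary V" using signature_onD[OF sig u(1)] by blast
  have "chosen \<sigma> (fund_circuit rmat B x) = u"
    using fund_circuit_rmat[OF B _ uel u(2)] x chosen_signature[OF sig u(1)] by simp
  moreover have "sgn (u x) = u x" using elementary_values[OF uel, of x] by auto
  ultimately show ?thesis using x by (simp add: circuit_four_def)
qed

lemma fundamental_in_signature:
  assumes sig: "signature_on V \<sigma>" and B: "B \<in> BB" and x: "x \<in> E - B"
  obtains u where "u \<in> \<sigma>" "chain_supp u \<subseteq> insert x B" "u x = 1 \<or> u x = -1"
proof -
  obtain c where c: "c \<in> elementary V" "c x = 1" "chain_supp c \<subseteq> insert x B"
    using fundamental_elementary[OF B x] .
  have "c \<in> \<sigma> \<or> (\<lambda>y. - c y) \<in> \<sigma>" using sig c(1) by (auto simp: signature_on_def)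
  then show thesis
    using that[of c] that[of "\<lambda>y. - c y"] c(2,3) by (auto simp: chain_supp_uminus)
qed

lemma circuit_signature_rmat:
  assumes "circuit_signature rmat \<sigma>"
  shows "signature_on V \<sigma>"
proof -
  have sub: "\<sigma> \<subseteq> elementary V" and ex: "\<And>u. u \<in> elementary V \<Longrightarrow> \<exists>!P. P \<in> \<sigma> \<and> chain_supp P = chain_supp u"
    using assms by (auto simp: circuit_signature_def circuits_rmat)
  have "(u \<in> \<sigma>) \<noteq> ((\<lambda>x. - u x) \<in> \<sigma>)" if u: "u \<in> elementary V" for u
  proof -
    obtain P where P: "P \<in> \<sigma>" "chain_supp P = chain_supp u"
      and uniq: "\<And>Q. Q \<in> \<sigma> \<Longrightarrow> chain_supp Q = chain_supp u \<Longrightarrow> Q = P" using ex[OF u] by metis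
    have "P = u \<or> P = (\<lambda>x. - u x)" using elementary_supp_eq[OF u, of P] P sub by auto
    moreover have "u \<noteq> (\<lambda>x. - u x)"
    proof
      assume "u = (\<lambda>x. - u x)"
      then have "u y = - u y" for y by (rule fun_cong)
      then have "u = (\<lambda>_. 0)" by (simp add: fun_eq_iff)
      then show False using u by (simp add: elementary_def)
    qed
    ultimately show ?thesis using P(1) uniq[of u] uniq[of "\<lambda>x. - u x"] chain_supp_uminus[of u] by metis
  qed
  then show ?thesis using sub by (simp add: signature_on_def)
qed

lemma cocircuit_four_dual:
  assumes "B \<subseteq> E"
  shows "cocircuit_four rmat \<sigma>' B = circuit_four (dual_matroid rmat) \<sigma>' (E - B)"
proof -
  have "fund_cocircuit rmat B x = fund_circuit (dual_matroid rmat) (E - B) x" for x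
    by (simp add: fund_cocircuit_def fund_circuit_def circuits_def cocircuits_def cocircuits_of_bases)
  then show ?thesis by (auto simp: cocircuit_four_def circuit_four_def fun_eq_iff)
qed

text \<open>If \<open>- u\<close> were chosen, extend the support of \<open>u\<close> minus one
  element \<open>x\<close> to a basis \<open>B'\<close>. Its fourientation has the sign
  \<open>- u x\<close> at \<open>x\<close>, so \<open>u\<close> is compatible with the negative of
  it. Triangulation forces \<open>B = B'\<close>, and then \<open>u\<close> has the wrong sign at
  \<open>x\<close>.\<close>

lemma triangulating_circuit_compatible:
  assumes tri: "triangulating_circuit_signature rmat \<sigma>" and B: "B \<in> BB"
    and u: "u \<in> elementary V" "chain_compatible u (circuit_four rmat \<sigma> B)"
  shows "u \<in> \<sigma>"
proof (rule ccontr)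
  assume "u \<notin> \<sigma>"
  have sig: "signature_on V \<sigma>"
    using tri circuit_signature_rmat by (simp add: triangulating_circuit_signature_def)
  then have m: "(\<lambda>x. - u x) \<in> \<sigma>" using \<open>u \<notin> \<sigma>\<close> u(1) by (auto simp: signature_on_def)
  obtain x where x: "u x \<noteq> 0" using u(1) by (auto simp: elementary_def fun_eq_iff)
  have "\<exists>B'\<in>BB. chain_supp u - {x} \<subseteq> B'"
  proof (rule independent_in_basis)
    show "chain_supp u - {x} \<subseteq> E" using V_supp[OF elementary_in[OF u(1)]] by (auto simp: chain_supp_def)
    fix v assume v: "v \<in> V" "chain_supp v \<subseteq> chain_supp u - {x}"
    show "v = (\<lambda>_. 0)"
    proof (rule ccontr)
      assume "v \<noteq> (\<lambda>_. 0)"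
      then have "chain_supp v = chain_supp u" using v u(1) by (auto simp: elementary_def)
      then show False using v(2) x by (auto simp: chain_supp_def)
    qed
  qed
  then obtain B' where B': "B' \<in> BB" "chain_supp u - {x} \<subseteq> B'" by blast
  have xB': "x \<notin> B'"
  proof
    assume "x \<in> B'"
    then have "u = (\<lambda>_. 0)"
      using B' by (intro basis_independent[OF B'(1) elementary_in[OF u(1)]]) (auto simp: chain_supp_def)
    then show False using x by simp
  qed
  have xE: "x \<in> E" using V_supp[OF elementary_in[OF u(1)] x] .
  have four: "circuit_four rmat \<sigma> B' x = {- u x}"
    using circuit_four_value[OF sig B'(1) _ m] xE xB' B'(2) by (auto simp: chain_supp_def)
  have sgu: "sgn (u y) = u y" for y using elementary_values[OF u(1), of y] by auto
  have "chain_compatible u (four_neg (circuit_four rmat \<sigma> B'))" unfolding chain_compatible_def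
  proof
    fix y assume y: "y \<in> chain_supp u"
    show "sgn (u y) \<in> four_neg (circuit_four rmat \<sigma> B') y"
    proof (cases "y = x")
      case True
      then show ?thesis using four sgu by (simp add: four_neg_def)
    next
      case False
      then have "y \<in> B'" "y \<in> E" "u y \<noteq> 0" using y B' bases_sub[OF B'(1)] by (auto simp: chain_supp_def)
      then show ?thesis using elementary_values[OF u(1), of y] by (auto simp: four_neg_def circuit_four_def)
    qed
  qed
  then have "chain_compatible u (four_inter (circuit_four rmat \<sigma> B) (four_neg (circuit_four rmat \<sigma> B')))"
    using u(2) by (simp add: chain_compatible_def four_inter_def)
  then have "B = B'"
    using tri B B'(1) u(1) unfolding triangulating_circuit_signature_def rmat_simps by blast
  then have "sgn (u x) \<in> {- u x}" using u(2) four x by (auto simp: chain_compatible_def chain_supp_def)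
  then show False using sgu x by simp
qed

text \<open>Triangulation speaks of signed circuits only; an elementary part conformal to an
  arbitrary violating chain is again violating.\<close>

lemma triangulating_separated:
  assumes tri: "triangulating_circuit_signature rmat \<sigma>" and B: "B1 \<in> BB" "B2 \<in> BB" "B1 \<noteq> B2"
    and o1: "\<And>x. x \<in> E - B1 \<Longrightarrow> circuit_four rmat \<sigma> B1 x = {o1 x}"
    and o2: "\<And>x. x \<in> E - B2 \<Longrightarrow> circuit_four rmat \<sigma> B2 x = {o2 x}"
  shows "separated V B1 B2 o1 o2"
  unfolding separated_def
proof
  assume "\<exists>u\<in>V. u \<noteq> (\<lambda>_. 0) \<and>
     (\<forall>x. u x \<noteq> 0 \<longrightarrow> (x \<notin> B2 \<longrightarrow> sgn (u x) = o2 x) \<and> (x \<notin> B1 \<longrightarrow> sgn (u x) = - o1 x))"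
  then obtain v where v: "v \<in> V" "v \<noteq> (\<lambda>_. 0)"
    "\<And>x. v x \<noteq> 0 \<Longrightarrow> (x \<notin> B2 \<longrightarrow> sgn (v x) = o2 x) \<and> (x \<notin> B1 \<longrightarrow> sgn (v x) = - o1 x)" by blast
  obtain u where u: "u \<in> elementary V" "conformal u v" using conformal_elementary v by blast
  have "chain_compatible u (four_inter (circuit_four rmat \<sigma> B2) (four_neg (circuit_four rmat \<sigma> B1)))"
    unfolding chain_compatible_def
  proof
    fix x assume "x \<in> chain_supp u"
    then have ux: "u x \<noteq> 0" by (simp add: chain_supp_def)
    then have s: "sgn (u x) = sgn (v x)" using u(2) by (simp add: conformal_def)
    then have vx: "v x \<noteq> 0" using ux by (auto simp: sgn_0_0)
    have xE: "x \<in> E" using V_supp[OF v(1) vx] .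
    have s1: "sgn (u x) = 1 \<or> sgn (u x) = -1" using ux by (auto simp: sgn_if)
    have "sgn (u x) \<in> circuit_four rmat \<sigma> B2 x"
    proof (cases "x \<in> B2")
      case True
      then show ?thesis using xE s1 by (simp add: circuit_four_def)
    next
      case False
      then show ?thesis using o2[of x] v(3)[OF vx] s xE by simp
    qed
    moreover have "sgn (u x) \<in> four_neg (circuit_four rmat \<sigma> B1) x"
    proof (cases "x \<in> B1")
      case True
      then show ?thesis using xE s1 by (auto simp: circuit_four_def four_neg_def)
    next
      case False
      then show ?thesis using o1[of x] v(3)[OF vx] s xE by (simp add: four_neg_def)
    qed
    ultimately show "sgn (u x) \<in> four_inter (circuit_four rmat \<sigma> B2) (four_neg (circuit_four rmat \<sigma> B1)) x"
      by (simp add: four_inter_def)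
  qed
  then show False
    using tri B u(1) unfolding triangulating_circuit_signature_def rmat_simps by blast
qed

lemma bby_value:
  assumes sig: "signature_on V \<sigma>" and B: "B \<in> BB" and x: "x \<in> E - B"
    and u: "u \<in> \<sigma>" "chain_supp u \<subseteq> insert x B"
  shows "bby rmat \<sigma> \<sigma>' B x = {u x}"
proof -
  have ux: "circuit_four rmat \<sigma> B x = {u x}" by (rule circuit_four_value[OF assms])
  have "u \<in> elementary V" using signature_onD[OF sig u(1)] by blast
  then have "u x \<noteq> 0 \<Longrightarrow> u x = 1 \<or> u x = -1" using elementary_values by blast
  moreover have "u x \<noteq> 0"
  proof
    assume "u x = 0"
    then have "u = (\<lambda>_. 0)"
      using u(2) \<open>u \<in> elementary V\<close>
      by (intro basis_independent[OF B]) (auto simp: chain_supp_def elementary_def)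
    then show False using \<open>u \<in> elementary V\<close> by (simp add: elementary_def)
  qed
  ultimately show ?thesis using x ux by (auto simp: bby_def four_inter_def cocircuit_four_def)
qed

lemma bby_dual:
  assumes "B \<subseteq> E"
  shows "bby rmat \<sigma> \<sigma>' B = bby (dual_matroid rmat) \<sigma>' \<sigma> (E - B)"
proof -
  interpret D: regular_pair E "(\<lambda>B. E - B) ` BB" W V by (rule dual)
  have "dual_matroid (dual_matroid rmat) = rmat"
    by (simp add: D.dual_rmat dual_rmat dual_bases_involution)
  moreover have "E - (E - B) = B" using assms by blast
  ultimately have "cocircuit_four (dual_matroid rmat) \<sigma> (E - B) = circuit_four rmat \<sigma> B"
    using D.cocircuit_four_dual[of "E - B" \<sigma>] by (simp add: dual_rmat)
  then show ?thesis using cocircuit_four_dual[OF assms]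
    by (auto simp: bby_def four_inter_def fun_eq_iff)
qed

lemma bby_orientation:
  assumes sig: "signature_on V \<sigma>" "signature_on W \<sigma>'" and B: "B \<in> BB"
  shows "bby rmat \<sigma> \<sigma>' B \<in> orientations E"
proof -
  interpret D: regular_pair E "(\<lambda>B. E - B) ` BB" W V by (rule dual)
  have BE: "B \<subseteq> E" using bases_sub[OF B] .
  have "bby rmat \<sigma> \<sigma>' B x = {1} \<or> bby rmat \<sigma> \<sigma>' B x = {-1}" if x: "x \<in> E" for x
  proof (cases "x \<in> B")
    case False
    then have xB: "x \<in> E - B" using x by simp
    obtain u where u: "u \<in> \<sigma>" "chain_supp u \<subseteq> insert x B" "u x = 1 \<or> u x = -1"
      using fundamental_in_signature[OF sig(1) B xB] .
    then show ?thesis using bby_value[OF sig(1) B xB u(1,2)] by auto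
  next
    case True
    then have xB: "x \<in> E - (E - B)" using x by simp
    have DB: "E - B \<in> (\<lambda>B. E - B) ` BB" using B by simp
    obtain u where u: "u \<in> \<sigma>'" "chain_supp u \<subseteq> insert x (E - B)" "u x = 1 \<or> u x = -1"
      using D.fundamental_in_signature[OF sig(2) DB xB] .
    then show ?thesis using D.bby_value[OF sig(2) DB xB u(1,2)] unfolding bby_dual[OF BE] dual_rmat by auto
  qed
  then show ?thesis by (auto simp: orientations_def bby_def four_inter_def circuit_four_def)
qed

lemma circuit_four_bby:
  assumes sig: "signature_on V \<sigma>" "signature_on W \<sigma>'" and B: "B \<in> BB" and x: "x \<in> E - B"
  shows "circuit_four rmat \<sigma> B x = {orientation_sign (bby rmat \<sigma> \<sigma>' B) x}"
proof -
  obtain u where u: "u \<in> \<sigma>" "chain_supp u \<subseteq> insert x B" using fundamental_in_signature[OF sig(1) B x] .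
  have "circuit_four rmat \<sigma> B x = bby rmat \<sigma> \<sigma>' B x"
    using circuit_four_value[OF sig(1) B x u] bby_value[OF sig(1) B x u] by simp
  then show ?thesis using orientation_eq_sign[OF bby_orientation[OF sig B]] x by simp
qed

lemma triangulating_circuit_dual:
  "triangulating_cocircuit_signature rmat \<sigma>' \<longleftrightarrow> triangulating_circuit_signature (dual_matroid rmat) \<sigma>'"
proof -
  have "cocircuit_signature rmat \<sigma>' \<longleftrightarrow> circuit_signature (dual_matroid rmat) \<sigma>'"
    by (simp add: cocircuit_signature_def circuit_signature_def circuits_def cocircuits_def cocircuits_of_bases)
  moreover have "E - B1 = E - B2 \<longleftrightarrow> B1 = B2" if "B1 \<in> BB" "B2 \<in> BB" for B1 B2
    using bases_sub[OF that(1)] bases_sub[OF that(2)] by blast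
  ultimately show ?thesis using cocircuit_four_dual bases_sub
    by (simp add: triangulating_cocircuit_signature_def triangulating_circuit_signature_def)
qed

lemma triangulating_rmat:
  assumes "triangulating rmat \<sigma> \<sigma>'"
  shows "triangulating_circuit_signature rmat \<sigma>"
    "triangulating_circuit_signature (matroid_of_pair E ((\<lambda>B. E - B) ` BB) W V) \<sigma>'"
    "signature_on V \<sigma>" "signature_on W \<sigma>'"
proof -
  show t: "triangulating_circuit_signature rmat \<sigma>"
    "triangulating_circuit_signature (matroid_of_pair E ((\<lambda>B. E - B) ` BB) W V) \<sigma>'"
    using assms triangulating_circuit_dual by (auto simp: triangulating_def dual_rmat)
  show "signature_on V \<sigma>" "signature_on W \<sigma>'"
    using t circuit_signature_rmat regular_pair.circuit_signature_rmat[OF dual]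
    by (auto simp: triangulating_circuit_signature_def)
qed

lemma chain_compatible_inter:
  assumes "chain_compatible u (four_inter F F')"
  shows "chain_compatible u F" "chain_compatible u F'"
  using assms by (auto simp: chain_compatible_def four_inter_def)

lemma bby_compatible:
  assumes tri: "triangulating rmat \<sigma> \<sigma>'" and B: "B \<in> BB"
  shows "compatible_orientation rmat \<sigma> \<sigma>' (bby rmat \<sigma> \<sigma>' B)"
proof -
  interpret D: regular_pair E "(\<lambda>B. E - B) ` BB" W V by (rule dual)
  note t = triangulating_rmat[OF tri]
  have DB: "E - B \<in> (\<lambda>B. E - B) ` BB" using B by simp
  have "u \<in> \<sigma>" if "u \<in> elementary V" "chain_compatible u (bby rmat \<sigma> \<sigma>' B)" for u
    using triangulating_circuit_compatible[OF t(1) B that(1)] chain_compatible_inter(1) that(2)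
    unfolding bby_def by blast
  moreover have "u \<in> \<sigma>'" if "u \<in> elementary W" "chain_compatible u (bby rmat \<sigma> \<sigma>' B)" for u
    using D.triangulating_circuit_compatible[OF t(2) DB that(1)] chain_compatible_inter(2) that(2)
      cocircuit_four_dual[OF bases_sub[OF B], of \<sigma>'] unfolding bby_def dual_rmat by metis
  ultimately show ?thesis using bby_orientation[OF t(3,4) B] by (simp add: compatible_orientation_def)
qed

lemma separated_bby:
  assumes tri: "triangulating rmat \<sigma> \<sigma>'" and B: "B1 \<in> BB" "B2 \<in> BB" "B1 \<noteq> B2"
  defines "o1 \<equiv> orientation_sign (bby rmat \<sigma> \<sigma>' B1)" and "o2 \<equiv> orientation_sign (bby rmat \<sigma> \<sigma>' B2)"
  shows "separated V B1 B2 o1 o2" "separated W (E - B1) (E - B2) o1 o2"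
proof -
  interpret D: regular_pair E "(\<lambda>B. E - B) ` BB" W V by (rule dual)
  note t = triangulating_rmat[OF tri]
  show "separated V B1 B2 o1 o2" unfolding o1_def o2_def
    using triangulating_separated[OF t(1) B circuit_four_bby[OF t(3,4) B(1)] circuit_four_bby[OF t(3,4) B(2)]] .
  have DB: "E - B1 \<in> (\<lambda>B. E - B) ` BB" "E - B2 \<in> (\<lambda>B. E - B) ` BB" using B by auto
  have "E - B1 \<noteq> E - B2" using B bases_sub[OF B(1)] bases_sub[OF B(2)] by blast
  from D.triangulating_separated[OF t(2) DB this D.circuit_four_bby[OF t(4,3) DB(1)] D.circuit_four_bby[OF t(4,3) DB(2)]]
  show "separated W (E - B1) (E - B2) o1 o2" unfolding o1_def o2_def
    using bby_dual[OF bases_sub[OF B(1)]] bby_dual[OF bases_sub[OF B(2)]] by (simp add: dual_rmat)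
qed

text \<open>With equal orientations the circuit of \<open>exchange_chain\<close> violates the
  separation of two distinct bases.\<close>

lemma bby_injective:
  assumes tri: "triangulating rmat \<sigma> \<sigma>'" and B: "B1 \<in> BB" "B2 \<in> BB"
    and eq: "bby rmat \<sigma> \<sigma>' B1 = bby rmat \<sigma> \<sigma>' B2"
  shows "B1 = B2"
proof (rule ccontr)
  assume ne: "B1 \<noteq> B2"
  define o1 where "o1 = orientation_sign (bby rmat \<sigma> \<sigma>' B1)"
  have val: "\<And>x. o1 x = 1 \<or> o1 x = -1" using orientation_sign_values by (simp add: o1_def)
  have sep: "separated V B1 B2 o1 o1" "separated W (E - B1) (E - B2) o1 o1"
    using separated_bby[OF tri B ne] eq by (auto simp: o1_def)
  obtain e where e: "e \<in> B1 - B2 \<or> e \<in> B2 - B1" using ne by blast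
  obtain q where q: "q \<in> elementary V" "q e \<noteq> 0" "\<And>x. q x \<noteq> 0 \<Longrightarrow> x \<in> B1 \<union> B2 \<and>
     (x \<in> B1 - B2 \<longrightarrow> q x = o1 x) \<and> (x \<in> B2 - B1 \<longrightarrow> q x = - o1 x)"
    using exchange_chain[OF B val val sep(2) e] by blast
  have sg: "sgn (q x) = q x" for x using elementary_values[OF q(1), of x] by auto
  have "q e = 0"
    by (rule separatedD[OF sep(1) elementary_in[OF q(1)]]) (use q(3) in \<open>auto simp: sg\<close>)
  then show False using q(2) by simp
qed

end

section \<open>Deletion and contraction\<close>

lemma chain_restrict_apply: "chain_restrict e P x = (if x = e then 0 else P x)"
  by (simp add: chain_restrict_def)

lemma chain_restrict_id: "P e = 0 \<Longrightarrow> chain_restrict e P = P"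
  by (auto simp: chain_restrict_def)

lemma chain_supp_restrict: "chain_supp (chain_restrict e P) = chain_supp P - {e}"
  by (auto simp: chain_supp_def chain_restrict_def)

lemma supp_empty_iff: "chain_supp P = {} \<longleftrightarrow> P = (\<lambda>_. 0)"
  by (auto simp: chain_supp_def)

section \<open>Minors of a regular pair and their signatures\<close>

context regular_pair begin

lemma elementary_deletion: "elementary {v \<in> V. v e = 0} = {u \<in> elementary V. u e = 0}"
proof -
  have "q e = 0" if "chain_supp q \<subseteq> chain_supp P" "P e = 0" for q P :: "'e chain"
    using that by (auto simp: chain_supp_def)
  then show ?thesis unfolding elementary_def by blast
qed

text \<open>Lift \<open>u\<close> to some \<open>v\<close> in \<open>V\<close> and take an
  elementary part conformal to \<open>v\<close> through a point of \<open>u\<close>. Its restriction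
  has support inside that of \<open>u\<close>, hence equal support by minimality, and the same
  signs.\<close>

lemma contraction_lift:
  assumes u: "u \<in> elementary (chain_restrict e ` V)"
  shows "\<exists>q\<in>elementary V. u = chain_restrict e q"
proof -
  obtain v where v: "v \<in> V" "u = chain_restrict e v" using u by (auto simp: elementary_def)
  obtain y where y: "u y \<noteq> 0" using u by (auto simp: elementary_def fun_eq_iff)
  then have "v y \<noteq> 0" using v(2) by (auto simp: chain_restrict_apply split: if_splits)
  then obtain q where q: "q \<in> elementary V" "conformal q v" "q y \<noteq> 0" using conformal_through v(1) by blast
  have conf: "q x \<noteq> 0 \<Longrightarrow> sgn (q x) = sgn (v x)" for x using q(2) by (simp add: conformal_def)
  have "y \<noteq> e" using y v(2) by (auto simp: chain_restrict_apply)
  have "chain_supp q \<subseteq> chain_supp v" using conf by (force simp: chain_supp_def sgn_0_0)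
  then have "chain_supp (chain_restrict e q) \<subseteq> chain_supp u"
    using v(2) by (auto simp: chain_supp_restrict)
  moreover have "chain_restrict e q y \<noteq> 0" using q(3) \<open>y \<noteq> e\<close> by (simp add: chain_restrict_apply)
  then have "chain_restrict e q \<noteq> (\<lambda>_. 0)" by auto
  ultimately have supp: "chain_supp (chain_restrict e q) = chain_supp u"
    using u elementary_in[OF q(1)] by (auto simp: elementary_def)
  have "u x = chain_restrict e q x" for x
  proof (cases "u x = 0")
    case True
    then show ?thesis using supp by (auto simp: chain_supp_def)
  next
    case False
    then have "chain_restrict e q x \<noteq> 0" using supp by (auto simp: chain_supp_def)
    then have ne: "x \<noteq> e" "q x \<noteq> 0" by (auto simp: chain_restrict_apply split: if_splits)
    have "u x \<in> {-1, 0, 1}" using u by (auto simp: elementary_def)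
    moreover have "sgn (q x) = sgn (u x)" using conf[OF ne(2)] v(2) ne(1) by (simp add: chain_restrict_apply)
    ultimately have "q x = u x" using elementary_values[OF q(1), of x] False ne(2) by auto
    then show ?thesis using ne(1) by (simp add: chain_restrict_apply)
  qed
  then show ?thesis using q(1) by blast
qed

lemma elementary_contraction:
  "elementary (chain_restrict e ` V) = supp_minimal (chain_restrict e ` elementary V)"
proof (intro equalityI subsetI)
  fix u assume u: "u \<in> elementary (chain_restrict e ` V)"
  have "\<not> chain_supp Q \<subset> chain_supp u" if "Q \<in> chain_restrict e ` elementary V" "chain_supp Q \<noteq> {}" for Q
  proof -
    have "Q \<in> chain_restrict e ` V" using that(1) elementary_in by blast
    then show ?thesis using u that(2) unfolding supp_empty_iff by (auto simp: elementary_def)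
  qed
  moreover have "u \<in> chain_restrict e ` elementary V" using contraction_lift[OF u] by blast
  moreover have "chain_supp u \<noteq> {}" unfolding supp_empty_iff using u by (auto simp: elementary_def)
  ultimately show "u \<in> supp_minimal (chain_restrict e ` elementary V)" unfolding supp_minimal_def by blast
next
  fix u assume u: "u \<in> supp_minimal (chain_restrict e ` elementary V)"
  then obtain q where q: "q \<in> elementary V" "u = chain_restrict e q" by (auto simp: supp_minimal_def)
  have une: "u \<noteq> (\<lambda>_. 0)" using u unfolding supp_minimal_def supp_empty_iff by blast
  have uV: "u \<in> chain_restrict e ` V" using q elementary_in by blast
  have "u x \<in> {-1, 0, 1}" for x
    using q elementary_values[OF q(1), of x] by (auto simp: chain_restrict_apply)
  moreover have "chain_supp p = chain_supp u"
    if p: "p \<in> chain_restrict e ` V" "p \<noteq> (\<lambda>_. 0)" "chain_supp p \<subseteq> chain_supp u" for p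
  proof -
    obtain v where v: "v \<in> V" "p = chain_restrict e v" using p(1) by blast
    obtain y where y: "p y \<noteq> 0" using p(2) by auto
    then have ye: "y \<noteq> e" "v y \<noteq> 0" using v(2) by (auto simp: chain_restrict_apply split: if_splits)
    then obtain r where r: "r \<in> elementary V" "conformal r v" "r y \<noteq> 0" using conformal_through v(1) by blast
    have "chain_supp r \<subseteq> chain_supp v" using r(2) by (force simp: conformal_def chain_supp_def sgn_0_0)
    then have sub: "chain_supp (chain_restrict e r) \<subseteq> chain_supp p" using v(2) by (auto simp: chain_supp_restrict)
    have "y \<in> chain_supp (chain_restrict e r)" using r(3) ye by (simp add: chain_supp_def chain_restrict_apply)
    then have "\<not> chain_supp (chain_restrict e r) \<subset> chain_supp u"
      using u r(1) unfolding supp_minimal_def by blast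
    then show ?thesis using sub p(3) by blast
  qed
  ultimately show "u \<in> elementary (chain_restrict e ` V)" using uV une by (auto simp: elementary_def)
qed

text \<open>\<open>B0\<close> witnesses that \<open>e\<close> is no coloop. For a basis avoiding
  \<open>e\<close>, fundamental circuits of other elements do not contain \<open>e\<close>, and
  fundamental cocircuits are merely truncated at \<open>e\<close>.\<close>

lemma deletion_pair:
  assumes e: "e \<in> E" and B0: "B0 \<in> BB" "e \<notin> B0"
  shows "regular_pair (E - {e}) {B \<in> BB. e \<notin> B} {v \<in> V. v e = 0} (chain_restrict e ` W)"
proof
  show "finite (E - {e})" using finite_E by simp
  show "{B \<in> BB. e \<notin> B} \<noteq> {}" using B0 by blast
  show "\<And>B. B \<in> {B \<in> BB. e \<notin> B} \<Longrightarrow> B \<subseteq> E - {e}" using bases_sub by blast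
  show "{v \<in> V. v e = 0} \<subseteq> chains (E - {e})" using V_sub by (fastforce simp: chains_iff)
  show "chain_restrict e ` W \<subseteq> chains (E - {e})" using W_sub by (auto simp: chains_iff chain_restrict_apply)
  show "(\<lambda>_. 0) \<in> {v \<in> V. v e = 0}" using V_zero by simp
  have "chain_restrict e (\<lambda>_. 0) = (\<lambda>_. 0)" by (simp add: chain_restrict_id)
  then show "(\<lambda>_. 0) \<in> chain_restrict e ` W" using W_zero by (metis image_eqI)
  show "(\<lambda>x. u x - v x) \<in> {v \<in> V. v e = 0}" if "u \<in> {v \<in> V. v e = 0}" "v \<in> {v \<in> V. v e = 0}" for u v
    using that V_diff by auto
  show "(\<lambda>x. u x - v x) \<in> chain_restrict e ` W"
    if mem: "u \<in> chain_restrict e ` W" "v \<in> chain_restrict e ` W" for u v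
  proof -
    obtain u' v' where uv: "u' \<in> W" "v' \<in> W" "u = chain_restrict e u'" "v = chain_restrict e v'" using mem by blast
    have "(\<lambda>x. u x - v x) = chain_restrict e (\<lambda>x. u' x - v' x)" using uv by (auto simp: chain_restrict_apply)
    then show ?thesis using W_diff[OF uv(1,2)] by blast
  qed
  show "(\<Sum>x\<in>E - {e}. v x * w x) = 0" if vw: "v \<in> {v \<in> V. v e = 0}" "w \<in> chain_restrict e ` W" for v w
  proof -
    obtain w' where w': "w' \<in> W" "w = chain_restrict e w'" using vw(2) by blast
    have "(\<Sum>x\<in>E - {e}. v x * w x) = (\<Sum>x\<in>E - {e}. v x * w' x)"
      by (rule sum.cong) (auto simp: w' chain_restrict_apply)
    also have "\<dots> = (\<Sum>x\<in>E. v x * w' x)" using sum.remove[OF finite_E e, of "\<lambda>x. v x * w' x"] vw(1) by simp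
    finally show ?thesis using orth[of v w'] vw(1) w' by simp
  qed
next
  fix B x assume B: "B \<in> {B \<in> BB. e \<notin> B}" and x: "x \<in> E - {e} - B"
  then obtain c where c: "c \<in> V" "c x = 1" "\<forall>y. c y \<in> {-1, 0, 1}" "\<forall>y. c y \<noteq> 0 \<longrightarrow> y \<in> insert x B"
    "\<forall>y\<in>B. c y \<noteq> 0 \<longrightarrow> insert x (B - {y}) \<in> BB" using fund[of B x] by auto
  have "c e = 0" using c(4) x B by auto
  then show "\<exists>c\<in>{v \<in> V. v e = 0}. c x = 1 \<and> (\<forall>y. c y \<in> {-1, 0, 1}) \<and> (\<forall>y. c y \<noteq> 0 \<longrightarrow> y \<in> insert x B) \<and>
      (\<forall>y\<in>B. c y \<noteq> 0 \<longrightarrow> insert x (B - {y}) \<in> {B \<in> BB. e \<notin> B})"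
    using c x B by (intro bexI[of _ c]) auto
next
  fix B y assume B: "B \<in> {B \<in> BB. e \<notin> B}" and y: "y \<in> B"
  then obtain c where c: "c \<in> W" "c y = 1" "\<forall>x. c x \<in> {-1, 0, 1}" "\<forall>x. c x \<noteq> 0 \<longrightarrow> x \<in> insert y (E - B)"
    "\<forall>x\<in>E - B. c x \<noteq> 0 \<longrightarrow> insert x (B - {y}) \<in> BB" using cofund[of B y] by auto
  have "y \<noteq> e" using B y by auto
  then show "\<exists>c\<in>chain_restrict e ` W. c y = 1 \<and> (\<forall>x. c x \<in> {-1, 0, 1}) \<and>
      (\<forall>x. c x \<noteq> 0 \<longrightarrow> x \<in> insert y (E - {e} - B)) \<and>
      (\<forall>x\<in>E - {e} - B. c x \<noteq> 0 \<longrightarrow> insert x (B - {y}) \<in> {B \<in> BB. e \<notin> B})"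
    using c B by (intro bexI[of _ "chain_restrict e c"]) (auto simp: chain_restrict_apply)
qed

lemma deletion_rmat:
  "deletion rmat e = matroid_of_pair (E - {e}) {B \<in> BB. e \<notin> B} {v \<in> V. v e = 0} (chain_restrict e ` W)"
proof -
  have "chain_restrict e ` {P \<in> elementary V. P e = 0} = {u \<in> elementary V. u e = 0}"
    by (force simp: chain_restrict_id image_iff)
  then show ?thesis
    using regular_pair.elementary_contraction[OF dual, of e]
    by (simp add: deletion_def matroid_of_pair_def elementary_deletion)
qed

lemma sig_delete_rmat:
  assumes "signature_on V \<sigma>"
  shows "sig_delete rmat \<sigma> e = {u \<in> \<sigma>. u e = 0}"
proof -
  have "sig_delete rmat \<sigma> e = chain_restrict e ` \<sigma> \<inter> {u \<in> elementary V. u e = 0}"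
    unfolding sig_delete_def deletion_rmat by (simp add: matroid_of_pair_def elementary_deletion)
  also have "\<dots> = {u \<in> \<sigma>. u e = 0}"
  proof (intro equalityI subsetI)
    fix u assume "u \<in> chain_restrict e ` \<sigma> \<inter> {u \<in> elementary V. u e = 0}"
    then obtain q where q: "q \<in> \<sigma>" "u = chain_restrict e q" "u \<in> elementary V" "u e = 0" by auto
    \<comment> \<open>Restriction cannot shrink the support of an elementary chain to that of
      another one, so \<open>q\<close> already vanishes at \<open>e\<close>.\<close>
    have "q \<in> elementary V" using assms q(1) by (auto simp: signature_on_def)
    moreover have "chain_supp u \<subseteq> chain_supp q" using q(2) by (auto simp: chain_supp_restrict)
    ultimately have "chain_supp u = chain_supp q" using q(3) by (auto simp: elementary_def)
    then have "q e = 0" using q(4) by (auto simp: chain_supp_def)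
    then show "u \<in> {u \<in> \<sigma>. u e = 0}" using q(1,2) by (simp add: chain_restrict_id)
  next
    fix u assume "u \<in> {u \<in> \<sigma>. u e = 0}"
    then show "u \<in> chain_restrict e ` \<sigma> \<inter> {u \<in> elementary V. u e = 0}"
      using assms chain_restrict_id[of u e] by (auto simp: signature_on_def image_iff intro!: bexI[of _ u])
  qed
  finally show ?thesis .
qed

lemma signature_deletion:
  "signature_on V \<sigma> \<Longrightarrow> signature_on {v \<in> V. v e = 0} {u \<in> \<sigma>. u e = 0}"
  by (auto simp: signature_on_def elementary_deletion)

lemma cosig_delete_rmat:
  "cosig_delete rmat \<sigma>' e = chain_restrict e ` \<sigma>' \<inter> elementary (chain_restrict e ` W)"
  unfolding cosig_delete_def deletion_rmat by (simp add: matroid_of_pair_def)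

lemma signature_contraction:
  assumes sig: "signature_on W \<sigma>'" and B0: "B0 \<in> BB" "e \<notin> B0" and e: "e \<in> E"
  shows "signature_on (chain_restrict e ` W) (chain_restrict e ` \<sigma>' \<inter> elementary (chain_restrict e ` W))"
proof -
  interpret D: regular_pair E "(\<lambda>B. E - B) ` BB" W V by (rule dual)
  interpret N: regular_pair "E - {e}" "{B \<in> BB. e \<notin> B}" "{v \<in> V. v e = 0}" "chain_restrict e ` W"
    by (rule deletion_pair[OF e B0])
  have neg: "chain_restrict e (\<lambda>x. - q x) = (\<lambda>x. - chain_restrict e q x)" for q
    by (auto simp: chain_restrict_apply)
  have "(u \<in> chain_restrict e ` \<sigma>') \<noteq> ((\<lambda>x. - u x) \<in> chain_restrict e ` \<sigma>')"
    if u: "u \<in> elementary (chain_restrict e ` W)" for u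
  proof -
    obtain q where q: "q \<in> elementary W" "u = chain_restrict e q" using D.contraction_lift[OF u] by blast
    have "q \<in> \<sigma>' \<or> (\<lambda>x. - q x) \<in> \<sigma>'" using sig q(1) by (auto simp: signature_on_def)
    then have "u \<in> chain_restrict e ` \<sigma>' \<or> (\<lambda>x. - u x) \<in> chain_restrict e ` \<sigma>'"
      using q(2) neg by (metis image_eqI)
    moreover have "\<not> (u \<in> chain_restrict e ` \<sigma>' \<and> (\<lambda>x. - u x) \<in> chain_restrict e ` \<sigma>')"
    proof
      assume "u \<in> chain_restrict e ` \<sigma>' \<and> (\<lambda>x. - u x) \<in> chain_restrict e ` \<sigma>'"
      then obtain p r where pr: "p \<in> \<sigma>'" "r \<in> \<sigma>'" "u = chain_restrict e p" "(\<lambda>x. - u x) = chain_restrict e r" by blast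
      have pW: "p \<in> W" "r \<in> W" using pr sig by (auto simp: signature_on_def elementary_def)
      have sum0: "p x + r x = 0" if "x \<noteq> e" for x
      proof -
        have "u x = p x" using pr(3) that by (simp add: chain_restrict_apply)
        moreover have "- u x = r x" using fun_cong[OF pr(4), of x] that by (simp add: chain_restrict_apply)
        ultimately show ?thesis by simp
      qed
      \<comment> \<open>The sum is supported on \<open>e\<close>, which lies in the dual basis
        \<open>E - B0\<close> and is therefore no loop of the dual.\<close>
      have "(\<lambda>x. p x + r x) = (\<lambda>_. 0)"
      proof (rule D.basis_independent[of "E - B0"])
        show "E - B0 \<in> (\<lambda>B. E - B) ` BB" using B0 by simp
        show "(\<lambda>x. p x + r x) \<in> W" using W_add pW by blast
        show "x \<in> E - B0" if "p x + r x \<noteq> 0" for x using sum0[of x] that e B0 by auto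
      qed
      then have "p x + r x = 0" for x by (rule fun_cong)
      then have "r = (\<lambda>x. - p x)" by (intro ext) (simp add: eq_neg_iff_add_eq_0 add.commute)
      then show False using pr(1,2) sig by (auto simp: signature_on_def)
    qed
    ultimately show ?thesis by blast
  qed
  moreover have "(\<lambda>x. - u x) \<in> elementary (chain_restrict e ` W)" if "u \<in> elementary (chain_restrict e ` W)" for u
    using regular_pair.elementary_uminus[OF N.dual that] .
  ultimately show ?thesis unfolding signature_on_def by (intro conjI ballI Int_lower2) blast
qed

text \<open>Off \<open>B\<close> the fundamental circuits are unchanged, on \<open>B\<close> the
  fundamental cocircuits are restricted and remain fundamental. The value at \<open>e\<close> is
  emptied because \<open>e\<close> has left the ground set.\<close>

lemma bby_deletion:
  assumes sig: "signature_on V \<sigma>" "signature_on W \<sigma>'" and e: "e \<in> E" and B: "B \<in> BB" "e \<notin> B"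
  shows "bby (deletion rmat e) (sig_delete rmat \<sigma> e) (cosig_delete rmat \<sigma>' e) B = (bby rmat \<sigma> \<sigma>' B)(e := {})"
proof
  fix x
  interpret D: regular_pair E "(\<lambda>B. E - B) ` BB" W V by (rule dual)
  interpret N: regular_pair "E - {e}" "{B \<in> BB. e \<notin> B}" "{v \<in> V. v e = 0}" "chain_restrict e ` W"
    by (rule deletion_pair[OF e B])
  interpret ND: regular_pair "E - {e}" "(\<lambda>B. E - {e} - B) ` {B \<in> BB. e \<notin> B}" "chain_restrict e ` W" "{v \<in> V. v e = 0}"
    by (rule N.dual)
  note sigN = signature_deletion[OF sig(1), of e] signature_contraction[OF sig(2) B e]
  have BN: "B \<in> {B \<in> BB. e \<notin> B}" using B by simp
  have NB: "B \<subseteq> E - {e}" "B \<subseteq> E" using bases_sub[OF B(1)] B(2) by auto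
  show "bby (deletion rmat e) (sig_delete rmat \<sigma> e) (cosig_delete rmat \<sigma>' e) B x = ((bby rmat \<sigma> \<sigma>' B)(e := {})) x"
  proof (cases "x \<in> E - {e}")
    case False
    then show ?thesis using bby_orientation[OF sig B(1)] N.bby_orientation[OF sigN BN]
      unfolding deletion_rmat sig_delete_rmat[OF sig(1)] cosig_delete_rmat by (auto simp: orientations_def)
  next
    case xE: True
    show ?thesis
    proof (cases "x \<in> B")
      case False
      then have x: "x \<in> E - B" "x \<in> E - {e} - B" using xE by auto
      obtain u where u: "u \<in> \<sigma>" "chain_supp u \<subseteq> insert x B" using fundamental_in_signature[OF sig(1) B(1) x(1)] .
      have "u e = 0" using u(2) xE B(2) by (auto simp: chain_supp_def)
      then have "u \<in> {u \<in> \<sigma>. u e = 0}" using u by simp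
      then show ?thesis
        using bby_value[OF sig(1) B(1) x(1) u] N.bby_value[OF sigN(1) BN x(2) _ u(2)] xE
        unfolding deletion_rmat sig_delete_rmat[OF sig(1)] by simp
    next
      case True
      have DB: "E - B \<in> (\<lambda>B. E - B) ` BB" "E - {e} - B \<in> (\<lambda>B. E - {e} - B) ` {B \<in> BB. e \<notin> B}" using B by auto
      have x: "x \<in> E - (E - B)" "x \<in> E - {e} - (E - {e} - B)" using True xE by auto
      obtain u where u: "u \<in> \<sigma>'" "chain_supp u \<subseteq> insert x (E - B)" "u x = 1 \<or> u x = -1"
        using D.fundamental_in_signature[OF sig(2) DB(1) x(1)] .
      let ?u = "chain_restrict e u"
      have ux: "?u x = u x" using xE by (simp add: chain_restrict_apply)
      have sub: "chain_supp ?u \<subseteq> insert x (E - {e} - B)" using u(2) by (auto simp: chain_supp_restrict)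
      have "u \<in> W" using u(1) sig(2) by (auto simp: signature_on_def elementary_def)
      then have "?u \<in> elementary (chain_restrict e ` W)"
        using ND.elementary_of_fundamental[OF DB(2) _ _ _ sub] True ux u(3) by auto
      then have "?u \<in> chain_restrict e ` \<sigma>' \<inter> elementary (chain_restrict e ` W)" using u(1) by blast
      then show ?thesis
        using D.bby_value[OF sig(2) DB(1) x(1) u(1,2), of \<sigma>]
          ND.bby_value[OF sigN(2) DB(2) x(2) _ sub, of "{u \<in> \<sigma>. u e = 0}"] xE ux
        unfolding deletion_rmat sig_delete_rmat[OF sig(1)] cosig_delete_rmat N.bby_dual[OF NB(1)] bby_dual[OF NB(2)]
          dual_rmat N.dual_rmat by simp
    qed
  qed
qed

text \<open>Compatibility in the deletion is deduced from the triangulating condition on the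
  original matroid, by lifting each signed cocircuit of the deletion.\<close>

lemma bby_deletion_compatible:
  assumes tri: "triangulating rmat \<sigma> \<sigma>'" and e: "e \<in> E" and B: "B \<in> BB" "e \<notin> B"
  shows "compatible_orientation (deletion rmat e) (sig_delete rmat \<sigma> e) (cosig_delete rmat \<sigma>' e)
     ((bby rmat \<sigma> \<sigma>' B)(e := {}))"
proof -
  interpret D: regular_pair E "(\<lambda>B. E - B) ` BB" W V by (rule dual)
  note t = triangulating_rmat[OF tri]
  interpret N: regular_pair "E - {e}" "{B \<in> BB. e \<notin> B}" "{v \<in> V. v e = 0}" "chain_restrict e ` W"
    by (rule deletion_pair[OF e B])
  have DB: "E - B \<in> (\<lambda>B. E - B) ` BB" using B by simp
  have "(bby rmat \<sigma> \<sigma>' B)(e := {}) \<in> orientations (E - {e})"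
    using bby_orientation[OF t(3,4) B(1)] by (auto simp: orientations_def)
  moreover have "u \<in> sig_delete rmat \<sigma> e"
    if u: "u \<in> elementary {v \<in> V. v e = 0}" "chain_compatible u ((bby rmat \<sigma> \<sigma>' B)(e := {}))" for u
  proof -
    have uV: "u \<in> elementary V" "u e = 0" using u(1) by (auto simp: elementary_deletion)
    have "chain_compatible u (bby rmat \<sigma> \<sigma>' B)"
      using u(2) by (auto simp: chain_compatible_def split: if_splits)
    then have "u \<in> \<sigma>" using bby_compatible[OF tri B(1)] uV by (simp add: compatible_orientation_def)
    then show ?thesis using uV sig_delete_rmat[OF t(3)] by simp
  qed
  moreover have "u \<in> cosig_delete rmat \<sigma>' e"
    if u: "u \<in> elementary (chain_restrict e ` W)" "chain_compatible u ((bby rmat \<sigma> \<sigma>' B)(e := {}))" for u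
  proof -
    obtain q where q: "q \<in> elementary W" "u = chain_restrict e q" using D.contraction_lift[OF u(1)] by blast
    \<comment> \<open>The fourientation is used in place of the BBY orientation because it allows
      both signs at \<open>e\<close>, where the sign of the lift is not controlled.\<close>
    have "chain_compatible q (cocircuit_four rmat \<sigma>' B)" unfolding chain_compatible_def
    proof
      fix x assume x: "x \<in> chain_supp q"
      show "sgn (q x) \<in> cocircuit_four rmat \<sigma>' B x"
      proof (cases "x = e")
        case True
        have "q x = 1 \<or> q x = -1" using x D.elementary_values[OF q(1), of x] by (auto simp: chain_supp_def)
        then show ?thesis using True e B by (auto simp: cocircuit_four_def)
      next
        case False
        then have "x \<in> chain_supp u" "sgn (u x) = sgn (q x)"
          using x q(2) by (auto simp: chain_supp_restrict chain_restrict_apply)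
        then show ?thesis using u(2) False by (auto simp: chain_compatible_def bby_def four_inter_def)
      qed
    qed
    then have "q \<in> \<sigma>'"
      using D.triangulating_circuit_compatible[OF t(2) DB q(1)]
      unfolding cocircuit_four_dual[OF bases_sub[OF B(1)]] dual_rmat by blast
    then show ?thesis using q(2) u(1) unfolding cosig_delete_rmat by blast
  qed
  ultimately show ?thesis
    unfolding compatible_orientation_def deletion_rmat N.rmat_simps by blast
qed

text \<open>As \<open>v\<close> vanishes at \<open>e\<close>, it lies in the circuit lattice of the
  deletion, while \<open>w\<close> may be restricted freely; the equation thus survives in the
  minor.\<close>

lemma sandpile_act_deletion:
  assumes tri: "triangulating rmat \<sigma> \<sigma>'" and e: "e \<in> E"
    and B: "B1 \<in> BB" "e \<notin> B1" "B2 \<in> BB" "e \<notin> B2"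
    and a: "a \<in> chains E" "a e = 0" and v: "v \<in> V" "v e = 0" and w: "w \<in> W"
    and eq: "\<And>x. positive_part (bby rmat \<sigma> \<sigma>' B2) x - positive_part (bby rmat \<sigma> \<sigma>' B1) x - a x = v x + w x"
  shows "sandpile_act (deletion rmat e) (sig_delete rmat \<sigma> e) (cosig_delete rmat \<sigma>' e)
      (sandpile_class (deletion rmat e) a)
      (bby (deletion rmat e) (sig_delete rmat \<sigma> e) (cosig_delete rmat \<sigma>' e) B1)
    = bby (deletion rmat e) (sig_delete rmat \<sigma> e) (cosig_delete rmat \<sigma>' e) B2"
proof -
  note t = triangulating_rmat[OF tri]
  interpret N: regular_pair "E - {e}" "{B \<in> BB. e \<notin> B}" "{v \<in> V. v e = 0}" "chain_restrict e ` W"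
    by (rule deletion_pair[OF e B(1,2)])
  note bby1 = bby_deletion[OF t(3,4) e B(1,2)] and bby2 = bby_deletion[OF t(3,4) e B(3,4)]
  note sig = signature_deletion[OF t(3), of e] signature_contraction[OF t(4) B(1,2) e]
  show ?thesis unfolding bby1 bby2 unfolding deletion_rmat
  proof (rule N.sandpile_act_iff)
    show "(\<lambda>x. - u x) \<notin> sig_delete rmat \<sigma> e" if "u \<in> sig_delete rmat \<sigma> e" for u
      using signature_onD(2)[OF sig(1)] that sig_delete_rmat[OF t(3)] by blast
    show "(\<lambda>x. - u x) \<notin> cosig_delete rmat \<sigma>' e" if "u \<in> cosig_delete rmat \<sigma>' e" for u
      using signature_onD(2)[OF sig(2)] that unfolding cosig_delete_rmat by blast
    show "(bby rmat \<sigma> \<sigma>' B1)(e := {}) \<in> orientations (E - {e})"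
      using bby_orientation[OF t(3,4) B(1)] by (auto simp: orientations_def)
    show "a \<in> chains (E - {e})" using a by (auto simp: chains_iff)
    show "compatible_orientation N.rmat (sig_delete rmat \<sigma> e) (cosig_delete rmat \<sigma>' e) ((bby rmat \<sigma> \<sigma>' B2)(e := {}))"
      using bby_deletion_compatible[OF tri e B(3,4)] unfolding deletion_rmat .
    have "(\<lambda>x. positive_part ((bby rmat \<sigma> \<sigma>' B2)(e := {})) x - positive_part ((bby rmat \<sigma> \<sigma>' B1)(e := {})) x - a x)
        = (\<lambda>x. v x + chain_restrict e w x)"
    proof
      fix x
      show "positive_part ((bby rmat \<sigma> \<sigma>' B2)(e := {})) x - positive_part ((bby rmat \<sigma> \<sigma>' B1)(e := {})) x - a x
        = v x + chain_restrict e w x"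
        using eq[of x] a v by (cases "x = e") (auto simp: positive_part_def chain_restrict_apply)
    qed
    moreover have "(\<lambda>x. v x + chain_restrict e w x) \<in> N.lat" using v w by (intro N.lat_intro) auto
    moreover have "(bby rmat \<sigma> \<sigma>' B2)(e := {}) \<in> orientations (E - {e})"
      using bby_orientation[OF t(3,4) B(3)] by (auto simp: orientations_def)
    ultimately show "(bby rmat \<sigma> \<sigma>' B2)(e := {}) \<in> N.translate_class ((bby rmat \<sigma> \<sigma>' B1)(e := {})) a"
      by (simp add: N.translate_class_def)
  qed
qed

section \<open>Contraction as the dual of deletion\<close>

lemma sandpile_dual:
  "sandpile_act (dual_matroid rmat) \<sigma>' \<sigma> = sandpile_act rmat \<sigma> \<sigma>'"
  "sandpile_class (dual_matroid rmat) = sandpile_class rmat"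
proof -
  have move: "cc_move (dual_matroid rmat) = cc_move rmat"
    by (simp add: cc_move_def fun_eq_iff Un_commute)
  then have cls: "cc_class (dual_matroid rmat) = cc_class rmat" by (intro ext) (simp add: cc_class_def)
  then have clss: "cc_classes (dual_matroid rmat) = cc_classes rmat" by (simp add: cc_classes_def)
  have lattice: "cc_lattice (dual_matroid rmat) = cc_lattice rmat"
    unfolding dual_rmat regular_pair.cc_lattice_rmat[OF dual] cc_lattice_rmat by (rule lattice_sum_commute)
  then show sc: "sandpile_class (dual_matroid rmat) = sandpile_class rmat"
    by (simp add: sandpile_class_def fun_eq_iff)
  have "sandpile_group (dual_matroid rmat) = sandpile_group rmat" using lattice by (simp add: sandpile_group_def)
  then have "canonical_action (dual_matroid rmat) = canonical_action rmat"
    using cls clss sc by (simp add: canonical_action_def is_canonical_action_def)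
  moreover have "compatible_orientation (dual_matroid rmat) \<sigma>' \<sigma> = compatible_orientation rmat \<sigma> \<sigma>'"
    by (auto simp: compatible_orientation_def fun_eq_iff)
  ultimately show "sandpile_act (dual_matroid rmat) \<sigma>' \<sigma> = sandpile_act rmat \<sigma> \<sigma>'"
    using cls by (simp add: sandpile_act_def compatible_rep_def fun_eq_iff)
qed

lemma triangulating_dual:
  assumes "triangulating rmat \<sigma> \<sigma>'"
  shows "triangulating (dual_matroid rmat) \<sigma>' \<sigma>"
proof -
  interpret D: regular_pair E "(\<lambda>B. E - B) ` BB" W V by (rule dual)
  have "dual_matroid D.rmat = rmat" by (simp add: D.dual_rmat dual_bases_involution)
  then show ?thesis
    using assms triangulating_circuit_dual D.triangulating_circuit_dual
    by (simp add: triangulating_def dual_rmat)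
qed

lemma contraction_eq_dual:
  assumes "e \<in> E"
  shows "contraction rmat e = dual_matroid (deletion (dual_matroid rmat) e)"
proof -
  have "{B - {e} |B. B \<in> BB \<and> e \<in> B} = (\<lambda>B. E - {e} - B) ` {B \<in> (\<lambda>B. E - B) ` BB. e \<notin> B}"
    (is "?L = ?R")
  proof (intro equalityI subsetI)
    fix C assume "C \<in> ?L"
    then obtain B where B: "B \<in> BB" "e \<in> B" "C = B - {e}" by blast
    then have "C = E - {e} - (E - B)" using bases_sub[OF B(1)] by blast
    then show "C \<in> ?R" using B by blast
  next
    fix C assume "C \<in> ?R"
    then obtain B where B: "B \<in> BB" "e \<notin> E - B" "C = E - {e} - (E - B)" by blast
    then have "e \<in> B" "C = B - {e}" using assms bases_sub[OF B(1)] by auto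
    then show "C \<in> ?L" using B(1) by blast
  qed
  then show ?thesis
    by (simp add: contraction_def deletion_def dual_matroid_def matroid_of_pair_def)
qed

lemma sandpile_act_contraction:
  assumes tri: "triangulating rmat \<sigma> \<sigma>'" and e: "e \<in> E"
    and B: "B1 \<in> BB" "e \<in> B1" "B2 \<in> BB" "e \<in> B2"
    and a: "a \<in> chains E" "a e = 0" and v: "v \<in> V" and w: "w \<in> W" "w e = 0"
    and eq: "\<And>x. positive_part (bby rmat \<sigma> \<sigma>' B2) x - positive_part (bby rmat \<sigma> \<sigma>' B1) x - a x = v x + w x"
  shows "sandpile_act (contraction rmat e) (sig_contract rmat \<sigma> e) (cosig_contract rmat \<sigma>' e)
      (sandpile_class (contraction rmat e) a)
      (bby (contraction rmat e) (sig_contract rmat \<sigma> e) (cosig_contract rmat \<sigma>' e) (B1 - {e}))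
    = bby (contraction rmat e) (sig_contract rmat \<sigma> e) (cosig_contract rmat \<sigma>' e) (B2 - {e})"
proof -
  interpret D: regular_pair E "(\<lambda>B. E - B) ` BB" W V by (rule dual)
  have DB: "E - B1 \<in> (\<lambda>B. E - B) ` BB" "e \<notin> E - B1" "E - B2 \<in> (\<lambda>B. E - B) ` BB" "e \<notin> E - B2"
    using B by auto
  interpret N: regular_pair "E - {e}" "{B \<in> (\<lambda>B. E - B) ` BB. e \<notin> B}" "{v \<in> W. v e = 0}" "chain_restrict e ` V"
    by (rule D.deletion_pair[OF e DB(1,2)])
  have bby_eq: "bby D.rmat \<sigma>' \<sigma> (E - B) = bby rmat \<sigma> \<sigma>' B" if "B \<in> BB" for B
    using bby_dual[OF bases_sub[OF that]] by (simp add: dual_rmat)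
  have eq': "positive_part (bby D.rmat \<sigma>' \<sigma> (E - B2)) x - positive_part (bby D.rmat \<sigma>' \<sigma> (E - B1)) x - a x = w x + v x" for x
    using eq[of x] bby_eq B by simp
  have sig: "sig_contract rmat \<sigma> e = cosig_delete D.rmat \<sigma> e" "cosig_contract rmat \<sigma>' e = sig_delete D.rmat \<sigma>' e"
    by (simp_all add: sig_contract_def cosig_contract_def sig_delete_def cosig_delete_def
        contraction_eq_dual[OF e] dual_rmat)
  have con: "contraction rmat e = dual_matroid (deletion D.rmat e)" using contraction_eq_dual[OF e] by (simp add: dual_rmat)
  have bas: "B - {e} = E - {e} - (E - B)" "E - B \<subseteq> E - {e}" if "B \<in> BB" "e \<in> B" for B
    using bases_sub[OF that(1)] that(2) by auto
  have bby_con: "bby (contraction rmat e) (sig_contract rmat \<sigma> e) (cosig_contract rmat \<sigma>' e) (B - {e})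
      = bby (deletion D.rmat e) (sig_delete D.rmat \<sigma>' e) (cosig_delete D.rmat \<sigma> e) (E - B)"
    if "B \<in> BB" "e \<in> B" for B
    unfolding con sig D.deletion_rmat bas(1)[OF that] by (rule N.bby_dual[OF bas(2)[OF that], symmetric])
  have "triangulating D.rmat \<sigma>' \<sigma>" using triangulating_dual[OF tri] by (simp add: dual_rmat)
  from D.sandpile_act_deletion[OF this e DB a w v eq'] show ?thesis
    unfolding bby_con[OF B(1,2)] bby_con[OF B(3,4)]
    unfolding con sig D.deletion_rmat N.sandpile_dual .
qed

end

section \<open>Counting equivalence classes\<close>

text \<open>For \<open>k\<close> injective on the ground set this says that the coefficient at the
  largest element of the support is positive; it is the choice made by a lexicographic
  signature.\<close>

definition leading_positive :: "('e \<Rightarrow> nat) \<Rightarrow> 'e chain \<Rightarrow> bool" where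
  "leading_positive k u \<longleftrightarrow> (\<exists>x. u x > 0 \<and> (\<forall>y. u y \<noteq> 0 \<longrightarrow> k y \<le> k x))"

definition lex_orientations ::
    "('e \<Rightarrow> nat) \<Rightarrow> 'e set \<Rightarrow> 'e chain set \<Rightarrow> 'e chain set \<Rightarrow> 'e fourientation set" where
  "lex_orientations k E V W = {F \<in> orientations E.
     \<forall>u\<in>elementary V \<union> elementary W. chain_compatible u F \<longrightarrow> leading_positive k u}"

lemma lex_orientations_commute: "lex_orientations k E V W = lex_orientations k E W V"
  by (auto simp: lex_orientations_def)

lemma finite_orientations:
  assumes "finite E"
  shows "finite (orientations E)"
proof (rule inj_on_finite[of "\<lambda>F. {x \<in> E. 1 \<in> F x}" _ "Pow E"])
  show "inj_on (\<lambda>F. {x \<in> E. 1 \<in> F x}) (orientations E)"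
  proof (rule inj_onI)
    fix F F' assume FF: "F \<in> orientations E" "F' \<in> orientations E" "{x \<in> E. 1 \<in> F x} = {x \<in> E. 1 \<in> F' x}"
    have "positive_part F x = positive_part F' x" if "x \<in> E" for x
      using FF(3) that by (auto simp: positive_part_def)
    then show "F = F'" using orientation_eqI[OF FF(1,2)] by blast
  qed
qed (use assms in auto)

lemma flip_compatible:
  assumes F: "F \<in> orientations E" and e: "e \<in> E" and u: "chain_compatible u (reverse_on {e} F)" "u e = 0"
  shows "chain_compatible u F"
  using u by (auto simp: chain_compatible_def chain_supp_def reverse_on_def split: if_splits)

lemma reverse_on_involution: "reverse_on S (reverse_on S F) = F"
  by (auto simp: reverse_on_def fun_eq_iff image_image)

context regular_pair begin

text \<open>If flipping \<open>e\<close> in \<open>F\<close> keeps all signed circuits and cocircuits good, then one of the two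
  orientations is sent to the deletion of \<open>e\<close> and the other one to the contraction, as prescribed by
  \<open>s\<close>.  Otherwise the flip creates a bad signed circuit or a bad signed cocircuit, but not both, by
  orthogonality; without a bad cocircuit \<open>F\<close> survives in the deletion, without a bad circuit in the
  contraction.\<close>

definition flip_side :: "('e \<Rightarrow> nat) \<Rightarrow> 'e \<Rightarrow> int \<Rightarrow> 'e fourientation set" where
  "flip_side k e s = {F \<in> lex_orientations k E V W.
     (reverse_on {e} F \<in> lex_orientations k E V W \<and> F e = {s}) \<or>
     (reverse_on {e} F \<notin> lex_orientations k E V W \<and>
       (\<forall>w\<in>elementary W. chain_compatible w (reverse_on {e} F) \<longrightarrow> leading_positive k w))}"

text \<open>A cocircuit of the deletion lifts to one compatible with \<open>F\<close> or with its
  flip at \<open>e\<close>, and membership in the flip side makes both kinds good. As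
  \<open>e\<close> is smallest, removing it does not change the leading element.\<close>

lemma flip_side_deletion:
  assumes e: "e \<in> E" and min: "\<And>y. y \<in> E \<Longrightarrow> y \<noteq> e \<Longrightarrow> k e < k y" and F: "F \<in> flip_side k e s"
  shows "F(e := {}) \<in> lex_orientations k (E - {e}) {v \<in> V. v e = 0} (chain_restrict e ` W)"
proof -
  interpret D: regular_pair E "(\<lambda>B. E - B) ` BB" W V by (rule dual)
  have FO: "F \<in> orientations E" and FL: "F \<in> lex_orientations k E V W"
    using F by (auto simp: flip_side_def lex_orientations_def)
  have flip: "leading_positive k w" if "w \<in> elementary W" "chain_compatible w (reverse_on {e} F)" for w
    using F that unfolding flip_side_def lex_orientations_def by blast
  have "leading_positive k u" if u: "u \<in> elementary {v \<in> V. v e = 0}" "chain_compatible u (F(e := {}))" for u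
  proof -
    have "u \<in> elementary V" using u(1) by (simp add: elementary_deletion)
    moreover have "chain_compatible u F"
      using u(2) by (auto simp: chain_compatible_def split: if_splits)
    ultimately show ?thesis using FL by (auto simp: lex_orientations_def)
  qed
  moreover have "leading_positive k u"
    if u: "u \<in> elementary (chain_restrict e ` W)" "chain_compatible u (F(e := {}))" for u
  proof -
    obtain w where w: "w \<in> elementary W" "u = chain_restrict e w" using D.contraction_lift[OF u(1)] by blast
    have off: "sgn (w x) \<in> F x" if "w x \<noteq> 0" "x \<noteq> e" for x
      using u(2) w(2) that by (auto simp: chain_compatible_def chain_supp_def chain_restrict_apply split: if_splits)
    have "chain_compatible w F \<or> chain_compatible w (reverse_on {e} F)"
    proof (cases "w e \<noteq> 0 \<longrightarrow> sgn (w e) \<in> F e")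
      case True
      then have "chain_compatible w F" using off by (auto simp: chain_compatible_def chain_supp_def)
      then show ?thesis by blast
    next
      case False
      then have "w e = 1 \<or> w e = -1" using D.elementary_values[OF w(1), of e] by auto
      then have "sgn (w e) \<in> uminus ` F e" using False orientation_cases[OF FO e] by (elim disjE) simp_all
      then have "chain_compatible w (reverse_on {e} F)"
        using off by (auto simp: chain_compatible_def chain_supp_def reverse_on_def)
      then show ?thesis by blast
    qed
    then have "leading_positive k w" using FL flip w(1) by (auto simp: lex_orientations_def)
    then obtain x where x: "w x > 0" "\<And>y. w y \<noteq> 0 \<Longrightarrow> k y \<le> k x" by (auto simp: leading_positive_def)
    obtain y where y: "u y \<noteq> 0" using u(1) by (auto simp: elementary_def fun_eq_iff)
    then have ye: "y \<noteq> e" "w y \<noteq> 0" using w(2) by (auto simp: chain_restrict_apply split: if_splits)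
    have "y \<in> E" using D.V_supp[OF D.elementary_in[OF w(1)] ye(2)] .
    then have "k e < k x" using min[of y] ye x(2)[OF ye(2)] by simp
    then have "x \<noteq> e" by auto
    then have "u x > 0" using x(1) w(2) by (simp add: chain_restrict_apply)
    moreover have "k y \<le> k x" if "u y \<noteq> 0" for y
      using that x(2)[of y] w(2) by (auto simp: chain_restrict_apply split: if_splits)
    ultimately show ?thesis by (auto simp: leading_positive_def)
  qed
  moreover have "F(e := {}) \<in> orientations (E - {e})" using FO by (auto simp: orientations_def)
  ultimately show ?thesis unfolding lex_orientations_def by blast
qed

text \<open>Two members with the same restriction are flips of each other. Then both flips are good
  and both members carry the prescribed sign \<open>s\<close> at \<open>e\<close>.\<close>

lemma flip_side_inj:
  assumes e: "e \<in> E"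
  shows "inj_on (\<lambda>F. F(e := {})) (flip_side k e s)"
proof (rule inj_onI, rule ccontr)
  fix F F' assume F: "F \<in> flip_side k e s" "F' \<in> flip_side k e s" and eq: "F(e := {}) = F'(e := {})" and ne: "F \<noteq> F'"
  have FO: "F \<in> orientations E" "F' \<in> orientations E" using F by (auto simp: flip_side_def lex_orientations_def)
  have off: "F x = F' x" if "x \<noteq> e" for x using fun_cong[OF eq, of x] that by simp
  then have "F e \<noteq> F' e" using ne by (metis ext)
  then have opp: "F e = uminus ` F' e" using orientation_cases[OF FO(1) e] orientation_cases[OF FO(2) e] by auto
  have "F = reverse_on {e} F'" using off opp by (auto simp: reverse_on_def fun_eq_iff)
  moreover have "reverse_on {e} F = F'" using calculation by (simp add: reverse_on_involution)
  ultimately have "F e = {s}" "F' e = {s}" using F by (auto simp: flip_side_def)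
  then show False using \<open>F e \<noteq> F' e\<close> by simp
qed

lemma loop_chain:
  assumes e: "e \<in> E" and loop: "\<And>B. B \<in> BB \<Longrightarrow> e \<notin> B"
  shows "(\<lambda>x. if x = e then -1 else 0) \<in> elementary V"
proof -
  obtain B where B: "B \<in> BB" using bases_ne by blast
  then have eB: "e \<in> E - B" using e loop by blast
  obtain c where c: "c \<in> V" "c e = 1" "\<forall>y. c y \<noteq> 0 \<longrightarrow> y \<in> insert e B" "\<forall>y\<in>B. c y \<noteq> 0 \<longrightarrow> insert e (B - {y}) \<in> BB"
    using fund[OF B eB] by auto
  have "c y = 0" if "y \<noteq> e" for y using c(3,4) loop that by blast
  then have "(\<lambda>x. - c x) = (\<lambda>x. if x = e then -1 else 0)" using c(2) by (intro ext) simp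
  moreover have "c \<in> elementary V"
    using elementary_of_fundamental[OF B _ c(1)] eB c by (auto simp: chain_supp_def)
  then have "(\<lambda>x. - c x) \<in> elementary V" by (rule elementary_uminus)
  ultimately show ?thesis by simp
qed

lemma flip_side_coloop:
  assumes e: "e \<in> E" and coloop: "\<And>B. B \<in> BB \<Longrightarrow> e \<in> B"
  shows "flip_side k e s = {}"
proof -
  interpret D: regular_pair E "(\<lambda>B. E - B) ` BB" W V by (rule dual)
  have el: "(\<lambda>x. if x = e then -1 else 0) \<in> elementary W"
    using coloop by (intro D.loop_chain[OF e]) auto
  have neg: "\<not> leading_positive k (\<lambda>x. if x = e then -1 else 0)"
    by (auto simp: leading_positive_def split: if_splits)
  have "False" if F: "F \<in> flip_side k e s" for F
  proof -
    have FO: "F \<in> orientations E" and FL: "F \<in> lex_orientations k E V W"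
      using F by (auto simp: flip_side_def lex_orientations_def)
    have compat: "chain_compatible (\<lambda>x. if x = e then -1 else 0) G" if "G e = {-1}" for G
      using that by (auto simp: chain_compatible_def chain_supp_def split: if_splits)
    have "F e = {-1} \<or> reverse_on {e} F e = {-1}"
      using orientation_cases[OF FO e] by (elim disjE) (simp_all add: reverse_on_def)
    then show False
    proof
      assume "F e = {-1}"
      then show False using FL el neg compat unfolding lex_orientations_def by blast
    next
      assume "reverse_on {e} F e = {-1}"
      then show False using F el neg compat unfolding flip_side_def lex_orientations_def by blast
    qed
  qed
  then show ?thesis by blast
qed

text \<open>The induction hypothesis is a premise, so that the lemma can be used for the pair and,
  as a statement on contraction, for its dual.\<close>

lemma card_flip_side:
  assumes e: "e \<in> E" and min: "\<And>y. y \<in> E \<Longrightarrow> y \<noteq> e \<Longrightarrow> k e < k y"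
    and IH: "regular_pair (E - {e}) {B \<in> BB. e \<notin> B} {v \<in> V. v e = 0} (chain_restrict e ` W) \<Longrightarrow>
      card (lex_orientations k (E - {e}) {v \<in> V. v e = 0} (chain_restrict e ` W)) \<le> card {B \<in> BB. e \<notin> B}"
  shows "card (flip_side k e s) \<le> card {B \<in> BB. e \<notin> B}"
proof (cases "\<exists>B0\<in>BB. e \<notin> B0")
  case True
  then have pair: "regular_pair (E - {e}) {B \<in> BB. e \<notin> B} {v \<in> V. v e = 0} (chain_restrict e ` W)"
    using deletion_pair[OF e] by blast
  have "finite (lex_orientations k (E - {e}) {v \<in> V. v e = 0} (chain_restrict e ` W))"
    using finite_orientations[of "E - {e}"] finite_E by (auto simp: lex_orientations_def)
  then have "card (flip_side k e s) \<le> card (lex_orientations k (E - {e}) {v \<in> V. v e = 0} (chain_restrict e ` W))"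
    using flip_side_deletion[of e k, OF e min] by (intro card_inj_on_le[OF flip_side_inj[OF e]]) auto
  then show ?thesis using IH[OF pair] by simp
next
  case False
  then show ?thesis using flip_side_coloop[OF e] by auto
qed

text \<open>An orientation on neither side has a flip admitting a bad circuit and a bad cocircuit.
  Both contain \<open>e\<close>, since otherwise they would be compatible with \<open>F\<close>, and
  equal signs on common elements contradict orthogonality. The opposite signs 1 and -1 share out the
  pairs of good flips.\<close>

lemma lex_orientations_flip_sides:
  assumes e: "e \<in> E"
  shows "lex_orientations k E V W \<subseteq>
    flip_side k e 1 \<union> regular_pair.flip_side E W V k e (-1)"
proof
  interpret D: regular_pair E "(\<lambda>B. E - B) ` BB" W V by (rule dual)
  fix F assume F: "F \<in> lex_orientations k E V W"
  then have FO: "F \<in> orientations E" by (simp add: lex_orientations_def)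
  let ?R = "reverse_on {e} F"
  have R: "?R \<in> orientations E" using reverse_orientation[OF FO] .
  have D_def: "D.flip_side k e (-1) = {F \<in> lex_orientations k E V W.
     (reverse_on {e} F \<in> lex_orientations k E V W \<and> F e = {-1}) \<or>
     (reverse_on {e} F \<notin> lex_orientations k E V W \<and>
       (\<forall>w\<in>elementary V. chain_compatible w (reverse_on {e} F) \<longrightarrow> leading_positive k w))}"
    unfolding D.flip_side_def lex_orientations_commute[of k E W V] ..
  show "F \<in> flip_side k e 1 \<union> D.flip_side k e (-1)"
  proof (cases "?R \<in> lex_orientations k E V W")
    case True
    then show ?thesis using F orientation_cases[OF FO e] unfolding flip_side_def D_def by blast
  next
    case False
    show ?thesis
    proof (rule ccontr)
      assume "\<not> ?thesis"
      then obtain v w where v: "v \<in> elementary V" "chain_compatible v ?R" "\<not> leading_positive k v"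
        and w: "w \<in> elementary W" "chain_compatible w ?R" "\<not> leading_positive k w"
        using F False unfolding flip_side_def D_def by blast
      have "v e \<noteq> 0" "w e \<noteq> 0"
        using flip_compatible[OF FO e v(2)] flip_compatible[OF FO e w(2)] F v(1,3) w(1,3)
        by (auto simp: lex_orientations_def)
      have pos: "v x * w x > 0" if "v x \<noteq> 0" "w x \<noteq> 0" for x
      proof -
        have "sgn (v x) \<in> ?R x" "sgn (w x) \<in> ?R x"
          using v(2) w(2) that by (auto simp: chain_compatible_def chain_supp_def)
        moreover have "x \<in> E" using V_supp[OF elementary_in[OF v(1)] that(1)] .
        ultimately have "sgn (v x) = sgn (w x)" using orientation_cases[OF R] by force
        then show ?thesis
          using elementary_values[OF v(1), of x] D.elementary_values[OF w(1), of x] that by auto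
      qed
      then have "v x * w x \<ge> 0" for x by (cases "v x = 0 \<or> w x = 0") (auto intro: less_imp_le)
      then have "(\<Sum>x\<in>E. v x * w x) > 0"
        using pos \<open>v e \<noteq> 0\<close> \<open>w e \<noteq> 0\<close> e finite_E by (intro sum_pos2[of E e]) auto
      then show False using orth[OF elementary_in[OF v(1)] D.elementary_in[OF w(1)]] by simp
    qed
  qed
qed

lemma finite_bases: "finite BB"
  using bases_sub finite_E by (intro finite_subset[of BB "Pow E"]) auto

end

text \<open>Deletion and contraction of the smallest element split the bases into those avoiding and
  those containing it, and the two flip sides split the orientations accordingly.\<close>

lemma card_lex_orientations:
  assumes "regular_pair E BB V W" "inj_on k E"
  shows "card (lex_orientations k E V W) \<le> card BB"
  using assms
proof (induction "card E" arbitrary: E BB V W rule: less_induct)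
  case less
  interpret regular_pair E BB V W by (rule less(2))
  interpret D: regular_pair E "(\<lambda>B. E - B) ` BB" W V by (rule dual)
  show ?case
  proof (cases "E = {}")
    case True
    have "lex_orientations k E V W \<subseteq> {\<lambda>_. {}}"
      using True by (auto simp: lex_orientations_def orientations_def fun_eq_iff)
    then have "card (lex_orientations k E V W) \<le> 1"
      using card_mono[of "{\<lambda>_. {}}" "lex_orientations k E V W"] by simp
    also have "1 \<le> card BB" using bases_ne finite_bases by (simp add: card_gt_0_iff Suc_le_eq)
    finally show ?thesis .
  next
    case False
    obtain e where e: "e \<in> E" and le: "\<And>y. y \<in> E \<Longrightarrow> k e \<le> k y"
      using ex_min_if_finite[of "k ` E"] finite_E False by (force simp: not_less)
    have min: "k e < k y" if "y \<in> E" "y \<noteq> e" for y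
      using le[OF that(1)] less(3) that e by (metis inj_onD le_neq_implies_less)
    have lt: "card (E - {e}) < card E" using finite_E e by (rule card_Diff1_less)
    have inj: "inj_on k (E - {e})" using less(3) by (rule inj_on_subset) auto
    have c1: "card (flip_side k e 1) \<le> card {B \<in> BB. e \<notin> B}"
      using card_flip_side[of e k, OF e min] less(1)[OF lt _ inj] by blast
    have "card (D.flip_side k e (-1)) \<le> card {B \<in> (\<lambda>B. E - B) ` BB. e \<notin> B}"
      using D.card_flip_side[of e k, OF e min] less(1)[OF lt _ inj] by blast
    also have "\<dots> \<le> card {B \<in> BB. e \<in> B}"
    proof (rule surj_card_le[where f = "\<lambda>B. E - B"])
      show "finite {B \<in> BB. e \<in> B}" using finite_bases by simp
      show "{B \<in> (\<lambda>B. E - B) ` BB. e \<notin> B} \<subseteq> (\<lambda>B. E - B) ` {B \<in> BB. e \<in> B}" using e by auto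
    qed
    finally have c2: "card (D.flip_side k e (-1)) \<le> card {B \<in> BB. e \<in> B}" .
    have fin: "finite (flip_side k e 1)" "finite (D.flip_side k e (-1))"
      using finite_orientations[OF finite_E] by (auto simp: flip_side_def D.flip_side_def lex_orientations_def)
    have "card (lex_orientations k E V W) \<le> card (flip_side k e 1 \<union> D.flip_side k e (-1))"
      using lex_orientations_flip_sides[OF e] fin by (intro card_mono) auto
    also have "\<dots> \<le> card (flip_side k e 1) + card (D.flip_side k e (-1))" by (rule card_Un_le)
    also have "\<dots> \<le> card {B \<in> BB. e \<notin> B} + card {B \<in> BB. e \<in> B}" using c1 c2 by simp
    also have "\<dots> = card ({B \<in> BB. e \<notin> B} \<union> {B \<in> BB. e \<in> B})"
      using finite_bases by (intro card_Un_disjoint[symmetric]) auto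
    also have "{B \<in> BB. e \<notin> B} \<union> {B \<in> BB. e \<in> B} = BB" by auto
    finally show ?thesis .
  qed
qed

section \<open>Existence of compatible representatives\<close>

context regular_pair begin

text \<open>The weights are distinct powers of 2, so the leading coefficient -1 outweighs all
  smaller elements together.\<close>

lemma leading_negative_weight:
  assumes inj: "inj_on k E" and u: "u \<in> elementary V \<union> elementary W" "\<not> leading_positive k u"
  shows "(\<Sum>x\<in>E. 2 ^ k x * u x) < 0"
proof -
  note val = elementary_union_values[OF u(1)]
  have uE: "x \<in> E" if "u x \<noteq> 0" for x
  proof -
    have "u \<in> chains E" using elementary_union_lat[OF u(1)] lat_chains by blast
    then show ?thesis using that by (auto simp: chains_iff)
  qed
  have ne: "chain_supp u \<noteq> {}" using u(1) by (auto simp: elementary_def chain_supp_def)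
  have fin: "finite (chain_supp u)" using uE finite_E by (auto simp: chain_supp_def intro: finite_subset)
  obtain x where "x \<in> chain_supp u" "k x = Max (k ` chain_supp u)"
    using obtains_MAX[OF fin ne] by metis
  then have x: "u x \<noteq> 0" and max: "\<And>y. u y \<noteq> 0 \<Longrightarrow> k y \<le> k x"
    using fin by (auto simp: chain_supp_def)
  have "\<not> u x > 0" using u(2) max by (auto simp: leading_positive_def)
  then have ux: "u x = -1" using val[of x] x by auto
  let ?S = "chain_supp u - {x}"
  have lt: "k y < k x" if "y \<in> ?S" for y
  proof -
    have "k y \<le> k x" "y \<in> E" "y \<noteq> x" using that max uE by (auto simp: chain_supp_def)
    then show ?thesis using inj uE[OF x] by (metis inj_onD le_neq_implies_less)
  qed
  have sub: "?S \<subseteq> E" using uE by (auto simp: chain_supp_def)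
  have "(\<Sum>y\<in>?S. 2 ^ k y * u y) \<le> (\<Sum>y\<in>?S. 2 ^ k y)"
  proof (rule sum_mono)
    fix y show "2 ^ k y * u y \<le> 2 ^ k y" using val[of y] by auto
  qed
  also have "\<dots> = (\<Sum>i\<in>k ` ?S. 2 ^ i)" using inj_on_subset[OF inj sub] by (simp add: sum.reindex)
  also have "\<dots> \<le> (\<Sum>i<k x. 2 ^ i)" using lt by (intro sum_mono2) auto
  also have "\<dots> = 2 ^ k x - 1"
  proof -
    have "(\<Sum>i<n. 2 ^ i) = (2 :: int) ^ n - 1" for n by (induction n) auto
    then show ?thesis .
  qed
  finally have rest: "(\<Sum>y\<in>?S. 2 ^ k y * u y) \<le> 2 ^ k x - 1" .
  have "(\<Sum>y\<in>E. 2 ^ k y * u y) = (\<Sum>y\<in>chain_supp u. 2 ^ k y * u y)"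
    using uE finite_E by (intro sum.mono_neutral_right) (auto simp: chain_supp_def)
  also have "\<dots> = 2 ^ k x * u x + (\<Sum>y\<in>?S. 2 ^ k y * u y)"
    using fin x by (intro sum.remove) (auto simp: chain_supp_def)
  finally show ?thesis using rest ux by simp
qed

text \<open>Choose a member of the class whose positive part has the largest weight. Reversing a bad
  compatible chain would increase the weight, as reversal subtracts a chain of negative
  weight.\<close>

lemma lex_representative:
  assumes inj: "inj_on k E" and F: "F \<in> orientations E"
  shows "\<exists>G\<in>cc_class rmat F. G \<in> lex_orientations k E V W"
proof -
  define h where "h = (\<lambda>G. \<Sum>x\<in>E. 2 ^ k x * positive_part G x)"
  have fin: "finite (cc_class rmat F)"
    using finite_orientations[OF finite_E] by (rule finite_subset[rotated]) (auto simp: cc_class_rmat[OF F])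
  obtain G where G: "G \<in> cc_class rmat F" and hG: "h G = Max (h ` cc_class rmat F)"
    using obtains_MAX[OF fin] cc_class_self[OF F] by (metis empty_iff)
  have max: "h G' \<le> h G" if "G' \<in> cc_class rmat F" for G'
    using fin that unfolding hG by simp
  have GO: "G \<in> orientations E" and GF: "cc_class rmat G = cc_class rmat F" using cc_class_member[OF F G] by auto
  have "leading_positive k u" if u: "u \<in> elementary V \<union> elementary W" "chain_compatible u G" for u
  proof (rule ccontr)
    assume neg: "\<not> leading_positive k u"
    let ?G = "reverse_on (chain_supp u) G"
    have p: "positive_part ?G = (\<lambda>x. positive_part G x - u x)"
      by (rule positive_part_reverse[OF GO u(2) elementary_union_values[OF u(1)]])
    then have "(\<lambda>x. positive_part ?G x - positive_part G x) = (\<lambda>x. - u x)" by auto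
    then have "?G \<in> cc_class rmat F"
      using lat_uminus[OF elementary_union_lat[OF u(1)]] reverse_orientation[OF GO]
      by (simp add: cc_class_rmat[OF GO] flip: GF)
    then have "h ?G \<le> h G" by (rule max)
    moreover have "h ?G = h G - (\<Sum>x\<in>E. 2 ^ k x * u x)"
      unfolding h_def p by (simp add: right_diff_distrib sum_subtractf)
    ultimately show False using leading_negative_weight[OF inj u(1) neg] by simp
  qed
  then show ?thesis using G GO by (auto simp: lex_orientations_def)
qed

lemma card_cc_classes: "finite (cc_classes rmat) \<and> card (cc_classes rmat) \<le> card BB"
proof -
  obtain k :: "'e \<Rightarrow> nat" where k: "inj_on k E" using finite_imp_inj_to_nat_seg[OF finite_E] by blast
  have fin: "finite (lex_orientations k E V W)"
    using finite_orientations[OF finite_E] by (auto simp: lex_orientations_def)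
  have sub: "cc_classes rmat \<subseteq> cc_class rmat ` lex_orientations k E V W"
  proof
    fix C assume "C \<in> cc_classes rmat"
    then obtain F where F: "F \<in> orientations E" "C = cc_class rmat F" by (auto simp: cc_classes_rmat)
    obtain G where "G \<in> cc_class rmat F" "G \<in> lex_orientations k E V W" using lex_representative[OF k F(1)] by blast
    then show "C \<in> cc_class rmat ` lex_orientations k E V W" using F cc_class_member(2)[OF F(1)] by blast
  qed
  then have "card (cc_classes rmat) \<le> card (lex_orientations k E V W)" using fin by (intro surj_card_le) auto
  also have "\<dots> \<le> card BB" using card_lex_orientations[OF regular_pair_axioms k] .
  finally show ?thesis using sub fin finite_surj by blast
qed

lemma signature_no_opposite:
  assumes "triangulating rmat \<sigma> \<sigma>'"
  shows "u \<in> \<sigma> \<Longrightarrow> (\<lambda>x. - u x) \<notin> \<sigma>" "u \<in> \<sigma>' \<Longrightarrow> (\<lambda>x. - u x) \<notin> \<sigma>'"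
  using triangulating_rmat(3,4)[OF assms] signature_onD(2) by blast+

text \<open>Different bases give different classes, and there are at most as many classes as bases,
  so the map from bases to classes is onto.\<close>

lemma class_contains_bby:
  assumes tri: "triangulating rmat \<sigma> \<sigma>'" and C: "C \<in> cc_classes rmat"
  shows "\<exists>B\<in>BB. C = cc_class rmat (bby rmat \<sigma> \<sigma>' B)"
proof -
  note t = triangulating_rmat[OF tri]
  have orient: "bby rmat \<sigma> \<sigma>' B \<in> orientations E" if "B \<in> BB" for B using bby_orientation[OF t(3,4) that] .
  have "inj_on (\<lambda>B. cc_class rmat (bby rmat \<sigma> \<sigma>' B)) BB"
  proof (rule inj_onI)
    fix B B' assume B: "B \<in> BB" "B' \<in> BB" and eq: "cc_class rmat (bby rmat \<sigma> \<sigma>' B) = cc_class rmat (bby rmat \<sigma> \<sigma>' B')"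
    have "bby rmat \<sigma> \<sigma>' B' \<in> cc_class rmat (bby rmat \<sigma> \<sigma>' B)" unfolding eq by (rule cc_class_self[OF orient[OF B(2)]])
    then have "bby rmat \<sigma> \<sigma>' B = bby rmat \<sigma> \<sigma>' B'"
      using compatible_unique[OF signature_no_opposite[OF tri] bby_compatible[OF tri B(1)] bby_compatible[OF tri B(2)]]
      by (simp add: cc_class_rmat[OF orient[OF B(1)]])
    then show "B = B'" using bby_injective[OF tri B] by blast
  qed
  then have "card ((\<lambda>B. cc_class rmat (bby rmat \<sigma> \<sigma>' B)) ` BB) = card BB" by (rule card_image)
  moreover have "(\<lambda>B. cc_class rmat (bby rmat \<sigma> \<sigma>' B)) ` BB \<subseteq> cc_classes rmat"
    using orient unfolding cc_classes_rmat subset_iff by blast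
  ultimately have "(\<lambda>B. cc_class rmat (bby rmat \<sigma> \<sigma>' B)) ` BB = cc_classes rmat"
    using card_cc_classes by (intro card_seteq) auto
  then show ?thesis using C by blast
qed

text \<open>This turns the hypothesis on the action into a membership in \<open>lat\<close>: the
  description operator is defined because the translated class contains a BBY orientation.\<close>

lemma sandpile_act_difference:
  assumes tri: "triangulating rmat \<sigma> \<sigma>'" and F: "F \<in> orientations E" and c: "c \<in> chains E"
  shows "sandpile_act rmat \<sigma> \<sigma>' (sandpile_class rmat c) F \<in> translate_class F c"
proof -
  obtain B where B: "B \<in> BB" "translate_class F c = cc_class rmat (bby rmat \<sigma> \<sigma>' B)"
    using class_contains_bby[OF tri translate_class_in_classes[OF F c]] by blast
  have "bby rmat \<sigma> \<sigma>' B \<in> orientations E" using bby_orientation[OF triangulating_rmat(3,4)[OF tri] B(1)] .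
  then have mem: "bby rmat \<sigma> \<sigma>' B \<in> translate_class F c" unfolding B(2) by (rule cc_class_self)
  have "sandpile_act rmat \<sigma> \<sigma>' (sandpile_class rmat c) F = bby rmat \<sigma> \<sigma>' B"
    by (rule sandpile_act_iff[OF signature_no_opposite[OF tri] F c bby_compatible[OF tri B(1)] mem])
  then show ?thesis using mem by simp
qed

end

section \<open>Totally unimodular matrices\<close>

lemma submatrix_update:
  assumes "length js = r" "k < r"
  shows "replace_col (submatrix_of A [0..<r] js) (vec r (\<lambda>i. A i x)) k = submatrix_of A [0..<r] (js[k := x])"
  using assms by (intro eq_matI) (auto simp: replace_col_def submatrix_of_def nth_list_update)

text \<open>\<open>N\<close> is the inverse of the basis submatrix, so the sums with
  \<open>A i x\<close> are the coordinates of column \<open>x\<close>. By Cramer's rule each is a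
  quotient of two maximal minors, both in -1, 0, 1. The numerator is, up to sign, the minor of the
  exchanged set, so a nonzero coordinate permits the exchange.\<close>

lemma matrix_basis_coordinates:
  assumes tu: "totally_unimodular r E A" and js: "distinct js" "set js \<subseteq> E" "length js = r"
    and det: "det (submatrix_of A [0..<r] js) \<noteq> 0"
  shows "\<exists>N :: nat \<Rightarrow> nat \<Rightarrow> real.
    (\<forall>k<r. \<forall>j<r. (\<Sum>i<r. N k i * A i (js ! j)) = (if k = j then 1 else 0)) \<and>
    (\<forall>x\<in>E - set js. (\<forall>k<r. (\<Sum>i<r. N k i * A i x) \<in> {-1, 0, 1} \<and>
        ((\<Sum>i<r. N k i * A i x) \<noteq> 0 \<longrightarrow> insert x (set js - {js ! k}) \<in> bases_of_matrix r E A)) \<and>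
      (\<forall>i<r. A i x = (\<Sum>k<r. A i (js ! k) * (\<Sum>i<r. N k i * A i x))))"
proof -
  define M where "M = submatrix_of A [0..<r] js"
  have M: "M \<in> carrier_mat r r" using js by (simp add: M_def submatrix_of_def)
  have Mij: "M $$ (i, j) = A i (js ! j)" if "i < r" "j < r" for i j
    using that js by (simp add: M_def submatrix_of_def)
  have "M \<in> Units (ring_mat TYPE(real) r ())"
    using det_non_zero_imp_unit[OF M] det by (simp add: M_def)
  then obtain N where N: "N \<in> carrier_mat r r" "N * M = 1\<^sub>m r" "M * N = 1\<^sub>m r"
    by (auto simp: Units_def ring_mat_def)
  define n where "n = (\<lambda>k i. N $$ (k, i))"
  have left: "(\<Sum>i<r. n k i * A i (js ! j)) = (if k = j then 1 else 0)" if "k < r" "j < r" for k j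
  proof -
    have "(N * M) $$ (k, j) = (\<Sum>i<r. N $$ (k, i) * M $$ (i, j))"
      using N(1) M that by (simp add: scalar_prod_def atLeast0LessThan)
    then show ?thesis using N(2) that by (simp add: n_def Mij)
  qed
  have main: "(\<forall>k<r. (\<Sum>i<r. n k i * A i x) \<in> {-1, 0, 1} \<and>
        ((\<Sum>i<r. n k i * A i x) \<noteq> 0 \<longrightarrow> insert x (set js - {js ! k}) \<in> bases_of_matrix r E A)) \<and>
      (\<forall>i<r. A i x = (\<Sum>k<r. A i (js ! k) * (\<Sum>i<r. n k i * A i x)))"
    if x: "x \<in> E - set js" for x
  proof -
    define b where "b = vec r (\<lambda>i. A i x)"
    have b: "b \<in> carrier_vec r" by (simp add: b_def)
    define y where "y = N *\<^sub>v b"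
    have y: "y \<in> carrier_vec r" using N(1) b by (simp add: y_def)
    have yk: "y $ k = (\<Sum>i<r. n k i * A i x)" if "k < r" for k
      using that N(1) by (simp add: y_def b_def n_def scalar_prod_def atLeast0LessThan)
    have "M *\<^sub>v y = (M * N) *\<^sub>v b" unfolding y_def using M N(1) b by simp
    then have My: "M *\<^sub>v y = b" using N(3) b by simp
    have "A i x = (\<Sum>k<r. A i (js ! k) * (\<Sum>i<r. n k i * A i x))" if "i < r" for i
    proof -
      have "A i x = (M *\<^sub>v y) $ i" using My that by (simp add: b_def)
      also have "\<dots> = (\<Sum>k<r. M $$ (i, k) * y $ k)"
        using that M y by (simp add: scalar_prod_def atLeast0LessThan)
      finally show ?thesis using that by (simp add: Mij yk)
    qed
    moreover have "y $ k \<in> {-1, 0, 1} \<and> (y $ k \<noteq> 0 \<longrightarrow> insert x (set js - {js ! k}) \<in> bases_of_matrix r E A)"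
      if k: "k < r" for k
    proof -
      let ?js = "js[k := x]"
      have dist: "distinct ?js" using js x by (simp add: distinct_list_update)
      have set: "set ?js = insert x (set js - {js ! k})" using js k by (simp add: set_update_distinct)
      have sub: "set ?js \<subseteq> E" using set x js by auto
      have cr: "det (submatrix_of A [0..<r] ?js) = y $ k * det M"
        using cramer_lemma_mat[OF M y k] submatrix_update[OF js(3) k, of A x] unfolding My
        by (simp add: M_def b_def)
      have d1: "det (submatrix_of A [0..<r] ?js) \<in> {-1, 0, 1}"
        using tu dist sub js(3) unfolding totally_unimodular_def by (metis atLeast0LessThan atLeast_upt
            distinct_upt length_list_update length_upt minus_nat.diff_0 set_upt subset_refl)
      have d2: "det M \<in> {-1, 0, 1}"
        using tu js unfolding totally_unimodular_def M_def by (metis atLeast0LessThan atLeast_upt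
            distinct_upt length_upt minus_nat.diff_0 set_upt subset_refl)
      have "det M = 1 \<or> det M = -1" using d2 det by (auto simp: M_def)
      then have yv: "y $ k \<in> {-1, 0, 1}" using cr d1 by (elim disjE) auto
      have "insert x (set js - {js ! k}) \<in> bases_of_matrix r E A" if "y $ k \<noteq> 0"
      proof -
        have "det (submatrix_of A [0..<r] ?js) \<noteq> 0" using cr that det by (simp add: M_def)
        then show ?thesis unfolding set[symmetric] bases_of_matrix_def using dist sub js(3) by auto
      qed
      then show ?thesis using yv by blast
    qed
    ultimately show ?thesis using yk by auto
  qed
  show ?thesis using left main by (intro exI[of _ n]) blast
qed

text \<open>Fundamental circuits come from expanding a column in the basis columns, fundamental
  cocircuits from the rows of the inverse of the basis submatrix applied to the matrix.\<close>

lemma regular_pair_of_matrix: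
  assumes fin: "finite E" and tu: "totally_unimodular r E A" and ne: "bases_of_matrix r E A \<noteq> {}"
  shows "regular_pair E (bases_of_matrix r E A) {P \<in> chains E. in_kernel r E A P}
     {P \<in> chains E. in_row_space r E A P}"
proof
  show "finite E" "bases_of_matrix r E A \<noteq> {}" by fact+
  show "\<And>B. B \<in> bases_of_matrix r E A \<Longrightarrow> B \<subseteq> E" by (auto simp: bases_of_matrix_def)
  show "(\<lambda>_. 0) \<in> {P \<in> chains E. in_kernel r E A P}" by (simp add: chains_iff in_kernel_def)
  show "(\<lambda>_. 0) \<in> {P \<in> chains E. in_row_space r E A P}"
    by (auto simp: chains_iff in_row_space_def intro!: exI[of _ "\<lambda>_. 0"])
  show "(\<lambda>x. u x - v x) \<in> {P \<in> chains E. in_kernel r E A P}"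
    if "u \<in> {P \<in> chains E. in_kernel r E A P}" "v \<in> {P \<in> chains E. in_kernel r E A P}" for u v
    using that by (simp add: chains_iff in_kernel_def right_diff_distrib sum_subtractf)
  show "(\<lambda>x. u x - v x) \<in> {P \<in> chains E. in_row_space r E A P}"
    if uv: "u \<in> {P \<in> chains E. in_row_space r E A P}" "v \<in> {P \<in> chains E. in_row_space r E A P}" for u v
  proof -
    obtain c d where "\<forall>e\<in>E. of_int (u e) = (\<Sum>i<r. c i * A i e)" "\<forall>e\<in>E. of_int (v e) = (\<Sum>i<r. d i * A i e)"
      using uv by (auto simp: in_row_space_def)
    then have "\<forall>e\<in>E. of_int (u e - v e) = (\<Sum>i<r. (c i - d i) * A i e)"
      by (simp add: left_diff_distrib sum_subtractf)
    then have "in_row_space r E A (\<lambda>x. u x - v x)" unfolding in_row_space_def by (rule exI[of _ "\<lambda>i. c i - d i"])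
    then show ?thesis using uv by (simp add: chains_iff)
  qed
  show "(\<Sum>x\<in>E. v x * w x) = 0"
    if v: "v \<in> {P \<in> chains E. in_kernel r E A P}" and w: "w \<in> {P \<in> chains E. in_row_space r E A P}" for v w
  proof -
    obtain c where c: "\<forall>e\<in>E. of_int (w e) = (\<Sum>i<r. c i * A i e)" using w by (auto simp: in_row_space_def)
    have "of_int (\<Sum>x\<in>E. v x * w x) = (\<Sum>x\<in>E. of_int (v x) * (\<Sum>i<r. c i * A i x))" using c by simp
    also have "\<dots> = (\<Sum>x\<in>E. \<Sum>i<r. c i * (A i x * of_int (v x)))" by (simp add: sum_distrib_left mult_ac)
    also have "\<dots> = (\<Sum>i<r. \<Sum>x\<in>E. c i * (A i x * of_int (v x)))" by (rule sum.swap)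
    also have "\<dots> = (\<Sum>i<r. c i * (\<Sum>x\<in>E. A i x * of_int (v x)))" by (simp add: sum_distrib_left)
    also have "\<dots> = 0" using v by (simp add: in_kernel_def)
    finally show ?thesis unfolding of_int_eq_0_iff .
  qed
next
  fix B x assume "B \<in> bases_of_matrix r E A" and x: "x \<in> E - B"
  then obtain js where js: "distinct js" "set js \<subseteq> E" "length js = r" "det (submatrix_of A [0..<r] js) \<noteq> 0"
    and B: "B = set js" by (auto simp: bases_of_matrix_def)
  obtain N where N: "\<forall>k<r. (\<Sum>i<r. N k i * A i x) \<in> {-1, 0, 1} \<and>
        ((\<Sum>i<r. N k i * A i x) \<noteq> 0 \<longrightarrow> insert x (set js - {js ! k}) \<in> bases_of_matrix r E A)"
    "\<forall>i<r. A i x = (\<Sum>k<r. A i (js ! k) * (\<Sum>i<r. N k i * A i x))"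
    using matrix_basis_coordinates[OF tu js] x B by blast
  \<comment> \<open>The coordinates are reals that happen to be integers; rounding down converts
    their type without changing the value.\<close>
  define y where "y = (\<lambda>k. \<lfloor>\<Sum>i<r. N k i * A i x\<rfloor>)"
  have y: "of_int (y k) = (\<Sum>i<r. N k i * A i x)" "y k \<in> {-1, 0, 1}"
    "y k \<noteq> 0 \<Longrightarrow> insert x (set js - {js ! k}) \<in> bases_of_matrix r E A" if "k < r" for k
  proof -
    have "\<exists>m::int. (\<Sum>i<r. N k i * A i x) = of_int m \<and> m \<in> {-1, 0, 1}"
    proof -
      have "(\<Sum>i<r. N k i * A i x) \<in> of_int ` {-1, 0, 1}" using N(1) that by simp
      then show ?thesis by blast
    qed
    then obtain m :: int where m: "(\<Sum>i<r. N k i * A i x) = of_int m" "m \<in> {-1, 0, 1}" by blast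
    then have "y k = m" by (simp add: y_def)
    then show "of_int (y k) = (\<Sum>i<r. N k i * A i x)" "y k \<in> {-1, 0, 1}" using m by simp_all
    then show "y k \<noteq> 0 \<Longrightarrow> insert x (set js - {js ! k}) \<in> bases_of_matrix r E A"
      using N(1) that by force
  qed
  define idx where "idx = inv_into {..<r} (nth js)"
  have bij: "bij_betw (nth js) {..<r} (set js)" using bij_betw_nth[OF js(1)] js(3) by simp
  have idx: "idx (js ! k) = k" if "k < r" for k
    unfolding idx_def using bij that by (intro inv_into_f_f) (auto simp: bij_betw_def)
  have idx': "idx z < r \<and> js ! (idx z) = z" if "z \<in> set js" for z
    using that idx js(3) by (auto simp: in_set_conv_nth)
  \<comment> \<open>The column \<open>x\<close> minus its expansion in the basis columns;
    \<open>idx\<close> recovers the position of a basis element in the list.\<close>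
  define c where "c = (\<lambda>z. if z = x then 1 else if z \<in> set js then - y (idx z) else 0)"
  have xjs: "x \<notin> set js" using x B by simp
  have cval: "c z \<in> {-1, 0, 1}" for z using y(2)[of "idx z"] idx'[of z] by (auto simp: c_def)
  have "in_kernel r E A c" unfolding in_kernel_def
  proof (intro allI impI)
    fix i assume i: "i < r"
    have "(\<Sum>e\<in>E. A i e * of_int (c e)) = (\<Sum>e\<in>insert x (set js). A i e * of_int (c e))"
      using x js fin by (intro sum.mono_neutral_right) (auto simp: c_def)
    also have "\<dots> = A i x + (\<Sum>e\<in>set js. A i e * of_int (c e))" using xjs by (simp add: c_def)
    also have "(\<Sum>e\<in>set js. A i e * of_int (c e)) = (\<Sum>k<r. A i (js ! k) * of_int (c (js ! k)))"
      using sum.reindex_bij_betw[OF bij, of "\<lambda>e. A i e * of_int (c e)"] by simp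
    also have "\<dots> = (\<Sum>k<r. - (A i (js ! k) * (\<Sum>i<r. N k i * A i x)))"
    proof (rule sum.cong)
      fix k assume "k \<in> {..<r}"
      then have k: "k < r" by simp
      then have "js ! k \<in> set js" "js ! k \<noteq> x" using js(3) xjs by auto
      then have "c (js ! k) = - y k" using idx[OF k] by (simp add: c_def)
      then show "A i (js ! k) * of_int (c (js ! k)) = - (A i (js ! k) * (\<Sum>i<r. N k i * A i x))"
        using y(1)[OF k] by simp
    qed simp
    also have "\<dots> = - A i x" using N(2) i by (simp add: sum_negf)
    finally show "(\<Sum>e\<in>E. A i e * of_int (c e)) = 0" by simp
  qed
  moreover have "c \<in> chains E" using x js by (auto simp: chains_iff c_def)
  moreover have "\<forall>z. c z \<noteq> 0 \<longrightarrow> z \<in> insert x B" by (simp add: c_def B)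
  moreover have "\<forall>z\<in>B. c z \<noteq> 0 \<longrightarrow> insert x (B - {z}) \<in> bases_of_matrix r E A"
  proof (intro ballI impI)
    fix z assume z: "z \<in> B" "c z \<noteq> 0"
    then have "y (idx z) \<noteq> 0" using xjs B by (auto simp: c_def split: if_splits)
    then show "insert x (B - {z}) \<in> bases_of_matrix r E A" using y(3)[of "idx z"] idx'[of z] z B by auto
  qed
  moreover have "c x = 1" by (simp add: c_def)
  ultimately show "\<exists>c\<in>{P \<in> chains E. in_kernel r E A P}. c x = 1 \<and> (\<forall>y. c y \<in> {-1, 0, 1}) \<and>
      (\<forall>y. c y \<noteq> 0 \<longrightarrow> y \<in> insert x B) \<and> (\<forall>y\<in>B. c y \<noteq> 0 \<longrightarrow> insert x (B - {y}) \<in> bases_of_matrix r E A)"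
    using cval by blast
next
  fix B z assume "B \<in> bases_of_matrix r E A" and z: "z \<in> B"
  then obtain js where js: "distinct js" "set js \<subseteq> E" "length js = r" "det (submatrix_of A [0..<r] js) \<noteq> 0"
    and B: "B = set js" by (auto simp: bases_of_matrix_def)
  obtain N where "\<forall>k<r. \<forall>j<r. (\<Sum>i<r. N k i * A i (js ! j)) = (if k = j then 1 else 0)"
    "\<forall>x\<in>E - set js. \<forall>k<r. (\<Sum>i<r. N k i * A i x) \<in> {-1, 0, 1} \<and>
        ((\<Sum>i<r. N k i * A i x) \<noteq> 0 \<longrightarrow> insert x (set js - {js ! k}) \<in> bases_of_matrix r E A)"
    using matrix_basis_coordinates[OF tu js] by blast
  then have N: "\<And>k j. k < r \<Longrightarrow> j < r \<Longrightarrow> (\<Sum>i<r. N k i * A i (js ! j)) = (if k = j then 1 else 0)"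
    "\<And>x k. x \<in> E - set js \<Longrightarrow> k < r \<Longrightarrow> (\<Sum>i<r. N k i * A i x) \<in> {-1, 0, 1} \<and>
        ((\<Sum>i<r. N k i * A i x) \<noteq> 0 \<longrightarrow> insert x (set js - {js ! k}) \<in> bases_of_matrix r E A)"
    by blast+
  obtain k where k: "k < r" "js ! k = z" using z B js(3) by (auto simp: in_set_conv_nth)
  \<comment> \<open>Row \<open>k\<close> of the inverse times the matrix is a row vector that is 1
    at the basis element in position \<open>k\<close> and 0 at the other basis elements.\<close>
  define h where "h = (\<lambda>x. \<Sum>i<r. N k i * A i x)"
  have hB: "h x = (if x = z then 1 else 0)" if "x \<in> B" for x
  proof -
    obtain j where j: "j < r" "js ! j = x" using \<open>x \<in> B\<close> B js(3) by (auto simp: in_set_conv_nth)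
    then have "x = z \<longleftrightarrow> k = j" using k js nth_eq_iff_index_eq by metis
    then show ?thesis using N(1)[OF k(1) j(1)] j by (simp add: h_def)
  qed
  have hN: "h x \<in> {-1, 0, 1}" "h x \<noteq> 0 \<Longrightarrow> insert x (B - {z}) \<in> bases_of_matrix r E A" if "x \<in> E - B" for x
    using N(2)[of x k] that k B by (auto simp: h_def)
  have hval: "\<exists>m::int. h x = of_int m \<and> m \<in> {-1, 0, 1}" if "x \<in> E" for x
  proof -
    have "h x \<in> of_int ` {-1, 0, 1}" using hB[of x] hN(1)[of x] that by (cases "x \<in> B") simp_all
    then show ?thesis by blast
  qed
  define c where "c = (\<lambda>x. if x \<in> E then \<lfloor>h x\<rfloor> else 0)"
  have cE: "of_int (c x) = h x \<and> c x \<in> {-1, 0, 1}" if x: "x \<in> E" for x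
  proof -
    obtain m :: int where "h x = of_int m" "m \<in> {-1, 0, 1}" using hval[OF x] by blast
    moreover from this have "c x = m" using x by (simp add: c_def)
    ultimately show ?thesis by simp
  qed
  have cval: "c x \<in> {-1, 0, 1}" for x
  proof (cases "x \<in> E")
    case True
    then show ?thesis using cE by blast
  qed (simp add: c_def)
  have "in_row_space r E A c" unfolding in_row_space_def using cE by (auto simp: h_def intro!: exI[of _ "N k"])
  moreover have "c \<in> chains E" by (simp add: chains_iff c_def)
  moreover have zE: "z \<in> E" using z B js by auto
  moreover have "c z = 1" using hB[OF z] zE by (simp add: c_def)
  moreover have "\<forall>x. c x \<noteq> 0 \<longrightarrow> x \<in> insert z (E - B)" using hB by (auto simp: c_def split: if_splits)
  moreover have "\<forall>x\<in>E - B. c x \<noteq> 0 \<longrightarrow> insert x (B - {z}) \<in> bases_of_matrix r E A"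
  proof (intro ballI impI)
    fix x assume x: "x \<in> E - B" "c x \<noteq> 0"
    have "h x = of_int (c x)" using cE x(1) by simp
    then show "insert x (B - {z}) \<in> bases_of_matrix r E A" using hN(2)[OF x(1)] x(2) by simp
  qed
  ultimately show "\<exists>c\<in>{P \<in> chains E. in_row_space r E A P}. c z = 1 \<and> (\<forall>x. c x \<in> {-1, 0, 1}) \<and>
      (\<forall>x. c x \<noteq> 0 \<longrightarrow> x \<in> insert z (E - B)) \<and> (\<forall>x\<in>E - B. c x \<noteq> 0 \<longrightarrow> insert x (B - {z}) \<in> bases_of_matrix r E A)"
    using cval by blast
qed auto

lemma matroid_of_matrix_eq:
  assumes "regular_pair E (bases_of_matrix r E A) {P \<in> chains E. in_kernel r E A P}
     {P \<in> chains E. in_row_space r E A P}"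
  shows "matroid_of_matrix r E A = matroid_of_pair E (bases_of_matrix r E A)
     {P \<in> chains E. in_kernel r E A P} {P \<in> chains E. in_row_space r E A P}"
proof -
  interpret regular_pair E "bases_of_matrix r E A" "{P \<in> chains E. in_kernel r E A P}"
     "{P \<in> chains E. in_row_space r E A P}" by (rule assms)
  have "simple_chain E P \<Longrightarrow> P \<in> chains E" for P by (simp add: simple_chain_def)
  then show ?thesis
    unfolding matroid_of_matrix_def matroid_of_pair_def Let_def signed_circuits_eq[symmetric]
      regular_pair.signed_circuits_eq[OF dual, symmetric] cocircuits_of_bases
    by (auto)
qed

section \<open>From the action to the decomposition of the difference\<close>

context regular_pair begin

lemma component_rmat:
  assumes "x \<in> E"
  shows "component rmat x = {y \<in> E. linked x y}"
  using assms unfolding component_def circuits_rmat rmat_simps linked_def chain_supp_def by auto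

lemma bby_difference:
  assumes tri: "triangulating rmat \<sigma> \<sigma>'" and a: "a = (\<lambda>x. if x = f then s else 0)" "s = 1 \<or> s = -1"
    and f: "f \<in> E" and B: "B1 \<in> BB" "B2 \<in> BB"
    and act: "sandpile_act rmat \<sigma> \<sigma>' (sandpile_class rmat a) (bby rmat \<sigma> \<sigma>' B1) = bby rmat \<sigma> \<sigma>' B2"
  obtains v w where "v \<in> V" "w \<in> W"
    "\<And>x. positive_part (bby rmat \<sigma> \<sigma>' B2) x - positive_part (bby rmat \<sigma> \<sigma>' B1) x - a x = v x + w x"
    "\<And>e. e \<notin> B1 \<Longrightarrow> e \<notin> B2 \<Longrightarrow> e \<noteq> f \<Longrightarrow> v e = 0" "\<And>e. e \<in> B1 \<Longrightarrow> e \<in> B2 \<Longrightarrow> e \<noteq> f \<Longrightarrow> w e = 0"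
    "\<And>e. e \<in> E \<Longrightarrow> (e \<in> B1) \<noteq> (e \<in> B2) \<Longrightarrow> linked e f"
proof -
  interpret D: regular_pair E "(\<lambda>B. E - B) ` BB" W V by (rule dual)
  define o1 where "o1 = orientation_sign (bby rmat \<sigma> \<sigma>' B1)"
  define o2 where "o2 = orientation_sign (bby rmat \<sigma> \<sigma>' B2)"
  have o1: "o1 x = 1 \<or> o1 x = -1" and o2: "o2 x = 1 \<or> o2 x = -1" for x
    unfolding o1_def o2_def by (rule orientation_sign_values)+
  have aE: "a \<in> chains E" using a f by (simp add: chains_iff)
  have "bby rmat \<sigma> \<sigma>' B2 \<in> translate_class (bby rmat \<sigma> \<sigma>' B1) a"
    using sandpile_act_difference[OF tri bby_orientation[OF triangulating_rmat(3,4)[OF tri] B(1)] aE] act by simp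
  then obtain v w where vw: "v \<in> V" "w \<in> W"
    "(\<lambda>x. positive_part (bby rmat \<sigma> \<sigma>' B2) x - positive_part (bby rmat \<sigma> \<sigma>' B1) x - a x) = (\<lambda>x. v x + w x)"
    by (auto simp: translate_class_def lattice_sum_def)
  have eq: "positive_part (bby rmat \<sigma> \<sigma>' B2) x - positive_part (bby rmat \<sigma> \<sigma>' B1) x - a x = v x + w x" for x
    using vw(3) by (rule fun_cong)
  have eqo: "2 * (v x + w x + (if x = f then s else 0)) = o2 x - o1 x" for x
    using eq[of x] by (simp add: o1_def o2_def orientation_sign_def a(1))
  have main: "(\<forall>e. e \<notin> B1 \<longrightarrow> e \<notin> B2 \<longrightarrow> e \<noteq> f \<longrightarrow> v e = 0) \<and>
    (\<forall>e. e \<in> B1 \<longrightarrow> e \<in> B2 \<longrightarrow> e \<noteq> f \<longrightarrow> w e = 0) \<and>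
    (\<forall>e\<in>E. (e \<in> B1) \<noteq> (e \<in> B2) \<longrightarrow> linked e f)"
  proof (cases "B1 = B2")
    case True
    then have "o1 = o2" by (simp add: o1_def o2_def)
    \<comment> \<open>Separation is only available for distinct bases. For equal ones the sum
      \<open>v + w\<close> is the negative of the arc, and disjoint supports leave nothing off
      \<open>f\<close>.\<close>
    then have sum0: "v x + w x = (if x = f then - s else 0)" for x using eqo[of x] by auto
    have "v x * w x \<le> 0" for x
    proof (rule ccontr)
      assume "\<not> v x * w x \<le> 0"
      then have "(v x > 0 \<and> w x > 0) \<or> (v x < 0 \<and> w x < 0)" by (auto simp: not_le zero_less_mult_iff)
      then show False using sum0[of x] a(2) by (auto split: if_splits)
    qed
    then have "v x * w x = 0" if "x \<in> E" for x
      using sum_nonpos_zeroD[OF finite_E, of "\<lambda>x. v x * w x"] orth[OF vw(1,2)] that by blast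
    then have "v x = 0 \<or> w x = 0" for x using V_supp[OF vw(1)] by fastforce
    then have "v x = 0 \<and> w x = 0" if "x \<noteq> f" for x using sum0[of x] that by (metis add_0 add.right_neutral)
    then show ?thesis using True by blast
  next
    case False
    note sep = separated_bby[OF tri B False, folded o1_def o2_def]
    have core: "(\<forall>e. e \<notin> B1 \<longrightarrow> e \<notin> B2 \<longrightarrow> e \<noteq> f \<longrightarrow> v e = 0) \<and>
      (\<forall>e. e \<in> B1 \<longrightarrow> e \<in> B2 \<longrightarrow> e \<noteq> f \<longrightarrow> w e = 0) \<and> (\<forall>x\<in>E. o1 x \<noteq> o2 x \<longrightarrow> linked x f)"
      by (rule core[OF B o1 o2 sep vw(1,2) f a(2) eqo])
    have "linked e f" if e: "e \<in> E" "(e \<in> B1) \<noteq> (e \<in> B2)" for e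
    proof -
      have "e \<in> B1 - B2 \<or> e \<in> B2 - B1" using e(2) by blast
      then obtain q where q: "q \<in> elementary V" "q e \<noteq> 0" "\<And>x. q x \<noteq> 0 \<Longrightarrow> x \<in> B1 \<union> B2 \<and>
          (x \<in> B1 - B2 \<longrightarrow> q x = o1 x) \<and> (x \<in> B2 - B1 \<longrightarrow> q x = - o2 x)"
        using exchange_chain[OF B o1 o2 sep(2)] by blast
      have sg: "sgn (q x) = q x" for x using elementary_values[OF q(1), of x] by auto
      \<comment> \<open>If the orientations agreed on the support of \<open>q\<close>, the signs of
        \<open>q\<close> would be those excluded by separation in \<open>V\<close>.\<close>
      have "\<exists>x. q x \<noteq> 0 \<and> o1 x \<noteq> o2 x"
      proof (rule ccontr)
        assume "\<not> ?thesis"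
        then have same: "q x \<noteq> 0 \<Longrightarrow> o1 x = o2 x" for x by blast
        have "q e = 0"
          by (rule separatedD[OF sep(1) elementary_in[OF q(1)]]) (use q(3) same in \<open>auto simp: sg\<close>)
        then show False using q(2) by simp
      qed
      then obtain x where x: "q x \<noteq> 0" "o1 x \<noteq> o2 x" by blast
      have "linked e x" using q(1,2) x(1) by (auto simp: linked_def)
      moreover have "linked x f" using core x V_supp[OF elementary_in[OF q(1)] x(1)] by blast
      ultimately show ?thesis by (rule linked_trans)
    qed
    then show ?thesis using core by blast
  qed
  show thesis by (rule that[OF vw(1,2) eq]) (use main in blast)+
qed

end

section \<open>Consistency\<close>

theorem theorem1p1:
  fixes A :: "nat \<Rightarrow> 'e \<Rightarrow> real" and r :: nat and E :: "'e set"
    and M :: "'e signed_matroid"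
    and \<sigma> \<sigma>' :: "'e chain set"
    and a :: "'e chain" and f :: 'e and B1 B2 :: "'e set"
  assumes "finite E"
    and "totally_unimodular r E A"
    and "full_row_rank r E A"
    and "M = matroid_of_matrix r E A"
    and "triangulating M \<sigma> \<sigma>'"
    and "is_arc E a" and "chain_supp a = {f}"
    and "B1 \<in> bases M" and "B2 \<in> bases M"
    and "sandpile_act M \<sigma> \<sigma>' (sandpile_class M a) (bby M \<sigma> \<sigma>' B1) = bby M \<sigma> \<sigma>' B2"
  shows
    "(\<forall>e \<in> (E - (B1 \<union> B2)) - {f}.
        sandpile_act (deletion M e) (sig_delete M \<sigma> e) (cosig_delete M \<sigma>' e)
          (sandpile_class (deletion M e) a)
          (bby (deletion M e) (sig_delete M \<sigma> e) (cosig_delete M \<sigma>' e) B1)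
        = bby (deletion M e) (sig_delete M \<sigma> e) (cosig_delete M \<sigma>' e) B2) \<and>
     (\<forall>e \<in> (B1 \<inter> B2) - {f}.
        sandpile_act (contraction M e) (sig_contract M \<sigma> e) (cosig_contract M \<sigma>' e)
          (sandpile_class (contraction M e) a)
          (bby (contraction M e) (sig_contract M \<sigma> e) (cosig_contract M \<sigma>' e) (B1 - {e}))
        = bby (contraction M e) (sig_contract M \<sigma> e) (cosig_contract M \<sigma>' e) (B2 - {e})) \<and>
     (\<forall>e \<in> E. component M e \<noteq> component M f \<longrightarrow> (e \<in> B1 \<longleftrightarrow> e \<in> B2))"
proof -
  define BB where "BB = bases_of_matrix r E A"
  define V where "V = {P \<in> chains E. in_kernel r E A P}"
  define W where "W = {P \<in> chains E. in_row_space r E A P}"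
  have "bases M = BB" using assms(4) by (simp add: matroid_of_matrix_def BB_def Let_def)
  then have B: "B1 \<in> BB" "B2 \<in> BB" using assms(8,9) by auto
  then have "bases_of_matrix r E A \<noteq> {}" by (auto simp: BB_def)
  note pair = regular_pair_of_matrix[OF assms(1,2) this, folded BB_def V_def W_def]
  have M: "M = matroid_of_pair E BB V W"
    using matroid_of_matrix_eq[of E r A, folded BB_def V_def W_def, OF pair] assms(4) by simp
  interpret regular_pair E BB V W by (rule pair)
  obtain g s where gs: "g \<in> E" "s = 1 \<or> s = -1" "a = (\<lambda>x. if x = g then s else 0)"
    using is_arc_form[OF assms(6)] .
  have "g = f" using assms(7) gs by (auto simp: chain_supp_def split: if_splits)
  then have a: "a = (\<lambda>x. if x = f then s else 0)" and f: "f \<in> E" using gs by auto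
  have tri: "triangulating rmat \<sigma> \<sigma>'"
    and act: "sandpile_act rmat \<sigma> \<sigma>' (sandpile_class rmat a) (bby rmat \<sigma> \<sigma>' B1) = bby rmat \<sigma> \<sigma>' B2"
    using assms(5,10) unfolding M .
  obtain v w where vw: "v \<in> V" "w \<in> W"
    and eq: "\<And>x. positive_part (bby rmat \<sigma> \<sigma>' B2) x - positive_part (bby rmat \<sigma> \<sigma>' B1) x - a x = v x + w x"
    and zero: "\<And>e. e \<notin> B1 \<Longrightarrow> e \<notin> B2 \<Longrightarrow> e \<noteq> f \<Longrightarrow> v e = 0" "\<And>e. e \<in> B1 \<Longrightarrow> e \<in> B2 \<Longrightarrow> e \<noteq> f \<Longrightarrow> w e = 0"
    and link: "\<And>e. e \<in> E \<Longrightarrow> (e \<in> B1) \<noteq> (e \<in> B2) \<Longrightarrow> linked e f"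
    by (rule bby_difference[OF tri a gs(2) f B act]) blast
  have aE: "a \<in> chains E" using a f by (simp add: chains_iff)
  show ?thesis unfolding M
  proof (intro conjI ballI impI, goal_cases)
    case (1 e)
    then have e: "e \<in> E" "e \<notin> B1" "e \<notin> B2" "a e = 0" "v e = 0" using zero a by auto
    show ?case by (rule sandpile_act_deletion[OF tri e(1) B(1) e(2) B(2) e(3) aE e(4) vw(1) e(5) vw(2) eq])
  next
    case (2 e)
    then have e: "e \<in> E" "e \<in> B1" "e \<in> B2" "a e = 0" "w e = 0" using zero a bases_sub[OF B(1)] by auto
    show ?case by (rule sandpile_act_contraction[OF tri e(1) B(1) e(2) B(2) e(3) aE e(4) vw(1,2) e(5) eq])
  next
    case (3 e)
    \<comment> \<open>For linked elements, symmetry and transitivity would make the two components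
      equal.\<close>
    have "\<not> linked e f"
      using 3(2) linked_trans linked_sym unfolding component_rmat[OF 3(1)] component_rmat[OF f] by blast
    then show ?case using link[OF 3(1)] by blast
  qed
qed

end
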